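(* Let $H$ be a real or complex separable Hilbert space, $I=[0,1]$, and let $h:I\times I\rightarrow\mathcal{CF}^{\mathrm{sa}}(H)$ be a homotopy of selfadjoint Fredholm operators (i.e. a map that is continuous with respect to the gap-metric). Then $$\operatorname{sf}(h(0,\cdot))=\operatorname{sf}(h(\cdot,0))+\operatorname{sf}(h(1,\cdot))-\operatorname{sf}(h(\cdot,1)),$$ where $h(s,\cdot)$ denotes the path $\lambda\mapsto h(s,\lambda)$ and $h(\cdot,\lambda)$ denotes the path $s\mapsto h(s,\lambda)$.
   Context: Let $\mathcal{C}(H)$ be the set of densely defined closed operators on $H$ with the gap-metric $d_G(T,S)=\|P_T-P_S\|$, where $P_T,P_S$ are the orthogonal projections in $H\times H$ onto the graphs of $T,S$. $\mathcal{CF}^{\mathrm{sa}}(H)\subset\mathcal{C}(H)$ is the subspace of (generally unbounded) selfadjoint Fredholm operators. For $T\in\mathcal{CF}^{\mathrm{sa}}(H)$, $\chi_{[a,b]}(T)$ denotes the spectral projection of $T$ for the interval $[a,b]$, and $\sigma(T)$, $\sigma_{ess}(T)$ are the spectrum and the essential spectrum of $T$. Spectral flow: for a (gap-continuous) path $\mathcal{A}=\{\mathcal{A}_\lambda\}_{\lambda\in I}$ in $\mathcal{CF}^{\mathrm{sa}}(H)$ there are a partition $0=\lambda_0<\lambda_1<\dots<\lambda_N=1$ and numbers $a_i>0$ such that $\pm a_i\notin\sigma(\mathcal{A}_\lambda)$ and $[-a_i,a_i]\cap\sigma_{ess}(\mathcal{A}_\lambda)=\emptyset$ for all $\lambda\in[\lambda_{i-1},\lambda_i]$,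 and $\lambda\mapsto\chi_{[-a_i,a_i]}(\mathcal{A}_\lambda)$ is norm-continuous on $[\lambda_{i-1},\lambda_i]$, $i=1,\dots,N$. The spectral flow is the integer $$\operatorname{sf}(\mathcal{A})=\sum_{i=1}^N\left(\dim\operatorname{im}\chi_{[0,a_i]}(\mathcal{A}_{\lambda_i})-\dim\operatorname{im}\chi_{[0,a_i]}(\mathcal{A}_{\lambda_{i-1}})\right),$$ which is independent of the choice of partition and of the numbers $a_i$. *)

theory Defs
  imports "HOL-Analysis.Analysis"
begin

section \<open>The scalar field\<close>

text \<open>
  The field of scalars is the field of real or of complex numbers.  The embedding
  \<^term>\<open>to_complex\<close> is an isomorphism of normed real algebras onto one of these two
  subfields of the complex numbers; it gives access to conjugation and real part.
\<close>

class real_or_complex = real_normed_field +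
  fixes to_complex :: "'a \<Rightarrow> complex"
  assumes to_complex_add: "to_complex (x + y) = to_complex x + to_complex y"
    and to_complex_mult: "to_complex (x * y) = to_complex x * to_complex y"
    and to_complex_scaleR: "to_complex (scaleR r x) = scaleR r (to_complex x)"
    and norm_to_complex: "norm (to_complex x) = norm x"
    and range_to_complex: "range to_complex = \<real> \<or> range to_complex = UNIV"

instantiation real :: real_or_complex
begin
definition to_complex_real :: "real \<Rightarrow> complex" where "to_complex_real = complex_of_real"
instance
  by standard (auto simp: to_complex_real_def Reals_def scaleR_conv_of_real)
end

instantiation complex :: real_or_complex
begin
definition to_complex_complex :: "complex \<Rightarrow> complex" where "to_complex_complex = id"
instance
  by standard (auto simp: to_complex_complex_def)
end


section \<open>Hilbert spaces\<close>

text \<open>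
  A Hilbert space over \<^typ>\<open>'k\<close> with scalar multiplication \<open>scale\<close> and inner product \<open>ip\<close>
  (linear in the first, conjugate linear in the second argument).  The type class structure of
  the carrier is that of the underlying real Hilbert space, whose inner product is the real
  part of \<open>ip\<close>; in particular \<open>norm x ^ 2 = ip x x\<close>.  On pairs, the library norm is the
  Hilbert space norm of the orthogonal sum.
\<close>

locale hilbert_space = vector_space scale
  for scale :: "'k::real_or_complex \<Rightarrow> 'a::{real_inner,banach} \<Rightarrow> 'a" +
  fixes ip :: "'a \<Rightarrow> 'a \<Rightarrow> 'k"
  assumes scale_of_real: "scale (of_real r) x = scaleR r x"
    and ip_add_left: "ip (x + y) z = ip x z + ip y z"
    and ip_scale_left: "ip (scale c x) y = c * ip x y"
    and ip_commute: "to_complex (ip x y) = cnj (to_complex (ip y x))"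
    and Re_ip: "Re (to_complex (ip x y)) = inner x y"

lemma hilbert_space_real:
  "hilbert_space (scaleR :: real \<Rightarrow> 'a::{real_inner,banach} \<Rightarrow> 'a) inner"
  by unfold_locales
     (auto simp: algebra_simps inner_commute to_complex_real_def)

lemma hilbert_space_complex:
  "hilbert_space ((*) :: complex \<Rightarrow> complex \<Rightarrow> complex) (\<lambda>x y. x * cnj y)"
  by unfold_locales
     (auto simp: algebra_simps scaleR_conv_of_real to_complex_complex_def inner_complex_def)

locale separable_hilbert_space = hilbert_space scale ip
  for scale :: "'k::real_or_complex \<Rightarrow> 'a::{real_inner,banach} \<Rightarrow> 'a" and ip +
  assumes separable: "separable_space (euclidean :: 'a topology)"

text \<open>
  \<open>P\<close> is an orthogonal projection with respect to the form \<open>B\<close>.  Linearity of \<open>P\<close> over the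
  scalars follows from its symmetry.
\<close>

definition is_orth_proj :: "('b \<Rightarrow> 'b \<Rightarrow> 'k) \<Rightarrow> ('b::real_normed_vector \<Rightarrow>\<^sub>L 'b) \<Rightarrow> bool" where
  "is_orth_proj B P \<longleftrightarrow>
     P o\<^sub>L P = P \<and> (\<forall>x y. B (blinfun_apply P x) y = B x (blinfun_apply P y))"


section \<open>Closed, selfadjoint and Fredholm operators\<close>

text \<open>
  Unbounded operators are partial maps: \<^term>\<open>dom T\<close>, \<^term>\<open>ran T\<close> and \<^term>\<open>Map.graph T\<close> are
  the domain, the image and the graph of \<open>T\<close>.
\<close>

context hilbert_space
begin

definition linear_op :: "('a \<rightharpoonup> 'a) \<Rightarrow> bool" where
  "linear_op T \<longleftrightarrow> subspace (dom T) \<and>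
     (\<forall>x\<in>dom T. \<forall>y\<in>dom T. the (T (x + y)) = the (T x) + the (T y)) \<and>
     (\<forall>c. \<forall>x\<in>dom T. the (T (scale c x)) = scale c (the (T x)))"

definition closed_ops :: "('a \<rightharpoonup> 'a) set" where
  "closed_ops = {T. linear_op T \<and> closure (dom T) = UNIV \<and> closed (Map.graph T)}"

definition adjoint :: "('a \<rightharpoonup> 'a) \<Rightarrow> ('a \<rightharpoonup> 'a)" where
  "adjoint T = (\<lambda>y.
     if \<exists>z. \<forall>x\<in>dom T. ip (the (T x)) y = ip x z
     then Some (THE z. \<forall>x\<in>dom T. ip (the (T x)) y = ip x z)
     else None)"

text \<open>Finite-dimensional kernel and cokernel; for closed operators the image is then closed.\<close>

definition fredholm :: "('a \<rightharpoonup> 'a) \<Rightarrow> bool" where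
  "fredholm T \<longleftrightarrow>
     (\<exists>F. finite F \<and> span F = {x. T x = Some 0}) \<and>
     (\<exists>F. finite F \<and> span (ran T \<union> F) = UNIV)"

definition CFsa :: "('a \<rightharpoonup> 'a) set" where
  "CFsa = {T \<in> closed_ops. adjoint T = T \<and> fredholm T}"


section \<open>The gap metric\<close>

definition ip_prod :: "'a \<times> 'a \<Rightarrow> 'a \<times> 'a \<Rightarrow> 'k" where
  "ip_prod u v = ip (fst u) (fst v) + ip (snd u) (snd v)"

definition graph_proj :: "('a \<rightharpoonup> 'a) \<Rightarrow> ('a \<times> 'a) \<Rightarrow>\<^sub>L ('a \<times> 'a)" where
  "graph_proj T =
     (THE P. is_orth_proj ip_prod P \<and> range (blinfun_apply P) = Map.graph T)"

definition gap_dist :: "('a \<rightharpoonup> 'a) \<Rightarrow> ('a \<rightharpoonup> 'a) \<Rightarrow> real" where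
  "gap_dist T S = norm (graph_proj T - graph_proj S)"

definition gap_continuous_on :: "'p::topological_space set \<Rightarrow> ('p \<Rightarrow> ('a \<rightharpoonup> 'a)) \<Rightarrow> bool" where
  "gap_continuous_on X A \<longleftrightarrow>
     (\<forall>p\<in>X. ((\<lambda>q. gap_dist (A q) (A p)) \<longlongrightarrow> 0) (at p within X))"


section \<open>Spectrum and spectral projections\<close>

definition shift_op :: "('a \<rightharpoonup> 'a) \<Rightarrow> 'k \<Rightarrow> ('a \<rightharpoonup> 'a)" where
  "shift_op T c = (\<lambda>x. map_option (\<lambda>y. y - scale c x) (T x))"

definition resolvent_set :: "('a \<rightharpoonup> 'a) \<Rightarrow> 'k set" where
  "resolvent_set T = {c. \<exists>R :: 'a \<Rightarrow>\<^sub>L 'a.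
     (\<forall>y. shift_op T c (blinfun_apply R y) = Some y) \<and>
     (\<forall>x\<in>dom T. blinfun_apply R (the (shift_op T c x)) = x)}"

definition spectrum :: "('a \<rightharpoonup> 'a) \<Rightarrow> 'k set" where
  "spectrum T = - resolvent_set T"

definition ess_spectrum :: "('a \<rightharpoonup> 'a) \<Rightarrow> 'k set" where
  "ess_spectrum T = {c. \<not> fredholm (shift_op T c)}"

text \<open>
  Projection-valued measures on the Borel sets of the real line, and the scalar measures
  \<open>S \<mapsto> \<langle>E S x, x\<rangle>\<close> they induce.  Multiplicativity of \<open>E\<close> on intersections follows from
  additivity.
\<close>

definition projection_valued_measure :: "(real set \<Rightarrow> ('a \<Rightarrow>\<^sub>L 'a)) \<Rightarrow> bool" where
  "projection_valued_measure E \<longleftrightarrow>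
     (\<forall>S\<in>sets borel. is_orth_proj ip (E S)) \<and>
     E UNIV = id_blinfun \<and>
     (\<forall>S :: nat \<Rightarrow> real set. range S \<subseteq> sets borel \<longrightarrow> disjoint_family S \<longrightarrow>
        (\<forall>x. (\<lambda>n. blinfun_apply (E (S n)) x) sums blinfun_apply (E (\<Union>n. S n)) x))"

definition scalar_measure :: "(real set \<Rightarrow> ('a \<Rightarrow>\<^sub>L 'a)) \<Rightarrow> 'a \<Rightarrow> real measure" where
  "scalar_measure E x =
     measure_of UNIV (sets borel)
       (\<lambda>S. ennreal (Re (to_complex (ip (blinfun_apply (E S) x) x))))"

text \<open>
  \<open>T = \<integral> t dE(t)\<close>: the domain of \<open>T\<close> consists of the \<open>x\<close> with \<open>\<integral> t^2 d\<langle>E x, x\<rangle> < \<infinity>\<close>, and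
  \<open>\<langle>T x, x\<rangle> = \<integral> t d\<langle>E x, x\<rangle>\<close> there.  By polarization, the quadratic form determines
  the symmetric operator \<open>T\<close>, also over the reals.
\<close>

definition is_spectral_measure :: "('a \<rightharpoonup> 'a) \<Rightarrow> (real set \<Rightarrow> ('a \<Rightarrow>\<^sub>L 'a)) \<Rightarrow> bool" where
  "is_spectral_measure T E \<longleftrightarrow>
     projection_valued_measure E \<and>
     dom T = {x. integrable (scalar_measure E x) (\<lambda>t. t\<^sup>2)} \<and>
     (\<forall>x\<in>dom T. ip (the (T x)) x = of_real (\<integral>t. t \<partial>scalar_measure E x))"

text \<open>
  The spectral projection of a selfadjoint \<open>T\<close> for a Borel set.  Spectral measures are unique
  only on Borel sets, so the description ranges over the projection and not over \<open>E\<close>.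
\<close>

definition spectral_proj :: "real set \<Rightarrow> ('a \<rightharpoonup> 'a) \<Rightarrow> ('a \<Rightarrow>\<^sub>L 'a)" where
  "spectral_proj S T = (THE P. \<exists>E. is_spectral_measure T E \<and> P = E S)"


section \<open>Spectral flow\<close>

definition sf_partition ::
    "(real \<Rightarrow> ('a \<rightharpoonup> 'a)) \<Rightarrow> nat \<Rightarrow> (nat \<Rightarrow> real) \<Rightarrow> (nat \<Rightarrow> real) \<Rightarrow> bool" where
  "sf_partition A N l a \<longleftrightarrow>
     l 0 = 0 \<and> l N = 1 \<and>
     (\<forall>i\<in>{1..N}. l (i - 1) < l i \<and> 0 < a i \<and>
        (\<forall>t\<in>{l (i - 1)..l i}.
           of_real (a i) \<notin> spectrum (A t) \<and> of_real (- a i) \<notin> spectrum (A t) \<and>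
           of_real ` {- a i..a i} \<inter> ess_spectrum (A t) = {}) \<and>
        continuous_on {l (i - 1)..l i} (\<lambda>t. spectral_proj {- a i..a i} (A t)))"

definition spectral_dim :: "real set \<Rightarrow> ('a \<rightharpoonup> 'a) \<Rightarrow> int" where
  "spectral_dim S T = int (dim (range (blinfun_apply (spectral_proj S T))))"

definition sf :: "(real \<Rightarrow> ('a \<rightharpoonup> 'a)) \<Rightarrow> int" where
  "sf A = (THE k. \<exists>N l a. sf_partition A N l a \<and>
     k = (\<Sum>i=1..N. spectral_dim {0..a i} (A (l i)) - spectral_dim {0..a i} (A (l (i - 1)))))"

end

end

(* Everything is carried out on graphs in the underlying real Hilbert space; linearity over the scalars
   is tracked by commutation with the scalar multiplications.

   Spectral theorem: the graph projection of a selfadjoint T has entries R = (1 + T^2)^-1 and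
   S = T (1 + T^2)^-1, and the spectral projection of T for (-oo, c] is the projection onto the part of
   the space where c R - S >= 0.  Bisection of intervals turns the inequalities between T and its bounds
   on spectral subspaces into the integral formulas.

   Stability: for a, b outside the spectrum of T, a sin-theta estimate bounds the difference of the
   spectral projections for [a, b] of T and of a gap-near S by a multiple of the gap.  Hence the difference
   dim chi_[0,b] - dim chi_[0,a] is locally constant where a and b are both admissible.

   Homotopy: this makes p |-> dim chi_[0,a](h p) a family of local potentials with locally constant
   differences; on the square they glue, strip by strip, to one global potential g.  The spectral flow of
   each edge is the difference of the values of g at its corners, and the four differences cancel. *)

theory Submission
  imports Defs
begin

section \<open>Projections, square roots and positive parts\<close>

text \<open>The function p |-> dim chi_[0,a](h p) jumps whenever an eigenvalue crosses 0, and in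
  general no single \<open>a\<close> is admissible on the whole square. Only differences for two
  admissible numbers are stable, so the local functions have to be corrected by constants. That the
  corrections fit together is an absence of monodromy; it comes from cutting the square into
  rectangles with connected overlaps. \<open>sf\<close> is a definite description: one partition
  must be exhibited and all partitions must give the same integer. A potential along the path
  settles both. Over real scalars there is no resolvent at nonreal points, hence no Cayley
  transform; the projection onto the graph is available in both cases. \<open>spectral_proj\<close>
  ranges over all spectral measures, so their uniqueness is part of the task: it is the sin-theta
  estimate at gap 0, applied to two measures of one operator. The Fredholm condition only counts
  dimensions; Baire category turns it into finite rank of a spectral projection.\<close>

abbreviation orth_proj :: "('a::real_inner \<Rightarrow>\<^sub>L 'a) \<Rightarrow> bool" where
  "orth_proj \<equiv> is_orth_proj inner"

definition sym_op :: "('a::real_inner \<Rightarrow>\<^sub>L 'a) \<Rightarrow> bool" where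
  "sym_op A \<longleftrightarrow> (\<forall>x y. inner (A x) y = inner x (A y))"

lemma sym_opD: "sym_op A \<Longrightarrow> inner (A x) y = inner x (A y)"
  by (simp add: sym_op_def)

lemma orth_projI:
  fixes P :: "'a::real_inner \<Rightarrow>\<^sub>L 'a"
  assumes "\<And>x. P (P x) = P x" "\<And>x y. inner (P x) y = inner x (P y)"
  shows "orth_proj P"
  using assms unfolding is_orth_proj_def by (auto intro!: blinfun_eqI)

lemma is_orth_proj_idem:
  fixes P :: "'a::real_normed_vector \<Rightarrow>\<^sub>L 'a"
  assumes "is_orth_proj B P"
  shows "P (P x) = P x"
proof -
  have "P o\<^sub>L P = P" using assms by (simp add: is_orth_proj_def)
  then have "(P o\<^sub>L P) x = P x" by simp
  then show ?thesis by simp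
qed

lemma orth_proj_idem: "orth_proj P \<Longrightarrow> P (P x) = P x"
  by (rule is_orth_proj_idem)

lemma orth_proj_sym: "orth_proj P \<Longrightarrow> inner (P x) y = inner x (P y)"
  unfolding is_orth_proj_def by blast

lemma orth_proj_imp_sym_op: "orth_proj P \<Longrightarrow> sym_op P"
  by (simp add: sym_op_def orth_proj_sym)

lemma orth_proj_inner: "orth_proj P \<Longrightarrow> inner (P x) x = (norm (P x))\<^sup>2"
  by (metis orth_proj_idem orth_proj_sym power2_norm_eq_inner)

lemma orth_proj_range: "is_orth_proj B P \<Longrightarrow> y \<in> range (blinfun_apply P) \<longleftrightarrow> P y = y"
  by (auto simp: is_orth_proj_idem) (metis rangeI)

lemma orth_proj_pythagoras:
  assumes "orth_proj P"
  shows "(norm x)\<^sup>2 = (norm (P x))\<^sup>2 + (norm (x - P x))\<^sup>2"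
proof -
  have "inner (P x) (x - P x) = 0"
    unfolding inner_diff_right orth_proj_sym[OF assms, of x x]
    by (simp add: orth_proj_sym[OF assms] orth_proj_idem[OF assms])
  then show ?thesis
    unfolding power2_norm_eq_inner by (simp add: inner_diff inner_commute)
qed

lemma orth_proj_norm_le:
  assumes "orth_proj P" shows "norm (P x) \<le> norm x"
proof (rule power2_le_imp_le)
  show "(norm (P x))\<^sup>2 \<le> (norm x)\<^sup>2"
    unfolding orth_proj_pythagoras[OF assms, of x] by (rule le_add_same_cancel1[THEN iffD2]) (rule zero_le_power2)
qed (rule norm_ge_zero)

lemma orth_proj_compl:
  assumes "orth_proj P" shows "orth_proj (id_blinfun - P)"
  using assms
  by (intro orth_projI)
    (auto simp: blinfun.bilinear_simps orth_proj_idem orth_proj_sym inner_diff)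

lemma orth_proj_eqI:
  fixes P :: "'a::real_inner \<Rightarrow>\<^sub>L 'a"
  assumes P: "orth_proj P" and p: "P p = p" and orth: "\<And>q. P q = q \<Longrightarrow> inner (x - p) q = 0"
  shows "P x = p"
proof -
  have "inner (P (x - p)) (P (x - p)) = inner (x - p) (P (x - p))"
    by (metis P orth_proj_idem orth_proj_sym)
  also have "\<dots> = 0"
    by (rule orth) (simp add: P orth_proj_idem)
  finally show ?thesis using p by (simp add: blinfun.bilinear_simps)
qed

lemma orth_proj_unique:
  assumes "orth_proj P" "orth_proj Q" "range (blinfun_apply P) = range (blinfun_apply Q)"
  shows "P = Q"
proof (rule blinfun_eqI)
  fix x
  have iff: "P y = y \<longleftrightarrow> Q y = y" for y
    using assms orth_proj_range by metis
  show "P x = Q x"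
  proof (rule orth_proj_eqI[OF assms(1)])
    show "P (Q x) = Q x" using iff assms(2) orth_proj_idem by blast
    fix q assume "P q = q"
    then have "Q q = q" using iff by blast
    then show "inner (x - Q x) q = 0"
      by (metis assms(2) inner_diff_left orth_proj_sym right_minus_eq)
  qed
qed

text \<open>Invariance of the range of \<open>P\<close> under the adjoint \<open>C'\<close> amounts
  to invariance of the kernel of \<open>P\<close> under \<open>C\<close>, so both summands of
  \<open>x = P x + (x - P x)\<close> are respected. \<open>C\<close> and \<open>C'\<close> are plain
  functions, so that scalar multiplication on pairs is an instance.\<close>

lemma orth_proj_commute:
  fixes P :: "'a::real_inner \<Rightarrow>\<^sub>L 'a"
  assumes P: "orth_proj P" and adj: "\<And>x y. inner (C x) y = inner x (C' y)"
    and lin: "\<And>x y. C (x + y) = C x + C y"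
    and C: "\<And>x. P x = x \<Longrightarrow> P (C x) = C x" and C': "\<And>x. P x = x \<Longrightarrow> P (C' x) = C' x"
  shows "P (C x) = C (P x)"
proof (rule orth_proj_eqI[OF P])
  show "P (C (P x)) = C (P x)" by (simp add: C P orth_proj_idem)
  fix q assume q: "P q = q"
  have "C x = C (P x) + C (x - P x)" by (metis lin add.commute diff_add_cancel)
  then have "inner (C x - C (P x)) q = inner (x - P x) (C' q)" by (simp add: adj)
  also have "\<dots> = inner (x - P x) (P (C' q))" by (simp add: C' q)
  also have "\<dots> = inner (P (x - P x)) (C' q)" by (simp add: P orth_proj_sym)
  also have "\<dots> = 0" by (simp add: blinfun.bilinear_simps P orth_proj_idem)
  finally show "inner (C x - C (P x)) q = 0" .
qed

section \<open>Orthogonal projections onto closed subspaces\<close>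

lemma parallelogram:
  fixes a b :: "'a::real_inner"
  shows "(norm (a + b))\<^sup>2 + (norm (a - b))\<^sup>2 = 2 * (norm a)\<^sup>2 + 2 * (norm b)\<^sup>2"
  by (simp add: power2_norm_eq_inner inner_diff inner_add inner_commute)

text \<open>Midpoints of near-minimisers of the distance stay in \<open>S\<close>, so the
  parallelogram law makes a minimising sequence Cauchy; completeness provides the nearest point, and
  minimality along lines gives orthogonality.\<close>

lemma ex_nearest_point:
  fixes S :: "'a::{real_inner,banach} set"
  assumes S: "subspace S" "closed S"
  shows "\<exists>p\<in>S. \<forall>s\<in>S. inner (x - p) s = 0"
proof -
  define d where "d = infdist x S"
  have ne: "S \<noteq> {}" using S(1) subspace_0 by blast
  have d_le: "d \<le> norm (x - s)" if "s \<in> S" for s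
    using infdist_le[OF that, of x] by (simp add: d_def dist_norm)
  have d0: "d \<ge> 0" by (simp add: d_def infdist_nonneg)
  have "\<exists>y\<in>S. norm (x - y) < d + inverse (Suc n)" for n
  proof (rule ccontr)
    assume "\<not> ?thesis"
    then have "\<And>y. y \<in> S \<Longrightarrow> d + inverse (Suc n) \<le> dist x y" by (auto simp: dist_norm not_less)
    then have "d + inverse (Suc n) \<le> (INF y\<in>S. dist x y)" using ne by (intro cINF_greatest)
    then have "d + inverse (Suc n) \<le> d" using ne by (simp add: d_def infdist_def)
    then show False by simp
  qed
  then obtain y where y: "\<And>n. y n \<in> S" "\<And>n. norm (x - y n) < d + inverse (Suc n)" by metis
  have close: "(norm (y m - y n))\<^sup>2 \<le> 4 * (2 * d + 1) * inverse (Suc N)" if "m \<ge> N" "n \<ge> N" for m n N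
  proof -
    define e where "e = inverse (real (Suc N))"
    have e: "0 < e" "e \<le> 1" by (auto simp: e_def field_simps)
    have "inverse (real (Suc m)) \<le> e" "inverse (real (Suc n)) \<le> e"
      using that by (auto simp: e_def)
    then have "norm (x - y m) \<le> d + e" "norm (x - y n) \<le> d + e" using y(2)[of m] y(2)[of n] by auto
    then have 1: "(norm (x - y m))\<^sup>2 \<le> (d + e)\<^sup>2" "(norm (x - y n))\<^sup>2 \<le> (d + e)\<^sup>2"
      by (auto intro!: power_mono)
    have "(1/2) *\<^sub>R (y m + y n) \<in> S" using y S(1) by (simp add: subspace_add subspace_scale)
    from d_le[OF this] have "2 * d \<le> 2 * norm (x - (1/2) *\<^sub>R (y m + y n))" by simp
    also have "\<dots> = norm (2 *\<^sub>R (x - (1/2) *\<^sub>R (y m + y n)))" by simp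
    also have "2 *\<^sub>R (x - (1/2) *\<^sub>R (y m + y n)) = (x - y m) + (x - y n)"
      by (simp add: algebra_simps scaleR_2)
    finally have "(2 * d)\<^sup>2 \<le> (norm ((x - y m) + (x - y n)))\<^sup>2" using d0 by (intro power_mono) auto
    moreover have "norm ((x - y m) - (x - y n)) = norm (y m - y n)"
      by (simp add: norm_minus_commute)
    ultimately have "(norm (y m - y n))\<^sup>2 \<le> 4 * (d + e)\<^sup>2 - (2 * d)\<^sup>2"
      using parallelogram[of "x - y m" "x - y n"] 1 by simp
    also have "\<dots> = 4 * (2 * d + e) * e" by (simp add: power2_eq_square algebra_simps)
    also have "\<dots> \<le> 4 * (2 * d + 1) * e" using e d0 by (intro mult_right_mono) auto
    finally show ?thesis by (simp add: e_def)
  qed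
  have "Cauchy y"
  proof (rule CauchyI)
    fix e :: real assume "0 < e"
    then have "0 < e\<^sup>2 / (4 * (2 * d + 1))" using d0 by simp
    from reals_Archimedean[OF this] obtain N where N: "inverse (Suc N) < e\<^sup>2 / (4 * (2 * d + 1))" ..
    have "norm (y m - y n) < e" if "m \<ge> N" "n \<ge> N" for m n
    proof -
      have "(norm (y m - y n))\<^sup>2 \<le> 4 * (2 * d + 1) * inverse (Suc N)" using close that by blast
      also have "\<dots> < e\<^sup>2" using N d0 by (simp add: field_simps)
      finally show ?thesis using \<open>0 < e\<close> power2_less_imp_less by (metis less_imp_le)
    qed
    then show "\<exists>M. \<forall>m\<ge>M. \<forall>n\<ge>M. norm (y m - y n) < e" by blast
  qed
  then obtain p where p: "y \<longlonglongrightarrow> p" using Cauchy_convergent convergent_def by blast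
  have pS: "p \<in> S" using S(2) y(1) p closed_sequentially by blast
  have "(\<lambda>n. norm (x - y n)) \<longlonglongrightarrow> norm (x - p)" by (intro tendsto_intros p)
  moreover have "(\<lambda>n. d + inverse (real (Suc n))) \<longlonglongrightarrow> d + 0"
    by (intro tendsto_intros LIMSEQ_inverse_real_of_nat)
  ultimately have "norm (x - p) \<le> d + 0"
    by (rule LIMSEQ_le) (use y(2) less_imp_le in blast)
  then have pd: "norm (x - p) \<le> d" by simp
  have "inner (x - p) s = 0" if s: "s \<in> S" for s
  proof (cases "s = 0")
    case False
    \<comment> \<open>The minimiser of the quadratic polynomial t |-> |x - p - t s|^2; minimality of
      \<open>p\<close> forces its value there to be no smaller than at t = 0.\<close>
    define t where "t = inner (x - p) s / (norm s)\<^sup>2"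
    have "p + t *\<^sub>R s \<in> S" using pS s S(1) by (simp add: subspace_add subspace_scale)
    from d_le[OF this] pd have "(norm (x - p))\<^sup>2 \<le> (norm (x - p - t *\<^sub>R s))\<^sup>2"
      by (intro power_mono) (auto simp: algebra_simps)
    also have "\<dots> = (norm (x - p))\<^sup>2 - 2 * t * inner (x - p) s + t\<^sup>2 * (norm s)\<^sup>2"
      unfolding power2_norm_eq_inner
      by (simp add: inner_diff inner_commute algebra_simps power2_eq_square)
    also have "t\<^sup>2 * (norm s)\<^sup>2 = t * inner (x - p) s"
      using False by (simp add: t_def power2_eq_square)
    finally have "t * inner (x - p) s \<le> 0" by simp
    then have "(inner (x - p) s)\<^sup>2 / (norm s)\<^sup>2 \<le> 0" by (simp add: t_def power2_eq_square)
    then show ?thesis using False by (simp add: divide_le_0_iff zero_less_power)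
  qed auto
  then show ?thesis using pS by blast
qed

lemma ex_orth_proj:
  fixes S :: "'a::{real_inner,banach} set"
  assumes S: "subspace S" "closed S"
  shows "\<exists>P. orth_proj P \<and> range (blinfun_apply P) = S"
proof -
  obtain p where p: "\<And>x. p x \<in> S" "\<And>x s. s \<in> S \<Longrightarrow> inner (x - p x) s = 0"
    using ex_nearest_point[OF S] by metis
  have uniq: "p x = q" if "q \<in> S" "\<And>s. s \<in> S \<Longrightarrow> inner (x - q) s = 0" for x q
  proof -
    have qp: "q - p x \<in> S" using that(1) p(1) S(1) subspace_diff by blast
    have "inner (q - p x) (q - p x) = inner ((x - p x) - (x - q)) (q - p x)" by simp
    also have "\<dots> = inner (x - p x) (q - p x) - inner (x - q) (q - p x)" by (rule inner_diff_left)
    also have "\<dots> = 0" using p(2)[OF qp] that(2)[OF qp] by simp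
    finally show ?thesis by simp
  qed
  have add: "p (x + y) = p x + p y" for x y
  proof (rule uniq)
    show "p x + p y \<in> S" using p(1) S(1) subspace_add by blast
    fix s assume "s \<in> S"
    then show "inner (x + y - (p x + p y)) s = 0"
      using p(2)[of s x] p(2)[of s y] by (simp add: inner_diff_left inner_add_left)
  qed
  have scale: "p (r *\<^sub>R x) = r *\<^sub>R p x" for r x
  proof (rule uniq)
    show "r *\<^sub>R p x \<in> S" using p(1) S(1) subspace_scale by blast
    fix s assume "s \<in> S"
    then show "inner (r *\<^sub>R x - r *\<^sub>R p x) s = 0"
      using p(2)[of s x] by (simp add: inner_diff_left algebra_simps)
  qed
  have sym: "inner (p x) y = inner x (p y)" for x y
    using p(2)[OF p(1), of x y] p(2)[OF p(1), of y x]
    by (simp add: inner_diff_left inner_diff_right inner_commute)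
  have idem: "p (p x) = p x" for x by (rule uniq) (auto simp: p)
  have "norm (p x) \<le> norm x * 1" for x
  proof -
    have "(norm (p x))\<^sup>2 = inner x (p x)" unfolding power2_norm_eq_inner by (simp add: sym idem)
    also have "\<dots> \<le> norm x * norm (p x)" by (rule norm_cauchy_schwarz)
    finally show ?thesis
      by (cases "norm (p x) = 0") (auto simp: power2_eq_square)
  qed
  with add scale have bl: "bounded_linear p" by (rule bounded_linear_intro)
  define P where "P = Blinfun p"
  have P: "blinfun_apply P = p" unfolding P_def using bl by (rule bounded_linear_Blinfun_apply)
  have "orth_proj P" by (rule orth_projI) (auto simp: P idem sym)
  moreover have "range p = S"
    using p(1) uniq[of _ "_"] by (auto simp: image_iff) (metis diff_self inner_zero_left)
  ultimately show ?thesis using P by auto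
qed

section \<open>Norm bounds from quadratic forms, square roots, positive parts\<close>

lemma real_subspace_closure:
  fixes S :: "'a::real_normed_vector set"
  assumes "subspace S" shows "subspace (closure S)"
proof (unfold subspace_def, intro conjI ballI allI)
  show "0 \<in> closure S" using assms subspace_0 closure_subset by blast
  fix x assume "x \<in> closure S"
  then obtain f where f: "\<And>n. f n \<in> S" "f \<longlonglongrightarrow> x" by (auto simp: closure_sequential)
  show "x + y \<in> closure S" if y: "y \<in> closure S" for y
  proof -
    obtain g where "\<forall>n. g n \<in> S" "g \<longlonglongrightarrow> y" using y unfolding closure_sequential by blast
    with f show ?thesis unfolding closure_sequential
      by (intro exI[of _ "\<lambda>n. f n + g n"]) (auto intro!: tendsto_intros subspace_add assms)
  qed
  show "c *\<^sub>R x \<in> closure S" for c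
    using f unfolding closure_sequential
    by (intro exI[of _ "\<lambda>n. c *\<^sub>R f n"]) (auto intro!: tendsto_intros subspace_scale assms)
qed

text \<open>Polarisation and the parallelogram law give
  \<open>2 * inner w v \<le> r * (|u|^2 + |v|^2)\<close> for \<open>v\<close> in the domain of the
  relation; by density this extends to all multiples \<open>v = t w\<close>, and \<open>t\<close> is
  then optimised. \<open>A\<close> is a relation on a possibly non-closed domain, so the lemma
  yields boundedness of an operator that is not yet known to be bounded.\<close>

lemma norm_le_of_quadratic_form:
  fixes A :: "('a::real_inner \<times> 'a) set"
  assumes A: "subspace A"
    and sym: "\<And>u w v z. (u, w) \<in> A \<Longrightarrow> (v, z) \<in> A \<Longrightarrow> inner w v = inner u z"
    and bound: "\<And>u w. (u, w) \<in> A \<Longrightarrow> \<bar>inner w u\<bar> \<le> r * (norm u)\<^sup>2"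
    and uw: "(u, w) \<in> A" and cl: "w \<in> closure (fst ` A)"
  shows "norm w \<le> r * norm u"
proof (cases "w = 0")
  case True
  have "0 \<le> r * (norm u)\<^sup>2" using bound[OF uw] by linarith
  then have "u = 0 \<or> 0 \<le> r" by (auto simp: zero_le_mult_iff)
  then show ?thesis using True by auto
next
  case False
  have 1: "2 * inner w v \<le> r * ((norm u)\<^sup>2 + (norm v)\<^sup>2)" if v: "v \<in> fst ` A" for v
  proof -
    obtain z where vz: "(v, z) \<in> A" using v by auto
    have "(u, w) + (v, z) \<in> A" "(u, w) - (v, z) \<in> A"
      using A uw vz by (auto simp only: subspace_add subspace_diff)
    then have "(u + v, w + z) \<in> A" "(u - v, w - z) \<in> A" by auto
    from bound[OF this(1)] bound[OF this(2)]
    have "inner (w + z) (u + v) - inner (w - z) (u - v)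
       \<le> r * ((norm (u + v))\<^sup>2 + (norm (u - v))\<^sup>2)"
      by (simp add: distrib_left)
    also have "\<dots> = r * (2 * (norm u)\<^sup>2 + 2 * (norm v)\<^sup>2)" by (simp add: parallelogram)
    also have "inner (w + z) (u + v) - inner (w - z) (u - v) = 2 * inner w v + 2 * inner u z"
      by (simp add: inner_add inner_diff inner_commute)
    finally show ?thesis using sym[OF uw vz] by (simp add: algebra_simps)
  qed
  have "closed {v. 2 * inner w v \<le> r * ((norm u)\<^sup>2 + (norm v)\<^sup>2)}"
    by (intro closed_Collect_le continuous_intros)
  moreover have "fst ` A \<subseteq> {v. 2 * inner w v \<le> r * ((norm u)\<^sup>2 + (norm v)\<^sup>2)}"
    using 1 by auto
  ultimately have "closure (fst ` A) \<subseteq> {v. 2 * inner w v \<le> r * ((norm u)\<^sup>2 + (norm v)\<^sup>2)}"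
    by (rule closure_minimal[rotated])
  moreover have "subspace (closure (fst ` A))"
    using A by (intro real_subspace_closure linear_subspace_image) (auto intro: linear_fst)
  ultimately have 2: "2 * inner w (t *\<^sub>R w) \<le> r * ((norm u)\<^sup>2 + (norm (t *\<^sub>R w))\<^sup>2)" for t
    using cl subspace_scale by blast
  then have 3: "2 * t * (norm w)\<^sup>2 \<le> r * ((norm u)\<^sup>2 + t\<^sup>2 * (norm w)\<^sup>2)" for t
    using 2[of t] by (simp add: power_mult_distrib power2_norm_eq_inner mult.assoc)
  show ?thesis
  proof (cases "u = 0")
    case True
    \<comment> \<open>Any positive \<open>t\<close> with \<open>r * t < 1\<close> contradicts
      \<open>w \<noteq> 0\<close>; the absolute value and the 1 make this work for every sign of
      \<open>r\<close>.\<close>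
    define t where "t = 1 / (\<bar>r\<bar> + 1)"
    have t: "t > 0" "r * t < 1"
      using abs_ge_self[of r] by (auto simp: t_def field_simps add_pos_nonneg)
    have "2 * t * (norm w)\<^sup>2 \<le> (r * t) * t * (norm w)\<^sup>2"
      using 3[of t] True by (simp add: power2_eq_square algebra_simps)
    then have "2 * t \<le> (r * t) * t" using False by (simp add: mult_le_cancel_right)
    moreover have "(r * t) * t < 1 * t" using t by (intro mult_strict_right_mono) auto
    ultimately show ?thesis using t by simp
  next
    case u: False
    \<comment> \<open>At \<open>t = norm u / norm w\<close> the two squares on the right-hand side
      are equal, which is the best choice.\<close>
    have "2 * (norm u * norm w) \<le> 2 * (r * (norm u)\<^sup>2)"
      using 3[of "norm u / norm w"] False by (simp add: field_simps power2_eq_square)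
    then show ?thesis using u by (simp add: power2_eq_square)
  qed
qed

lemma sym_op_norm_le:
  fixes A :: "'a::real_inner \<Rightarrow>\<^sub>L 'a"
  assumes "sym_op A" and "\<And>x. \<bar>inner (A x) x\<bar> \<le> r * (norm x)\<^sup>2" and "r \<ge> 0"
  shows "norm A \<le> r"
proof (rule norm_blinfun_bound[OF \<open>r \<ge> 0\<close>])
  fix x
  have "subspace (range (\<lambda>x. (x, A x)))"
    by (intro linear_subspace_image) (auto intro!: linearI simp: blinfun.bilinear_simps)
  then show "norm (A x) \<le> r * norm x"
    by (rule norm_le_of_quadratic_form) (use assms in \<open>auto simp: sym_op_def image_image\<close>)
qed

text \<open>With \<open>A' = 1 - A\<close> and \<open>Q = 1 - L\<close>, the equation Q^2 = A reads
  L = (A' + L^2) / 2. It is solved by iteration from 0, each iterate being a polynomial in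
  \<open>A'\<close>; symmetry and commutation therefore hold for the iterates and pass to the
  limit.\<close>

lemma blinfun_sqrt:
  fixes A :: "'a::{real_inner,banach} \<Rightarrow>\<^sub>L 'a"
  assumes A: "sym_op A" "\<And>x. 0 \<le> inner (A x) x" "\<And>x. inner (A x) x \<le> (norm x)\<^sup>2"
  obtains Q where "sym_op Q" "\<And>x. Q (Q x) = A x" "\<And>x. 0 \<le> inner (Q x) x"
    "\<And>(C :: 'a \<Rightarrow>\<^sub>L 'a) x. (\<And>x. A (C x) = C (A x)) \<Longrightarrow> Q (C x) = C (Q x)"
proof -
  define A' where "A' = id_blinfun - A"
  have A': "sym_op A'" using A(1) by (auto simp: A'_def sym_op_def blinfun.bilinear_simps inner_diff)
  have nA': "norm A' \<le> 1"
    by (rule sym_op_norm_le[OF A'])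
      (use A(2,3) in \<open>auto simp: A'_def blinfun.bilinear_simps inner_diff power2_norm_eq_inner\<close>)
  define Y where "Y = rec_nat (0::'a \<Rightarrow>\<^sub>L 'a) (\<lambda>_ Z. (1/2) *\<^sub>R (A' + (Z o\<^sub>L Z)))"
  have Y: "Y 0 = 0" "\<And>n. Y (Suc n) = (1/2) *\<^sub>R (A' + (Y n o\<^sub>L Y n))" by (auto simp: Y_def)
  \<comment> \<open>The same iteration with 1 in place of \<open>A'\<close>, whose norm is at most
    1. It increases and is bounded by 1, and it majorises both the norms of the \<open>Y n\<close>
    and their increments.\<close>
  define y where "y = rec_nat (0::real) (\<lambda>_ z. (1/2) * (1 + z * z))"
  have y: "y 0 = 0" "\<And>n. y (Suc n) = (1/2) * (1 + y n * y n)" by (auto simp: y_def)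
  have y01: "0 \<le> y n \<and> y n \<le> 1" for n
  proof (induction n)
    case (Suc n)
    then have "y n * y n \<le> 1" by (simp add: mult_le_one)
    then show ?case using Suc by (simp add: y)
  qed (simp add: y)
  have yinc: "y n \<le> y (Suc n)" for n
    using zero_le_square[of "y n - 1"] by (simp add: y algebra_simps)
  have nY: "norm (Y n) \<le> y n" for n
  proof (induction n)
    case (Suc n)
    have "norm (Y n o\<^sub>L Y n) \<le> norm (Y n) * norm (Y n)" by (rule norm_blinfun_compose)
    also have "\<dots> \<le> y n * y n" using Suc by (intro mult_mono) (auto simp: y01)
    finally have "norm (A' + (Y n o\<^sub>L Y n)) \<le> 1 + y n * y n" using nA' by (intro norm_triangle_le) linarith
    then show ?case by (simp add: Y y)
  qed (simp add: Y y)
  have dY: "norm (Y (Suc n) - Y n) \<le> y (Suc n) - y n" for n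
  proof (induction n)
    case 0 show ?case using nA' by (simp add: Y y)
  next
    case (Suc n)
    define D where "D = Y (Suc n) - Y n"
    have "Y (Suc (Suc n)) - Y (Suc n) = (1/2) *\<^sub>R ((Y (Suc n) o\<^sub>L Y (Suc n)) - (Y n o\<^sub>L Y n))"
      by (simp add: Y(2)[of "Suc n"] Y(2)[of n] algebra_simps)
    \<comment> \<open>The factorisation is arranged so that the two iterates need not be known to
      commute.\<close>
    also have "(Y (Suc n) o\<^sub>L Y (Suc n)) - (Y n o\<^sub>L Y n) = (Y (Suc n) o\<^sub>L D) + (D o\<^sub>L Y n)"
      by (rule blinfun_eqI) (simp add: D_def blinfun.bilinear_simps)
    finally have "norm (Y (Suc (Suc n)) - Y (Suc n))
        \<le> (norm (Y (Suc n) o\<^sub>L D) + norm (D o\<^sub>L Y n)) / 2"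
      using norm_triangle_ineq[of "Y (Suc n) o\<^sub>L D" "D o\<^sub>L Y n"] by simp
    also have "\<dots> \<le> (norm (Y (Suc n)) * norm D + norm D * norm (Y n)) / 2"
      by (intro divide_right_mono add_mono norm_blinfun_compose) auto
    also have "\<dots> \<le> (y (Suc n) * (y (Suc n) - y n) + (y (Suc n) - y n) * y n) / 2"
      using Suc yinc[of n] unfolding D_def[symmetric]
      by (intro divide_right_mono add_mono mult_mono nY) (auto simp: y01)
    also have "\<dots> = y (Suc (Suc n)) - y (Suc n)"
      by (simp add: y(2)[of "Suc n"] y(2)[of n] field_simps)
    finally show ?case .
  qed
  have dYm: "norm (Y (n + k) - Y n) \<le> y (n + k) - y n" for n k
  proof (induction k)
    case (Suc k)
    have "norm (Y (n + Suc k) - Y n) \<le> norm (Y (Suc (n + k)) - Y (n + k)) + norm (Y (n + k) - Y n)"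
      using norm_triangle_ineq[of "Y (Suc (n + k)) - Y (n + k)" "Y (n + k) - Y n"] by simp
    then show ?case using Suc dY[of "n + k"] by simp
  qed simp
  have "incseq y" using yinc by (rule incseq_SucI)
  then have "convergent y" by (metis incseq_convergent y01 convergentI)
  then have Cy: "Cauchy y" by (rule convergent_Cauchy)
  have "Cauchy Y"
  proof (rule CauchyI')
    fix e :: real assume "0 < e"
    then obtain M where M: "\<And>m n. m \<ge> M \<Longrightarrow> n \<ge> M \<Longrightarrow> norm (y m - y n) < e"
      using CauchyD[OF Cy] by blast
    have "norm (Y m - Y n) < e" if "m \<ge> M" "n > m" for m n
    proof -
      have "norm (Y n - Y m) \<le> y n - y m" using dYm[of m "n - m"] that by simp
      also have "\<dots> < e" using M[of n m] that by simp
      finally show ?thesis by (simp add: norm_minus_commute)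
    qed
    then show "\<exists>M. \<forall>m\<ge>M. \<forall>n>m. dist (Y m) (Y n) < e" by (auto simp: dist_norm)
  qed
  then obtain L where L: "Y \<longlonglongrightarrow> L" using Cauchy_convergent convergent_def by blast
  have Lx: "(\<lambda>n. Y n x) \<longlonglongrightarrow> L x" for x by (intro tendsto_intros L)
  have nL: "norm L \<le> 1"
    by (rule LIMSEQ_le_const2[OF tendsto_norm[OF L]]) (meson nY y01 order_trans)
  have "(\<lambda>n. Y (Suc n)) \<longlonglongrightarrow> (1/2) *\<^sub>R (A' + (L o\<^sub>L L))"
    unfolding Y(2)
    by (intro tendsto_intros L bounded_bilinear.tendsto[OF bounded_bilinear_blinfun_compose])
  with L have Leq: "L = (1/2) *\<^sub>R (A' + (L o\<^sub>L L))"
    using LIMSEQ_Suc LIMSEQ_unique by blast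
  have L2: "2 *\<^sub>R L x = A' x + L (L x)" for x
    by (subst Leq) (simp add: blinfun.bilinear_simps)
  have symY: "sym_op (Y n)" for n
    by (induction n) (use A' in \<open>auto simp: sym_op_def Y blinfun.bilinear_simps inner_add\<close>)
  have symL: "inner (L x) z = inner x (L z)" for x z
  proof -
    have "(\<lambda>n. inner (Y n x) z) \<longlonglongrightarrow> inner (L x) z" by (intro tendsto_intros Lx)
    moreover have "(\<lambda>n. inner (Y n x) z) \<longlonglongrightarrow> inner x (L z)"
      unfolding sym_opD[OF symY] by (intro tendsto_intros Lx)
    ultimately show ?thesis by (rule LIMSEQ_unique)
  qed
  have commL: "L (C x) = C (L x)" if C: "\<And>x. A (C x) = C (A x)" for C :: "'a \<Rightarrow>\<^sub>L 'a" and x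
  proof -
    have "Y n (C x) = C (Y n x)" for n x
      by (induction n arbitrary: x) (auto simp: Y blinfun.bilinear_simps A'_def C)
    then have "(\<lambda>n. C (Y n x)) \<longlonglongrightarrow> L (C x)" using Lx[of "C x"] by simp
    moreover have "(\<lambda>n. C (Y n x)) \<longlonglongrightarrow> C (L x)" by (intro tendsto_intros Lx)
    ultimately show ?thesis by (rule LIMSEQ_unique)
  qed
  show ?thesis
  proof (rule that[of "id_blinfun - L"])
    show "sym_op (id_blinfun - L)"
      by (simp add: sym_op_def blinfun.bilinear_simps inner_diff symL)
    show "(id_blinfun - L) ((id_blinfun - L) x) = A x" for x
      using L2[of x] by (simp add: blinfun.bilinear_simps A'_def scaleR_2 algebra_simps)
    show "0 \<le> inner ((id_blinfun - L) x) x" for x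
    proof -
      have "inner (L x) x \<le> norm (L x) * norm x" by (rule norm_cauchy_schwarz)
      also have "\<dots> \<le> (norm L * norm x) * norm x" by (intro mult_right_mono norm_blinfun) auto
      also have "\<dots> \<le> (1 * norm x) * norm x" by (intro mult_right_mono nL) auto
      finally show ?thesis by (simp add: blinfun.bilinear_simps inner_diff dot_square_norm power2_eq_square)
    qed
    show "(id_blinfun - L) (C x) = C ((id_blinfun - L) x)"
      if "\<And>x. A (C x) = C (A x)" for C :: "'a \<Rightarrow>\<^sub>L 'a" and x
      using commL[OF that] by (simp add: blinfun.bilinear_simps)
  qed
qed

text \<open>Up to scaling, \<open>J\<close> is the absolute value of \<open>B\<close>, and
  \<open>P\<close> projects onto the kernel of \<open>J - B\<close>. The kernel of \<open>B\<close>
  is included there, so the form is strictly negative on the nonzero vectors of the complement, as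
  the third clause demands.\<close>

lemma nonneg_part_proj:
  fixes B :: "'a::{real_inner,banach} \<Rightarrow>\<^sub>L 'a"
  assumes B: "sym_op B"
  obtains P where "orth_proj P" "\<And>x. P x = x \<Longrightarrow> 0 \<le> inner (B x) x"
    "\<And>x. P x = 0 \<Longrightarrow> 0 \<le> inner (B x) x \<Longrightarrow> x = 0"
    "\<And>(C :: 'a \<Rightarrow>\<^sub>L 'a) (C' :: 'a \<Rightarrow>\<^sub>L 'a) x. (\<And>x y. inner (C x) y = inner x (C' y)) \<Longrightarrow>
       (\<And>x. B (C x) = C (B x)) \<Longrightarrow> P (C x) = C (P x)"
proof -
  \<comment> \<open>Scaling makes \<open>B\<close> a contraction, as the square root of its square
    requires; the 1 covers \<open>B = 0\<close>.\<close>
  define s where "s = 1 / (norm B + 1)"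
  have s: "s > 0" unfolding s_def by (simp add: add_nonneg_pos)
  define B' where "B' = s *\<^sub>R B"
  have B': "sym_op B'" using B by (simp add: B'_def sym_op_def blinfun.bilinear_simps)
  have nB': "norm (B' x) \<le> norm x" for x
  proof -
    have "norm (B' x) = s * norm (B x)" using s by (simp add: B'_def blinfun.bilinear_simps)
    also have "\<dots> \<le> s * (norm B * norm x)" using s by (intro mult_left_mono norm_blinfun) auto
    also have "\<dots> = (s * norm B) * norm x" by simp
    also have "\<dots> \<le> 1 * norm x" by (intro mult_right_mono) (auto simp: s_def add_nonneg_pos divide_le_eq)
    finally show ?thesis by simp
  qed
  have sq: "inner ((B' o\<^sub>L B') x) x = (norm (B' x))\<^sup>2" for x
    by (simp add: sym_opD[OF B'] power2_norm_eq_inner)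
  have nonneg: "0 \<le> inner ((B' o\<^sub>L B') x) x" and le1: "inner ((B' o\<^sub>L B') x) x \<le> (norm x)\<^sup>2" for x
    unfolding sq using nB'[of x] by (auto intro!: power_mono)
  have "sym_op (B' o\<^sub>L B')" by (simp add: sym_op_def sym_opD[OF B'])
  then obtain J where J: "sym_op J" "\<And>x. J (J x) = (B' o\<^sub>L B') x" "\<And>x. 0 \<le> inner (J x) x"
    "\<And>(C :: 'a \<Rightarrow>\<^sub>L 'a) x. (\<And>x. (B' o\<^sub>L B') (C x) = C ((B' o\<^sub>L B') x)) \<Longrightarrow> J (C x) = C (J x)"
    by (rule blinfun_sqrt[OF _ nonneg le1]) (rule that; blast)
  have JJ: "J (J x) = B' (B' x)" for x using J(2) by simp
  have JB: "J (B' x) = B' (J x)" for x by (rule J(4)) simp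
  have ker: "J x = 0 \<longleftrightarrow> B' x = 0" for x
  proof -
    have "inner (J x) (J x) = inner (B' x) (B' x)"
      by (metis JJ sym_opD[OF B'] sym_opD[OF J(1)])
    then show ?thesis by (metis inner_eq_zero_iff)
  qed
  have "subspace ((\<lambda>x. J x - B' x) -` {0})" "closed ((\<lambda>x. J x - B' x) -` {0})"
    by (auto simp: subspace_def blinfun.bilinear_simps algebra_simps
        intro!: closed_vimage continuous_intros)
  then obtain P where P: "orth_proj P" "range (blinfun_apply P) = (\<lambda>x. J x - B' x) -` {0}"
    using ex_orth_proj by blast
  have Piff: "P x = x \<longleftrightarrow> J x = B' x" for x
    using P orth_proj_range[OF P(1), of x] by auto
  have sum_fixed: "P (J x + B' x) = J x + B' x" for x
    unfolding Piff by (simp add: blinfun.bilinear_simps JJ JB)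
  have neg: "J x = - B' x" if "P x = 0" for x
  proof -
    \<comment> \<open>Because (J - B')(J + B') = 0, the range of \<open>J + B'\<close> is fixed by
      \<open>P\<close> and hence orthogonal to \<open>x\<close>.\<close>
    define z where "z = J x + B' x"
    have "inner z z = inner (J z + B' z) x"
      by (simp add: z_def inner_add blinfun.bilinear_simps sym_opD[OF J(1)] sym_opD[OF B'] inner_commute JB)
    also have "\<dots> = inner (P (J z + B' z)) x" unfolding sum_fixed ..
    also have "\<dots> = 0" using that by (simp add: orth_proj_sym[OF P(1)])
    finally have "J x + B' x = 0" by (simp add: z_def)
    then show ?thesis by (simp add: add_eq_0_iff2)
  qed
  show ?thesis
  proof (rule that[OF P(1)])
    fix x
    show "0 \<le> inner (B x) x" if "P x = x"
    proof -
      have "0 \<le> s * inner (B x) x"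
        using J(3)[of x] that by (simp add: Piff B'_def blinfun.bilinear_simps)
      then show ?thesis using s by (simp add: zero_le_mult_iff)
    qed
    show "x = 0" if Px: "P x = 0" and pos: "0 \<le> inner (B x) x"
    proof -
      have "0 \<le> inner (B' x) x" using pos s by (simp add: B'_def blinfun.bilinear_simps)
      then have Jx: "inner (J x) x = 0" using J(3)[of x] neg[OF Px] by simp
      text \<open>a nonnegative form vanishing at \<open>x\<close> has \<open>x\<close> in its kernel\<close>
      have q: "0 \<le> 2 * t * (norm (J x))\<^sup>2 + t\<^sup>2 * inner (J (J x)) (J x)" for t
        using J(3)[of "x + t *\<^sub>R J x"] Jx
        by (simp add: blinfun.bilinear_simps inner_add power2_norm_eq_inner sym_opD[OF J(1)]
            power2_eq_square[of t] algebra_simps inner_commute)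
      have "J x = 0"
      proof (rule ccontr)
        assume "J x \<noteq> 0"
        define a b where "a = (norm (J x))\<^sup>2" and "b = inner (J (J x)) (J x)"
        have a: "a > 0" and b: "b \<ge> 0" using \<open>J x \<noteq> 0\<close> J(3) by (auto simp: a_def b_def)
        \<comment> \<open>A negative \<open>t\<close> small enough for the linear term to outweigh
          the quadratic one; the 1 in the denominator covers \<open>b = 0\<close>.\<close>
        have "0 \<le> 2 * (- (a / (b + 1))) * a + (- (a / (b + 1)))\<^sup>2 * b" unfolding a_def b_def by (rule q)
        also have "\<dots> = (a / (b + 1)) * (a * (b / (b + 1) - 2))"
          by (simp add: power2_eq_square algebra_simps)
        also have "\<dots> < 0" using a b by (intro mult_pos_neg) (auto simp: field_simps)
        finally show False by simp
      qed
      then have "P x = x" using ker by (simp add: Piff)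
      then show ?thesis using Px by simp
    qed
  next
    fix C C' :: "'a \<Rightarrow>\<^sub>L 'a" and x
    assume adj: "\<And>x y. inner (C x) y = inner x (C' y)"
      and C: "\<And>x. B (C x) = C (B x)"
    have C'B: "B (C' x) = C' (B x)" for x
    proof -
      have "inner z (B (C' x)) = inner z (C' (B x))" for z
        by (metis C adj sym_opD[OF B])
      then show ?thesis by (meson inner_commute vector_eq_rdot vector_eq_ldot)
    qed
    have cB: "B' (C x) = C (B' x)" "B' (C' x) = C' (B' x)" for x
      by (auto simp: B'_def blinfun.bilinear_simps C C'B)
    then have cJ: "J (C x) = C (J x)" "J (C' x) = C' (J x)" for x by (auto intro!: J(4))
    show "P (C x) = C (P x)"
    proof (rule orth_proj_commute[OF P(1), where C' = C'])
      show "inner (C x) y = inner x (C' y)" for x y by (rule adj)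
      show "C (x + y) = C x + C y" for x y by (rule blinfun.add_right)
      show "P (C x) = C x" if "P x = x" for x using that by (simp add: Piff cB cJ)
      show "P (C' x) = C' x" if "P x = x" for x using that by (simp add: Piff cB cJ)
    qed
  qed
qed

section \<open>Selfadjoint graphs and their spectral families\<close>

text \<open>Adjoints are carried as explicit companions: the operators in question are symmetric or
  scalar multiplications, whose adjoint is multiplication by the conjugate scalar.\<close>

definition adjoint_pair :: "('a::real_inner \<Rightarrow>\<^sub>L 'a) \<Rightarrow> ('a \<Rightarrow>\<^sub>L 'a) \<Rightarrow> bool" where
  "adjoint_pair C C' \<longleftrightarrow> (\<forall>x y. inner (C x) y = inner x (C' y))"

lemma sym_op_adjoint_pair: "sym_op C \<longleftrightarrow> adjoint_pair C C"
  by (simp add: sym_op_def adjoint_pair_def)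

text \<open>Squared norms of increments are increments of a convergent real sequence. It serves
  monotone sequences of projections and, in \<open>resolves\<close>, the images of the cutoffs of
  one vector.\<close>

lemma Cauchy_of_orthogonal_increments:
  fixes y :: "nat \<Rightarrow> 'a::real_normed_vector"
  assumes diff: "\<And>m n. m \<le> n \<Longrightarrow> (norm (y n - y m))\<^sup>2 = (norm (y n))\<^sup>2 - (norm (y m))\<^sup>2"
    and conv: "convergent (\<lambda>n. (norm (y n))\<^sup>2)"
  shows "Cauchy y"
proof (rule CauchyI')
  fix e :: real assume "0 < e"
  then obtain M where M: "\<And>m n. m \<ge> M \<Longrightarrow> n \<ge> M \<Longrightarrow> norm ((norm (y m))\<^sup>2 - (norm (y n))\<^sup>2) < e\<^sup>2"
    using CauchyD[OF convergent_Cauchy[OF conv], of "e\<^sup>2"] by auto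
  have "norm (y m - y n) < e" if "m \<ge> M" "n > m" for m n
  proof -
    have "(norm (y n - y m))\<^sup>2 < e\<^sup>2" using M[of n m] that diff[of m n] by simp
    then show ?thesis using \<open>0 < e\<close>
      by (metis less_imp_le norm_minus_commute power2_less_imp_less)
  qed
  then show "\<exists>M. \<forall>m\<ge>M. \<forall>n>m. dist (y m) (y n) < e" by (auto simp: dist_norm)
qed

lemma orth_proj_incseq_limit:
  fixes Q :: "nat \<Rightarrow> 'a::{real_inner,banach} \<Rightarrow>\<^sub>L 'a"
  assumes Q: "\<And>n. orth_proj (Q n)" and mono: "\<And>m n x. m \<le> n \<Longrightarrow> Q n (Q m x) = Q m x"
  obtains P where "orth_proj P" "\<And>x. (\<lambda>n. Q n x) \<longlonglongrightarrow> P x"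
proof -
  have mono': "Q m (Q n x) = Q m x" if "m \<le> n" for m n x
  proof -
    have "inner (Q m (Q n x)) y = inner (Q m x) y" for y
      using mono[OF that] by (simp add: orth_proj_sym[OF Q])
    then show ?thesis using vector_eq_rdot by blast
  qed
  have diff: "(norm (Q n x - Q m x))\<^sup>2 = (norm (Q n x))\<^sup>2 - (norm (Q m x))\<^sup>2" if "m \<le> n" for m n x
    using orth_proj_pythagoras[OF Q[of m], of "Q n x"] mono'[OF that] by simp
  have "convergent (\<lambda>n. Q n x)" for x
  proof -
    have inc: "incseq (\<lambda>n. (norm (Q n x))\<^sup>2)"
    proof (rule incseq_SucI)
      fix n show "(norm (Q n x))\<^sup>2 \<le> (norm (Q (Suc n) x))\<^sup>2"
        using diff[of n "Suc n" x] zero_le_power2[of "norm (Q (Suc n) x - Q n x)"] by simp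
    qed
    moreover have "\<forall>n. (norm (Q n x))\<^sup>2 \<le> (norm x)\<^sup>2"
      by (auto intro!: power_mono orth_proj_norm_le[OF Q])
    ultimately obtain l where "(\<lambda>n. (norm (Q n x))\<^sup>2) \<longlonglongrightarrow> l" by (rule incseq_convergent)
    then have "convergent (\<lambda>n. (norm (Q n x))\<^sup>2)" by (rule convergentI)
    with diff have "Cauchy (\<lambda>n. Q n x)" by (rule Cauchy_of_orthogonal_increments)
    then show ?thesis by (rule Cauchy_convergent)
  qed
  then obtain p where p: "\<And>x. (\<lambda>n. Q n x) \<longlonglongrightarrow> p x" unfolding convergent_def by metis
  have bl: "bounded_linear p"
  proof (rule bounded_linear_intro[where K = 1])
    fix x y r
    have "(\<lambda>n. Q n (x + y)) \<longlonglongrightarrow> p x + p y"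
      by (simp add: blinfun.bilinear_simps) (intro tendsto_intros p)
    then show "p (x + y) = p x + p y" using p LIMSEQ_unique by blast
    have "(\<lambda>n. Q n (r *\<^sub>R x)) \<longlonglongrightarrow> r *\<^sub>R p x"
      by (simp add: blinfun.bilinear_simps) (intro tendsto_intros p)
    then show "p (r *\<^sub>R x) = r *\<^sub>R p x" using p LIMSEQ_unique by blast
    show "norm (p x) \<le> norm x * 1"
      using LIMSEQ_le_const2[OF tendsto_norm[OF p[of x]]] orth_proj_norm_le[OF Q] by simp
  qed
  define P where "P = Blinfun p"
  have P: "blinfun_apply P = p" unfolding P_def using bl by (rule bounded_linear_Blinfun_apply)
  have "orth_proj P"
  proof (rule orth_projI)
    fix x y
    have fix_n: "Q n (p x) = Q n x" for n x
    proof -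
      have "(\<lambda>k. Q n (Q k x)) \<longlonglongrightarrow> Q n (p x)" by (intro tendsto_intros p)
      moreover have "(\<lambda>k. Q n (Q k x)) \<longlonglongrightarrow> Q n x"
        by (rule tendsto_eventually) (use mono' eventually_sequentially in blast)
      ultimately show ?thesis by (rule LIMSEQ_unique)
    qed
    show "P (P x) = P x"
      using p[of "p x"] p[of x] LIMSEQ_unique unfolding P fix_n by blast
    have "(\<lambda>n. inner (Q n x) y) \<longlonglongrightarrow> inner (p x) y" by (intro tendsto_intros p)
    moreover have "(\<lambda>n. inner (Q n x) y) \<longlonglongrightarrow> inner x (p y)"
      unfolding orth_proj_sym[OF Q] by (intro tendsto_intros p)
    ultimately show "inner (P x) y = inner x (P y)" unfolding P by (rule LIMSEQ_unique)
  qed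
  then show ?thesis using that p P by simp
qed

lemma orth_proj_decseq_limit:
  fixes Q :: "nat \<Rightarrow> 'a::{real_inner,banach} \<Rightarrow>\<^sub>L 'a"
  assumes Q: "\<And>n. orth_proj (Q n)" and mono: "\<And>m n x. m \<le> n \<Longrightarrow> Q m (Q n x) = Q n x"
  obtains P where "orth_proj P" "\<And>x. (\<lambda>n. Q n x) \<longlonglongrightarrow> P x" "\<And>n x. Q n (P x) = P x"
proof -
  have mono': "Q n (Q m x) = Q n x" if "m \<le> n" for m n x
  proof -
    have "inner (Q n (Q m x)) y = inner (Q n x) y" for y
      using mono[OF that] by (simp add: orth_proj_sym[OF Q])
    then show ?thesis using vector_eq_rdot by blast
  qed
  obtain P where P: "orth_proj P" "\<And>x. (\<lambda>n. (id_blinfun - Q n) x) \<longlonglongrightarrow> P x"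
    by (rule orth_proj_incseq_limit[of "\<lambda>n. id_blinfun - Q n"])
      (auto simp: blinfun.bilinear_simps mono' intro!: orth_proj_compl Q)
  have lim: "(\<lambda>n. Q n x) \<longlonglongrightarrow> (id_blinfun - P) x" for x
    using tendsto_diff[OF tendsto_const[of x] P(2)[of x]] by (simp add: blinfun.bilinear_simps)
  show ?thesis
  proof (rule that[OF orth_proj_compl[OF P(1)] lim])
    fix n x
    have "(\<lambda>k. Q n (Q k x)) \<longlonglongrightarrow> Q n ((id_blinfun - P) x)" by (intro tendsto_intros lim)
    moreover have "(\<lambda>k. Q n (Q k x)) \<longlonglongrightarrow> (id_blinfun - P) x"
    proof (rule Lim_transform_eventually[OF lim])
      show "\<forall>\<^sub>F k in sequentially. Q k x = Q n (Q k x)"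
        using eventually_ge_at_top[of n] by eventually_elim (simp add: mono)
    qed
    ultimately show "Q n ((id_blinfun - P) x) = (id_blinfun - P) x" by (rule LIMSEQ_unique)
  qed
qed

text \<open>A relation that equals its adjoint is automatically closed, linear and, by density of its domain,
  single-valued.\<close>

locale selfadjoint_graph =
  fixes G :: "('a::{real_inner,banach} \<times> 'a) set"
  assumes dense: "closure (fst ` G) = UNIV"
    and mem_iff: "(y, z) \<in> G \<longleftrightarrow> (\<forall>(x, w)\<in>G. inner w y = inner x z)"
begin

lemma symm: "(x, w) \<in> G \<Longrightarrow> (y, z) \<in> G \<Longrightarrow> inner w y = inner x z"
  using mem_iff by blast

lemma memI: "(\<And>x w. (x, w) \<in> G \<Longrightarrow> inner w y = inner x z) \<Longrightarrow> (y, z) \<in> G"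
  using mem_iff by blast

lemma subspace_G: "subspace G"
proof (rule subspaceI)
  show "0 \<in> G" unfolding zero_prod_def by (rule memI) simp
  fix p q :: "'a \<times> 'a" and c :: real assume "p \<in> G"
  then show "c *\<^sub>R p \<in> G"
    by (cases p) (auto intro!: memI simp: symm)
  assume "q \<in> G"
  with \<open>p \<in> G\<close> show "p + q \<in> G"
    by (cases p, cases q) (auto intro!: memI simp: inner_add_right symm)
qed

lemma add_mem: "(x, w) \<in> G \<Longrightarrow> (y, z) \<in> G \<Longrightarrow> (x + y, w + z) \<in> G"
  using subspace_add[OF subspace_G] by fastforce

lemma diff_mem: "(x, w) \<in> G \<Longrightarrow> (y, z) \<in> G \<Longrightarrow> (x - y, w - z) \<in> G"
  using subspace_diff[OF subspace_G] by fastforce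

lemma scale_mem: "(x, w) \<in> G \<Longrightarrow> (c *\<^sub>R x, c *\<^sub>R w) \<in> G"
  using subspace_scale[OF subspace_G] by fastforce

lemma zero_mem: "(0, 0) \<in> G"
  using subspace_0[OF subspace_G] by (simp add: zero_prod_def)

lemma closed_G: "closed G"
proof -
  have "G = (\<Inter>(x, w)\<in>G. {p. inner w (fst p) = inner x (snd p)})"
  proof (intro set_eqI)
    fix p show "p \<in> G \<longleftrightarrow> p \<in> (\<Inter>(x, w)\<in>G. {p. inner w (fst p) = inner x (snd p)})"
      using mem_iff[of "fst p" "snd p"] by auto
  qed
  also have "closed \<dots>"
    by (intro closed_INT ballI) (auto intro!: closed_Collect_eq continuous_intros split: prod.split)
  finally show ?thesis .
qed

lemma inner_dense_eq_0:
  assumes "\<And>x. x \<in> fst ` G \<Longrightarrow> inner x z = 0" shows "z = 0"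
proof -
  have "closure (fst ` G) \<subseteq> {x. inner x z = 0}"
    using assms by (intro closure_minimal closed_Collect_eq continuous_intros) auto
  then have "inner z z = 0" using dense by blast
  then show ?thesis by simp
qed

lemma single_valued: "(x, w) \<in> G \<Longrightarrow> (x, w') \<in> G \<Longrightarrow> w = w'"
proof -
  assume "(x, w) \<in> G" "(x, w') \<in> G"
  then have "(0, w - w') \<in> G" using diff_mem by fastforce
  then have "inner v (w - w') = 0" if "v \<in> fst ` G" for v
    using that symm by fastforce
  then show ?thesis using inner_dense_eq_0 by (metis right_minus_eq)
qed

definition graph_projection :: "('a \<times> 'a) \<Rightarrow>\<^sub>L ('a \<times> 'a)" where
  "graph_projection = (SOME P. orth_proj P \<and> range (blinfun_apply P) = G)"

lemma graph_projection: "orth_proj graph_projection" "range (blinfun_apply graph_projection) = G"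
  using someI_ex[OF ex_orth_proj[OF subspace_G closed_G]] by (auto simp: graph_projection_def)

lemma graph_projection_mem: "graph_projection p \<in> G"
  using graph_projection(2) by blast

lemma graph_projection_fixed: "p \<in> G \<longleftrightarrow> graph_projection p = p"
  using orth_proj_range[OF graph_projection(1)] graph_projection(2) by blast

lemma graph_projection_eqI:
  assumes "(u, w) \<in> G" "\<And>v z. (v, z) \<in> G \<Longrightarrow> inner (x - u) v + inner (y - w) z = 0"
  shows "graph_projection (x, y) = (u, w)"
proof (rule orth_proj_eqI[OF graph_projection(1)])
  show "graph_projection (u, w) = (u, w)" using assms(1) graph_projection_fixed by blast
  fix q assume "graph_projection q = q"
  then have "q \<in> G" using graph_projection_fixed by blast
  then show "inner ((x, y) - (u, w)) q = 0"
    using assms(2) by (cases q) (auto simp: inner_prod_def)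
qed

definition R :: "'a \<Rightarrow>\<^sub>L 'a" where "R = Blinfun (\<lambda>x. fst (graph_projection (x, 0)))"
definition S :: "'a \<Rightarrow>\<^sub>L 'a" where "S = Blinfun (\<lambda>x. snd (graph_projection (x, 0)))"

lemma R_apply: "R x = fst (graph_projection (x, 0))"
  and S_apply: "S x = snd (graph_projection (x, 0))"
proof -
  have bl: "bounded_linear (\<lambda>x. graph_projection (x, 0))"
    by (intro bounded_linear_compose[OF blinfun.bounded_linear_right] bounded_linear_Pair
        bounded_linear_ident bounded_linear_zero)
  show "R x = fst (graph_projection (x, 0))"
    unfolding R_def by (subst bounded_linear_Blinfun_apply) (intro bounded_linear_fst_comp bl, simp)
  show "S x = snd (graph_projection (x, 0))"
    unfolding S_def by (subst bounded_linear_Blinfun_apply) (intro bounded_linear_snd_comp bl, simp)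
qed

lemma RS_mem: "(R x, S x) \<in> G"
  using graph_projection_mem[of "(x, 0)"] by (simp add: R_apply S_apply)

lemma RS_orth: "(v, z) \<in> G \<Longrightarrow> inner (x - R x) v = inner (S x) z"
proof -
  assume "(v, z) \<in> G"
  then have fixd: "graph_projection (v, z) = (v, z)" using graph_projection_fixed by blast
  have "inner (x, 0) (v, z) = inner (graph_projection (x, 0)) (v, z)"
    using orth_proj_sym[OF graph_projection(1), of "(x, 0)" "(v, z)"] fixd by simp
  then show ?thesis by (simp add: inner_prod_def R_apply S_apply inner_diff_left)
qed

text \<open>Orthogonality of \<open>(x, 0) - (R x, S x)\<close> to the graph says, by
  selfadjointness, that this pair lies in the graph. It is the identity T S x = x - R x, that is, (1
  + T^2) R x = x.\<close>

lemma SR_mem: "(S x, x - R x) \<in> G"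
  by (rule memI) (metis RS_orth inner_commute)

lemma graph_projection_apply: "graph_projection (x, y) = (R x + S y, S x + (y - R y))"
proof (rule graph_projection_eqI)
  show "(R x + S y, S x + (y - R y)) \<in> G" by (intro add_mem RS_mem SR_mem)
  fix v z assume vz: "(v, z) \<in> G"
  show "inner (x - (R x + S y)) v + inner (y - (S x + (y - R y))) z = 0"
    using RS_orth[OF vz, of x] symm[OF RS_mem[of y] vz]
    by (simp add: inner_diff_left inner_add_left)
qed

lemma R_sym: "sym_op R" and S_sym: "sym_op S"
proof -
  show "sym_op R"
    using orth_proj_sym[OF graph_projection(1), of "(_, 0)" "(_, 0)"]
    by (simp add: sym_op_def graph_projection_apply inner_prod_def blinfun.zero_right)
  show "sym_op S"
    using orth_proj_sym[OF graph_projection(1), of "(_, 0)" "(0, _)"]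
    by (simp add: sym_op_def graph_projection_apply inner_prod_def blinfun.zero_right)
qed

text \<open>Both identities are entries of the idempotency equation of the graph projection, the
  matrix with rows (R, S) and (S, 1 - R).\<close>

lemma RS_square: "R (R x) + S (S x) = R x" and RS_commute: "S (R x) = R (S x)"
  using orth_proj_idem[OF graph_projection(1), of "(x, 0)"]
  by (auto simp: graph_projection_apply blinfun.zero_right)

lemma R_form: "inner (R x) x = (norm (R x))\<^sup>2 + (norm (S x))\<^sup>2"
proof -
  have "inner (R x) x = inner (R (R x) + S (S x)) x" by (simp add: RS_square)
  then show ?thesis
    by (simp add: inner_add_left sym_opD[OF R_sym] sym_opD[OF S_sym] power2_norm_eq_inner)
qed

lemma R_nonneg: "0 \<le> inner (R x) x" by (simp add: R_form)

lemma R_le: "inner (R x) x \<le> (norm x)\<^sup>2"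
proof -
  have "(norm (R x))\<^sup>2 \<le> inner (R x) x" by (simp add: R_form)
  also have "\<dots> \<le> norm (R x) * norm x" by (rule norm_cauchy_schwarz)
  finally have "norm (R x) \<le> norm x"
    by (cases "norm (R x) = 0") (auto simp: power2_eq_square)
  then have "norm (R x) * norm x \<le> (norm x)\<^sup>2"
    by (simp add: power2_eq_square mult_right_mono)
  then show ?thesis using norm_cauchy_schwarz[of "R x" x] by linarith
qed

lemma R_eq_0D: "inner (R x) x \<le> 0 \<Longrightarrow> x = 0"
proof -
  assume "inner (R x) x \<le> 0"
  then have "(norm (R x))\<^sup>2 + (norm (S x))\<^sup>2 \<le> 0" by (simp add: R_form)
  then have "R x = 0" "S x = 0" by (simp_all add: sum_power2_le_zero_iff)
  then show "x = 0" using SR_mem[of x] zero_mem single_valued by force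
qed

definition reduces :: "('a \<Rightarrow>\<^sub>L 'a) \<Rightarrow> bool" where
  "reduces C \<longleftrightarrow> (\<forall>(x, y)\<in>G. (C x, C y) \<in> G)"

lemma reducesD: "reduces C \<Longrightarrow> (x, y) \<in> G \<Longrightarrow> (C x, C y) \<in> G"
  unfolding reduces_def by blast

text \<open>\<open>C\<close> leaves the graph invariant and \<open>C'\<close> its orthogonal
  complement, so \<open>C\<close> acting on both components commutes with the graph projection.
  \<open>commute_reduces\<close> is the converse.\<close>

lemma reduces_commute:
  assumes "adjoint_pair C C'" "reduces C" "reduces C'"
  shows "R (C x) = C (R x)" "S (C x) = C (S x)"
proof -
  have "graph_projection (C x, 0) = (C (R x), C (S x))"
  proof (rule graph_projection_eqI)
    show "(C (R x), C (S x)) \<in> G" using assms RS_mem by (auto simp: reduces_def)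
    fix v z assume "(v, z) \<in> G"
    then have "(C' v, C' z) \<in> G" using assms(3) by (rule reducesD[rotated])
    then have "inner (x - R x) (C' v) = inner (S x) (C' z)" by (rule RS_orth)
    then show "inner (C x - C (R x)) v + inner (0 - C (S x)) z = 0"
      using assms(1) by (simp add: adjoint_pair_def inner_diff_left)
  qed
  then show "R (C x) = C (R x)" "S (C x) = C (S x)" by (auto simp: R_apply S_apply)
qed

lemma commute_reduces:
  fixes C :: "'a \<Rightarrow>\<^sub>L 'a"
  assumes R: "\<And>x. R (C x) = C (R x)" and S: "\<And>x. S (C x) = C (S x)"
  shows "reduces C"
  unfolding reduces_def
proof (intro ballI, clarify)
  fix x y assume "(x, y) \<in> G"
  then have "graph_projection (x, y) = (x, y)" using graph_projection_fixed by blast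
  then have 1: "R x + S y = x" and 2: "S x + (y - R y) = y" by (auto simp: graph_projection_apply)
  have "C (R x + S y) = C x" "C (S x + (y - R y)) = C y" using 1 2 by auto
  then have "graph_projection (C x, C y) = (C x, C y)"
    by (auto simp: graph_projection_apply R S blinfun.bilinear_simps)
  then show "(C x, C y) \<in> G" using graph_projection_fixed by blast
qed

text \<open>The range of \<open>specfam c\<close> is the part of the space on which the operator is at most \<open>c\<close>:
  \<open>c R - S\<close> is the product of \<open>c - T\<close> and \<open>(1 + T\<^sup>2)\<^sup>-\<^sup>1\<close>.\<close>

definition specfam :: "real \<Rightarrow> 'a \<Rightarrow>\<^sub>L 'a" where
  "specfam c = (SOME P. orth_proj P \<and>
     (\<forall>x. P x = x \<longrightarrow> inner (S x) x \<le> c * inner (R x) x) \<and>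
     (\<forall>x. P x = 0 \<longrightarrow> inner (S x) x \<le> c * inner (R x) x \<longrightarrow> x = 0) \<and>
     (\<forall>C C'. adjoint_pair C C' \<longrightarrow> (\<forall>x. R (C x) = C (R x)) \<longrightarrow> (\<forall>x. S (C x) = C (S x)) \<longrightarrow>
        (\<forall>x. P (C x) = C (P x))))"

lemma specfam_exists:
  "\<exists>P. orth_proj P \<and>
     (\<forall>x. P x = x \<longrightarrow> inner (S x) x \<le> c * inner (R x) x) \<and>
     (\<forall>x. P x = 0 \<longrightarrow> inner (S x) x \<le> c * inner (R x) x \<longrightarrow> x = 0) \<and>
     (\<forall>C C'. adjoint_pair C C' \<longrightarrow> (\<forall>x. R (C x) = C (R x)) \<longrightarrow> (\<forall>x. S (C x) = C (S x)) \<longrightarrow>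
        (\<forall>x. P (C x) = C (P x)))"
proof -
  define B where "B = c *\<^sub>R R - S"
  have B: "B x = c *\<^sub>R R x - S x" for x by (simp add: B_def blinfun.bilinear_simps)
  have "sym_op B" using R_sym S_sym by (simp add: sym_op_def B inner_diff)
  then show ?thesis
  proof (rule nonneg_part_proj)
    fix P
    assume P: "orth_proj P" "\<And>x. P x = x \<Longrightarrow> 0 \<le> inner (B x) x"
      "\<And>x. P x = 0 \<Longrightarrow> 0 \<le> inner (B x) x \<Longrightarrow> x = 0"
      "\<And>(C :: 'a \<Rightarrow>\<^sub>L 'a) (C' :: 'a \<Rightarrow>\<^sub>L 'a) x. (\<And>x y. inner (C x) y = inner x (C' y)) \<Longrightarrow>
         (\<And>x. B (C x) = C (B x)) \<Longrightarrow> P (C x) = C (P x)"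
    show ?thesis
    proof (intro exI[of _ P] conjI allI impI)
      show "orth_proj P" by fact
      show "inner (S x) x \<le> c * inner (R x) x" if "P x = x" for x
        using P(2)[OF that] by (simp add: B inner_diff_left)
      show "x = 0" if "P x = 0" "inner (S x) x \<le> c * inner (R x) x" for x
        using P(3)[of x] that by (simp add: B inner_diff_left)
      fix C C' x assume "adjoint_pair C C'" "\<forall>x. R (C x) = C (R x)" "\<forall>x. S (C x) = C (S x)"
      then show "P (C x) = C (P x)"
        by (intro P(4)[of C C']) (auto simp: adjoint_pair_def B blinfun.bilinear_simps)
    qed
  qed
qed

lemma specfam_proj: "orth_proj (specfam c)"
  and specfam_le: "specfam c x = x \<Longrightarrow> inner (S x) x \<le> c * inner (R x) x"
  and specfam_gt: "specfam c x = 0 \<Longrightarrow> inner (S x) x \<le> c * inner (R x) x \<Longrightarrow> x = 0"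
  and specfam_commute: "adjoint_pair C C' \<Longrightarrow> (\<And>x. R (C x) = C (R x)) \<Longrightarrow>
     (\<And>x. S (C x) = C (S x)) \<Longrightarrow> specfam c (C x) = C (specfam c x)"
  using someI_ex[OF specfam_exists, of c, folded specfam_def] by blast+

lemma specfam_R: "R (specfam c x) = specfam c (R x)" and specfam_S: "S (specfam c x) = specfam c (S x)"
  using specfam_commute[of R R] specfam_commute[of S S] R_sym S_sym RS_commute
  by (simp_all add: sym_op_adjoint_pair)

lemma specfam_comm: "specfam c (specfam d x) = specfam d (specfam c x)"
  by (rule specfam_commute[of _ "specfam d"])
    (simp_all add: sym_op_adjoint_pair[symmetric] orth_proj_imp_sym_op[OF specfam_proj] specfam_R specfam_S)

text \<open>A vector in the range for \<open>c\<close> and in the kernel for \<open>d\<close>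
  satisfies the form inequality for \<open>c\<close>, hence for \<open>d\<close> because
  \<open>R\<close> is nonnegative, and \<open>specfam_gt\<close> then annihilates it.\<close>

lemma specfam_mono: "c \<le> d \<Longrightarrow> specfam d (specfam c x) = specfam c x"
proof -
  assume cd: "c \<le> d"
  define y where "y = specfam c x - specfam d (specfam c x)"
  have 1: "specfam c y = y"
    by (simp add: y_def blinfun.bilinear_simps specfam_comm[of c d] orth_proj_idem[OF specfam_proj])
  have 2: "specfam d y = 0" by (simp add: y_def blinfun.bilinear_simps orth_proj_idem[OF specfam_proj])
  have "inner (S y) y \<le> c * inner (R y) y" using specfam_le[OF 1] .
  also have "\<dots> \<le> d * inner (R y) y" using cd R_nonneg by (intro mult_right_mono)
  finally have "y = 0" using specfam_gt[OF 2] by blast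
  then show ?thesis by (simp add: y_def)
qed

text \<open>The part of the limit projection beyond \<open>specfam c\<close> satisfies the form
  inequality at every \<open>d n\<close>, hence at \<open>c\<close> in the limit. Continuity is from
  the right because \<open>specfam_gt\<close> admits equality, that is, because the kernel of c R -
  S belongs to the range of \<open>specfam c\<close>.\<close>

lemma specfam_right_limit: "(\<lambda>n. specfam (c + inverse (real (Suc n))) x) \<longlonglongrightarrow> specfam c x"
proof -
  define d where "d n = c + inverse (real (Suc n))" for n
  have d: "d \<longlonglongrightarrow> c" unfolding d_def using tendsto_add[OF tendsto_const LIMSEQ_inverse_real_of_nat, of c] by simp
  have cd: "c \<le> d n" for n by (simp add: d_def)
  have mono: "specfam (d m) (specfam (d n) x) = specfam (d n) x" if "m \<le> n" for m n x
    by (rule specfam_mono) (use that in \<open>simp add: d_def\<close>)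
  obtain P where P: "orth_proj P" "\<And>x. (\<lambda>n. specfam (d n) x) \<longlonglongrightarrow> P x" "\<And>n x. specfam (d n) (P x) = P x"
    by (rule orth_proj_decseq_limit[of "\<lambda>n. specfam (d n)"]) (use specfam_proj mono in auto)
  define y where "y = P x - specfam c (P x)"
  have 0: "specfam c y = 0" by (simp add: y_def blinfun.bilinear_simps orth_proj_idem[OF specfam_proj])
  have "specfam (d n) y = y" for n
    by (simp add: y_def blinfun.bilinear_simps P(3) specfam_mono[OF cd])
  then have "inner (S y) y \<le> d n * inner (R y) y" for n by (rule specfam_le)
  moreover have "(\<lambda>n. d n * inner (R y) y) \<longlonglongrightarrow> c * inner (R y) y" by (intro tendsto_intros d)
  ultimately have "inner (S y) y \<le> c * inner (R y) y" by (intro LIMSEQ_le_const) auto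
  then have "y = 0" using specfam_gt[OF 0] by blast
  then have 1: "specfam c (P x) = P x" by (simp add: y_def)
  have "(\<lambda>n. specfam c (specfam (d n) x)) \<longlonglongrightarrow> specfam c (P x)" by (intro tendsto_intros P)
  then have "(\<lambda>n. specfam c x) \<longlonglongrightarrow> specfam c (P x)"
    by (simp add: specfam_comm[of c] specfam_mono[OF cd])
  then have "specfam c x = P x" using 1 LIMSEQ_unique tendsto_const by metis
  then show ?thesis using P(2)[of x] by (simp add: d_def)
qed

text \<open>A vector \<open>y\<close> in all these ranges would satisfy n <R y, y> <= - <S y, y> for
  every n, which by the Archimedean property and injectivity of \<open>R\<close> leaves only 0. The
  limit at the top is the mirror image.\<close>

lemma specfam_bot_limit: "(\<lambda>n. specfam (- real n) x) \<longlonglongrightarrow> 0"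
proof -
  obtain P where P: "orth_proj P" "\<And>x. (\<lambda>n. specfam (- real n) x) \<longlonglongrightarrow> P x"
      "\<And>n x. specfam (- real n) (P x) = P x"
    by (rule orth_proj_decseq_limit[of "\<lambda>n. specfam (- real n)"]) (use specfam_proj in \<open>auto intro: specfam_mono\<close>)
  define y where "y = P x"
  have "inner (S y) y \<le> - real n * inner (R y) y" for n
    by (rule specfam_le) (simp add: y_def P(3))
  then have "inner (S y) y \<le> - (real n * inner (R y) y)" for n by simp
  then have *: "real n * inner (R y) y \<le> - inner (S y) y" for n by (simp add: le_minus_iff)
  have "inner (R y) y \<le> 0"
  proof (rule ccontr)
    assume "\<not> ?thesis"
    then obtain n where "- inner (S y) y < real n * inner (R y) y"
      using reals_Archimedean3 by (meson not_le)
    then show False using * not_less by blast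
  qed
  then have "y = 0" by (rule R_eq_0D)
  then show ?thesis using P(2)[of x] by (simp add: y_def)
qed

lemma specfam_top_limit: "(\<lambda>n. specfam (real n) x) \<longlonglongrightarrow> x"
proof -
  obtain P where P: "orth_proj P" "\<And>x. (\<lambda>n. (id_blinfun - specfam (real n)) x) \<longlonglongrightarrow> P x"
      "\<And>n x. (id_blinfun - specfam (real n)) (P x) = P x"
  proof (rule orth_proj_decseq_limit[of "\<lambda>n. id_blinfun - specfam (real n)"])
    fix m n :: nat and x assume "m \<le> n"
    then have "specfam (real m) (specfam (real n) x) = specfam (real m) x"
      using specfam_mono[of "real m" "real n" x] by (simp add: specfam_comm)
    then show "(id_blinfun - specfam (real m)) ((id_blinfun - specfam (real n)) x)
        = (id_blinfun - specfam (real n)) x"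
      by (simp add: blinfun.bilinear_simps)
  qed (auto intro!: orth_proj_compl[OF specfam_proj])
  define y where "y = P x"
  have "specfam (real n) y = 0" for n using P(3)[of n x] by (simp add: y_def blinfun.bilinear_simps)
  then have *: "y = 0 \<or> real n * inner (R y) y \<le> inner (S y) y" for n
    using specfam_gt[of "real n" y] by force
  have "y = 0"
  proof (rule ccontr)
    assume y: "y \<noteq> 0"
    then have "\<not> inner (R y) y \<le> 0" using R_eq_0D by blast
    then obtain n where "inner (S y) y < real n * inner (R y) y"
      using reals_Archimedean3 by (meson not_le)
    then show False using * y not_less by blast
  qed
  then have "(\<lambda>n. x - (id_blinfun - specfam (real n)) x) \<longlonglongrightarrow> x - 0"
    using P(2)[of x] by (intro tendsto_intros) (simp add: y_def)
  then show ?thesis by (simp add: blinfun.bilinear_simps)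
qed

end

section \<open>From spectral families to projection-valued measures\<close>

text \<open>The norm bound by the quadratic form with constant 0 plays the role of
  polarisation.\<close>

lemma sym_op_eqI:
  fixes A B :: "'a::real_inner \<Rightarrow>\<^sub>L 'a"
  assumes "sym_op A" "sym_op B" "\<And>x. inner (A x) x = inner (B x) x"
  shows "A = B"
proof -
  have "norm (A - B) \<le> 0"
    by (rule sym_op_norm_le) (use assms in \<open>auto simp: sym_op_def blinfun.bilinear_simps inner_diff\<close>)
  then show ?thesis by simp
qed

locale pvm =
  fixes E :: "real set \<Rightarrow> 'a::{real_inner,banach} \<Rightarrow>\<^sub>L 'a"
  assumes proj: "A \<in> sets borel \<Longrightarrow> orth_proj (E A)"
    and E_UNIV: "E UNIV = id_blinfun"
    and sums: "range S \<subseteq> sets borel \<Longrightarrow> disjoint_family S \<Longrightarrow> (\<lambda>n::nat. E (S n) x) sums E (\<Union>n. S n) x"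
begin

lemma E_empty [simp]: "E {} = 0"
proof (rule blinfun_eqI)
  fix x
  have "(\<lambda>n::nat. E {} x) sums E {} x"
    using sums[of "\<lambda>_. {}" x] by (simp add: disjoint_family_on_def)
  then have "(\<lambda>n::nat. E {} x) \<longlonglongrightarrow> 0" using sums_summable summable_LIMSEQ_zero by blast
  then show "E {} x = blinfun_apply 0 x" by (simp add: LIMSEQ_const_iff)
qed

lemma union:
  assumes "A \<in> sets borel" "B \<in> sets borel" "A \<inter> B = {}"
  shows "E (A \<union> B) x = E A x + E B x"
proof -
  have "range (binaryset A B) \<subseteq> sets borel" using assms by (simp add: range_binaryset_eq)
  moreover have "disjoint_family (binaryset A B)"
    using assms(3) by (auto simp: disjoint_family_on_def binaryset_def)
  ultimately have "(\<lambda>n. E (binaryset A B n) x) sums E (A \<union> B) x"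
    using sums[of "binaryset A B" x] by (simp add: UN_binaryset_eq)
  moreover have "(\<lambda>n. E (binaryset A B n) x) sums (E A x + E B x)"
    by (rule binaryset_sums) simp
  ultimately show ?thesis by (rule sums_unique2)
qed

lemma compl: "A \<in> sets borel \<Longrightarrow> E (- A) x = x - E A x"
  using union[of A "- A" x] by (simp add: E_UNIV Compl_partition algebra_simps)

text \<open>\<open>E (A \<union> B) = E A + E B\<close> is a contraction. For \<open>y\<close> in
  the range of \<open>E B\<close> this reads |E A y + y| <= |y|, and expanding the square leaves 3
  |E A y|^2 <= 0. Multiplicativity on intersections follows.\<close>

lemma disjoint:
  assumes "A \<in> sets borel" "B \<in> sets borel" "A \<inter> B = {}"
  shows "E A (E B x) = 0"
proof -
  define y where "y = E B x"
  have y: "E B y = y" by (simp add: y_def orth_proj_idem proj assms)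
  have "orth_proj (E (A \<union> B))" using assms by (intro proj) auto
  from orth_proj_norm_le[OF this, of y]
  have "(norm (E A y + y))\<^sup>2 \<le> (norm y)\<^sup>2" using y by (simp add: union[OF assms] power_mono)
  moreover have "inner (E A y) y = (norm (E A y))\<^sup>2" by (rule orth_proj_inner[OF proj[OF assms(1)]])
  ultimately have "3 * (norm (E A y))\<^sup>2 \<le> 0"
    by (simp add: power2_norm_eq_inner inner_add inner_commute)
  then show ?thesis by (simp add: y_def)
qed

lemma inter:
  assumes "A \<in> sets borel" "B \<in> sets borel"
  shows "E A (E B x) = E (A \<inter> B) x"
proof -
  have A: "A = (A \<inter> B) \<union> (A - B)" and B: "B = (A \<inter> B) \<union> (B - A)" by auto
  have "E B x = E (A \<inter> B) x + E (B - A) x"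
    by (subst B, subst union) (use assms in auto)
  moreover have "E A y = E (A \<inter> B) y + E (A - B) y" for y
    by (subst A, subst union) (use assms in auto)
  moreover have "E (A - B) (E (A \<inter> B) x) = 0" "E (A \<inter> B) (E (B - A) x) = 0"
    "E (A - B) (E (B - A) x) = 0"
    using assms by (intro disjoint; auto)+
  ultimately show ?thesis
    using assms by (simp add: blinfun.bilinear_simps orth_proj_idem proj)
qed

lemma mono: "A \<in> sets borel \<Longrightarrow> B \<in> sets borel \<Longrightarrow> A \<subseteq> B \<Longrightarrow> E A x = x \<Longrightarrow> E B x = x"
  by (metis inter inf.absorb_iff2 inf_commute)

end

definition vmeasure :: "(real set \<Rightarrow> 'a::real_inner \<Rightarrow>\<^sub>L 'a) \<Rightarrow> 'a \<Rightarrow> real measure" where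
  "vmeasure E x = measure_of UNIV (sets borel) (\<lambda>A. ennreal (inner (E A x) x))"

lemma sets_vmeasure [simp, measurable_cong]: "sets (vmeasure E x) = sets borel"
  and space_vmeasure [simp]: "space (vmeasure E x) = UNIV"
  using sets.sigma_sets_eq[of "borel :: real measure"] by (auto simp: vmeasure_def)

context pvm
begin

lemma emeasure_vmeasure:
  assumes "A \<in> sets borel"
  shows "emeasure (vmeasure E x) A = ennreal (inner (E A x) x)"
proof (rule emeasure_measure_of[OF vmeasure_def])
  show "countably_additive (sets (vmeasure E x)) (\<lambda>A. ennreal (inner (E A x) x))"
    unfolding countably_additive_def
  proof (intro allI impI)
    fix A :: "nat \<Rightarrow> real set" assume A: "range A \<subseteq> sets (vmeasure E x)" "disjoint_family A"
    then have "(\<lambda>n. inner (E (A n) x) x) sums inner (E (\<Union>n. A n) x) x"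
      using sums[of A x] bounded_linear.sums[OF bounded_linear_inner_left] by simp
    moreover have "0 \<le> inner (E (A n) x) x" for n
      using A(1) orth_proj_inner[OF proj, of "A n" x] by auto
    ultimately show "(\<Sum>n. ennreal (inner (E (A n) x) x)) = ennreal (inner (E (\<Union>n. A n) x) x)"
      by (intro suminf_ennreal_eq)
  qed
qed (use assms in \<open>auto simp: positive_def\<close>)

lemma measure_vmeasure: "A \<in> sets borel \<Longrightarrow> measure (vmeasure E x) A = (norm (E A x))\<^sup>2"
  by (simp add: measure_def emeasure_vmeasure orth_proj_inner[OF proj])

lemma finite_vmeasure: "finite_measure (vmeasure E x)"
  by (rule finite_measureI) (simp add: emeasure_vmeasure)

end

lemma UN_Ioc_nat: "(\<Union>n. {- real n<..real n}) = UNIV"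
proof -
  have "y \<in> (\<Union>n. {- real n<..real n})" for y
  proof -
    obtain n where "\<bar>y\<bar> < real n" using reals_Archimedean2 by blast
    then have "y \<in> {- real n<..real n}" by auto
    then show ?thesis by blast
  qed
  then show ?thesis by blast
qed

text \<open>Each Borel set \<open>A\<close> gets a projection whose quadratic form is the measure of \<open>A\<close>; the sets for
  which this is possible form a Dynkin system.\<close>

lemma spectral_family_extends:
  fixes F :: "real \<Rightarrow> 'a::{real_inner,banach} \<Rightarrow>\<^sub>L 'a"
  assumes F: "\<And>c. orth_proj (F c)"
    and mono: "\<And>c d x. c \<le> d \<Longrightarrow> F d (F c x) = F c x"
    and right: "\<And>c x. (\<lambda>n. F (c + inverse (real (Suc n))) x) \<longlonglongrightarrow> F c x"
    and bot: "\<And>x. (\<lambda>n. F (- real n) x) \<longlonglongrightarrow> 0"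
    and top: "\<And>x. (\<lambda>n. F (real n) x) \<longlonglongrightarrow> x"
  obtains E where "pvm E" "\<And>a b. a \<le> b \<Longrightarrow> E {a<..b} = F b - F a"
    "\<And>(C :: 'a \<Rightarrow>\<^sub>L 'a) A x. (\<And>c x. F c (C x) = C (F c x)) \<Longrightarrow> A \<in> sets borel \<Longrightarrow>
       E A (C x) = C (E A x)"
proof -
  define f where "f x c = inner (F c x) x" for x c
  have mono': "F c (F d x) = F c x" if "c \<le> d" for c d x
  proof -
    have "inner (F c (F d x)) y = inner (F c x) y" for y
      using mono[OF that] by (simp add: orth_proj_sym[OF F])
    then show ?thesis using vector_eq_rdot by blast
  qed
  have proj_diff: "orth_proj (F b - F a)" if "a \<le> b" for a b
    by (rule orth_projI)
      (simp_all add: blinfun.bilinear_simps inner_diff orth_proj_sym[OF F] orth_proj_idem[OF F]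
        mono[OF that] mono'[OF that])
  have f_mono: "f x a \<le> f x b" if "a \<le> b" for x a b
  proof -
    have "0 \<le> inner ((F b - F a) x) x" by (simp add: orth_proj_inner[OF proj_diff[OF that]])
    then show ?thesis by (simp add: f_def blinfun.bilinear_simps inner_diff_left)
  qed
  have f_right: "continuous (at_right c) (f x)" for x c
  proof -
    have *: "\<exists>d>0. f x (c + d) - f x c < e" if "e > 0" for e
    proof -
      have "(\<lambda>n. f x (c + inverse (real (Suc n))) - f x c) \<longlonglongrightarrow> f x c - f x c"
        unfolding f_def by (intro tendsto_intros right)
      then have "\<forall>\<^sub>F n in sequentially. f x (c + inverse (real (Suc n))) - f x c < e"
        using \<open>e > 0\<close> by (intro order_tendstoD) auto
      then obtain n where "f x (c + inverse (real (Suc n))) - f x c < e"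
        using eventually_happens'[OF sequentially_bot] by blast
      then show ?thesis by (intro exI[of _ "inverse (real (Suc n))"]) auto
    qed
    show ?thesis
      by (rule continuous_at_right_real_increasing[THEN iffD2]) (use f_mono * in auto)
  qed
  define \<mu> where "\<mu> x = interval_measure (f x)" for x
  have sets_\<mu> [simp]: "sets (\<mu> x) = sets borel" and space_\<mu> [simp]: "space (\<mu> x) = UNIV" for x
    by (simp_all add: \<mu>_def)
  have Ioc: "emeasure (\<mu> x) {a<..b} = ennreal (f x b - f x a)" if "a \<le> b" for x a b
    unfolding \<mu>_def by (rule emeasure_interval_measure_Ioc) (use that f_mono f_right in auto)
  have total: "emeasure (\<mu> x) UNIV = ennreal ((norm x)\<^sup>2)" for x
  proof -
    have "(\<lambda>n. emeasure (\<mu> x) {- real n<..real n}) \<longlonglongrightarrow> emeasure (\<mu> x) (\<Union>n. {- real n<..real n})"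
      by (intro Lim_emeasure_incseq) (auto simp: incseq_def)
    also note UN_Ioc_nat
    finally have 1: "(\<lambda>n. emeasure (\<mu> x) {- real n<..real n}) \<longlonglongrightarrow> emeasure (\<mu> x) UNIV" .
    have "(\<lambda>n. ennreal (f x (real n) - f x (- real n))) \<longlonglongrightarrow> ennreal (inner x x - inner 0 x)"
      unfolding f_def by (intro tendsto_intros top bot)
    then have "(\<lambda>n. emeasure (\<mu> x) {- real n<..real n}) \<longlonglongrightarrow> ennreal (inner x x - inner 0 x)"
      by (simp add: Ioc)
    with 1 show ?thesis using LIMSEQ_unique by (fastforce simp: power2_norm_eq_inner)
  qed
  have fin: "finite_measure (\<mu> x)" for x by (rule finite_measureI) (simp add: total)
  have total': "measure (\<mu> x) UNIV = (norm x)\<^sup>2" for x by (simp add: measure_def total)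
  \<comment> \<open>The quadratic form determines \<open>P\<close>, which later identifies the
    chosen projections on intervals and on tails. The commutation clause is carried through the
    induction because every closure operation preserves it.\<close>
  define good where "good A P \<longleftrightarrow> orth_proj P \<and> (\<forall>x. measure (\<mu> x) A = inner (P x) x) \<and>
      (\<forall>C :: 'a \<Rightarrow>\<^sub>L 'a. (\<forall>c x. F c (C x) = C (F c x)) \<longrightarrow> (\<forall>x. P (C x) = C (P x)))" for A P
  have good_Ioc: "good {a<..b} (F b - F a)" if "a \<le> b" for a b
    using that f_mono[OF that]
    by (auto simp: good_def proj_diff measure_def Ioc f_def blinfun.bilinear_simps inner_diff_left)
  have ex_good: "\<exists>P. good A P" if "A \<in> sets borel" for A
  proof -
    have A_sigma: "A \<in> sigma_sets UNIV (range (\<lambda>(a::real, b). {a<..b}))"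
      using that by (subst (asm) borel_sigma_sets_Ioc) simp
    have stable: "Int_stable (range (\<lambda>(a::real, b). {a<..b}))"
      unfolding Int_stable_def
    proof (intro ballI)
      fix A B assume "A \<in> range (\<lambda>(a::real, b). {a<..b})" "B \<in> range (\<lambda>(a::real, b). {a<..b})"
      then obtain a b c d where "A = {a<..b}" "B = {c<..d}" by auto
      then have "A \<inter> B = (\<lambda>(a, b). {a<..b}) (max a c, min b d)" by auto
      then show "A \<inter> B \<in> range (\<lambda>(a::real, b). {a<..b})" by blast
    qed
    have "range (\<lambda>(a::real, b). {a<..b}) \<subseteq> Pow UNIV" by simp
    from stable this A_sigma show ?thesis
    proof (induction A rule: sigma_sets_induct_disjoint)
      case (basic A)
      then obtain a b where A: "A = {a<..b}" by auto
      show ?case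
      proof (cases "a \<le> b")
        case True then show ?thesis using good_Ioc A by blast
      next
        case False
        then have "A = {a<..a}" using A by auto
        then show ?thesis using good_Ioc[of a a] by blast
      qed
    next
      case empty
      then show ?case using good_Ioc[of 0 0] by (intro exI[of _ "F 0 - F 0"]) simp
    next
      case (compl A)
      then obtain P where P: "good A P" by blast
      have A: "A \<in> sets (\<mu> x)" for x using compl.hyps by (subst sets_\<mu>, subst borel_sigma_sets_Ioc) simp
      have "good (UNIV - A) (id_blinfun - P)"
        using P finite_measure.finite_measure_compl[OF fin A]
        by (auto simp: good_def orth_proj_compl blinfun.bilinear_simps inner_diff_left total'
            power2_norm_eq_inner)
      then show ?case by blast
    next
      case (union A)
      then obtain P where P: "\<And>i. good (A i) (P i)" by metis
      have A: "A i \<in> sets (\<mu> x)" for i x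
        using union.hyps(2) by (subst sets_\<mu>, subst borel_sigma_sets_Ioc) auto
      have disj: "A i \<inter> A j = {}" if "i \<noteq> j" for i j
        using union.hyps(1) that by (auto simp: disjoint_family_on_def)
      have oP: "orth_proj (P i)" and mP: "measure (\<mu> x) (A i) = inner (P i x) x" for i x
        using P by (auto simp: good_def)
      \<comment> \<open>Tested on a vector \<open>y\<close> of the range of \<open>P j\<close>,
        additivity of the measure gives |P i y|^2 + |y|^2 <= |y|^2.\<close>
      have PP: "P i (P j x) = 0" if "i \<noteq> j" for i j x
      proof -
        define y where "y = P j x"
        have "measure (\<mu> y) (A i \<union> A j) = measure (\<mu> y) (A i) + measure (\<mu> y) (A j)"
          by (rule finite_measure.finite_measure_Union[OF fin A A disj[OF that]])
        then have "inner (P i y) y + inner (P j y) y \<le> measure (\<mu> y) UNIV"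
          using finite_measure.bounded_measure[OF fin, of y "A i \<union> A j"] by (simp add: mP)
        then have "(norm (P i y))\<^sup>2 + (norm (P j y))\<^sup>2 \<le> (norm y)\<^sup>2"
          by (simp add: total' orth_proj_inner[OF oP])
        then show ?thesis by (simp add: y_def orth_proj_idem[OF oP])
      qed
      define Q where "Q n = (\<Sum>i<n. P i)" for n
      have Q: "Q n x = (\<Sum>i<n. P i x)" for n x by (simp add: Q_def blinfun.sum_left)
      have PQ: "P i (Q n x) = (if i < n then P i x else 0)" for i n x
      proof -
        have "P i (Q n x) = (\<Sum>j<n. if j = i then P i x else 0)"
          unfolding Q blinfun.sum_right by (intro sum.cong) (auto simp: PP orth_proj_idem[OF oP])
        then show ?thesis by simp
      qed
      have QQ: "Q n (Q m x) = Q m x" if "m \<le> n" for m n x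
      proof -
        have "Q n (Q m x) = (\<Sum>i<n. if i \<in> {..<m} then P i x else 0)"
          by (subst Q) (simp add: PQ)
        also have "\<dots> = Q m x" unfolding Q using that
          by (subst sum.inter_restrict[symmetric]) (auto intro: sum.cong)
        finally show ?thesis .
      qed
      have oQ: "orth_proj (Q n)" for n
        by (rule orth_projI)
          (simp_all add: QQ, simp add: Q inner_sum_left inner_sum_right orth_proj_sym[OF oP])
      obtain L where L: "orth_proj L" "\<And>x. (\<lambda>n. Q n x) \<longlonglongrightarrow> L x"
        using orth_proj_incseq_limit[of Q] oQ QQ by blast
      have "good (\<Union>i. A i) L"
        unfolding good_def
      proof (intro conjI allI impI L(1))
        fix x
        have "(\<lambda>i. measure (\<mu> x) (A i)) sums measure (\<mu> x) (\<Union>i. A i)"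
          by (rule finite_measure.finite_measure_UNION[OF fin _ union.hyps(1)]) (use A in auto)
        then have "(\<lambda>n. \<Sum>i<n. inner (P i x) x) \<longlonglongrightarrow> measure (\<mu> x) (\<Union>i. A i)"
          by (simp add: sums_def mP)
        then have "(\<lambda>n. inner (Q n x) x) \<longlonglongrightarrow> measure (\<mu> x) (\<Union>i. A i)"
          by (simp add: Q inner_sum_left)
        moreover have "(\<lambda>n. inner (Q n x) x) \<longlonglongrightarrow> inner (L x) x" by (intro tendsto_intros L)
        ultimately show "measure (\<mu> x) (\<Union>i. A i) = inner (L x) x" by (rule LIMSEQ_unique)
      next
        fix C :: "'a \<Rightarrow>\<^sub>L 'a" and x assume "\<forall>c x. F c (C x) = C (F c x)"
        then have "P i (C y) = C (P i y)" for i y using P[of i] unfolding good_def by blast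
        then have QC: "Q n (C x) = C (Q n x)" for n by (simp add: Q blinfun.sum_right)
        have "(\<lambda>n. C (Q n x)) \<longlonglongrightarrow> C (L x)" by (intro tendsto_intros L)
        then show "L (C x) = C (L x)" using L(2)[of "C x"] LIMSEQ_unique unfolding QC by blast
      qed
      then show ?case by blast
    qed
  qed
  define E where "E A = (SOME P. good A P)" for A
  have E: "good A (E A)" if "A \<in> sets borel" for A
    unfolding E_def using ex_good[OF that] by (rule someI_ex)
  have oE: "orth_proj (E A)" and mE: "inner (E A x) x = measure (\<mu> x) A" if "A \<in> sets borel" for A x
    using E[OF that] by (auto simp: good_def)
  have uniq: "E A = P" if "A \<in> sets borel" "good A P" for A P
    by (rule sym_op_eqI) (use that E[OF that(1)] in \<open>auto simp: good_def intro: orth_proj_imp_sym_op\<close>)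
  have "pvm E"
  proof
    show "orth_proj (E A)" if "A \<in> sets borel" for A by (rule oE[OF that])
    show "E UNIV = id_blinfun"
      by (rule uniq) (auto simp: good_def total' power2_norm_eq_inner intro!: orth_projI)
    fix A :: "nat \<Rightarrow> real set" and x
    assume A: "range A \<subseteq> sets borel" "disjoint_family A"
    define U where "U = (\<Union>i. A i)"
    define V where "V n = (\<Union>i<n. A i)" for n
    have Am [simp]: "A i \<in> sets borel" for i using A(1) by auto
    have UV [simp]: "U \<in> sets borel" "V n \<in> sets borel" for n
      by (auto simp: U_def V_def)
    then have [simp]: "U - V n \<in> sets borel" for n by (rule sets.Diff)
    have m_V: "measure (\<mu> y) (V n) = (\<Sum>i<n. measure (\<mu> y) (A i))" for n y
      unfolding V_def using A(2)
      by (intro finite_measure.finite_measure_finite_Union[OF fin])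
        (auto simp: disjoint_family_on_def)
    \<comment> \<open>The tail of the series is itself the projection of the tail set, so its
      squared norm is a measure that tends to 0.\<close>
    have diff: "E U - (\<Sum>i<n. E (A i)) = E (U - V n)" for n
    proof (rule sym_op_eqI)
      show "sym_op (E (U - V n))" by (intro orth_proj_imp_sym_op oE) auto
      have s: "inner (E B y) z = inner y (E B z)" if "B \<in> sets borel" for B y z
        by (rule orth_proj_sym[OF oE[OF that]])
      show "sym_op (E U - (\<Sum>i<n. E (A i)))"
        by (simp add: sym_op_def blinfun.bilinear_simps blinfun.sum_left inner_diff inner_sum_left
            inner_sum_right s)
      fix y
      have "measure (\<mu> y) (U - V n) = measure (\<mu> y) U - measure (\<mu> y) (V n)"
        by (intro finite_measure.finite_measure_Diff[OF fin]) (auto simp: U_def V_def)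
      then show "inner ((E U - (\<Sum>i<n. E (A i))) y) y = inner (E (U - V n) y) y"
        by (simp add: blinfun.bilinear_simps blinfun.sum_left inner_diff_left inner_sum_left mE m_V)
    qed
    have "(\<lambda>n. measure (\<mu> x) U - measure (\<mu> x) (V n)) \<longlonglongrightarrow> measure (\<mu> x) U - measure (\<mu> x) U"
    proof (intro tendsto_intros)
      have "(\<lambda>i. measure (\<mu> x) (A i)) sums measure (\<mu> x) U"
        unfolding U_def by (rule finite_measure.finite_measure_UNION[OF fin _ A(2)]) (use A in auto)
      then show "(\<lambda>n. measure (\<mu> x) (V n)) \<longlonglongrightarrow> measure (\<mu> x) U" by (simp add: sums_def m_V)
    qed
    also have "(\<lambda>n. measure (\<mu> x) U - measure (\<mu> x) (V n))
        = (\<lambda>n. (norm (E U x - (\<Sum>i<n. E (A i) x)))\<^sup>2)"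
    proof
      fix n
      have "measure (\<mu> x) U - measure (\<mu> x) (V n) = measure (\<mu> x) (U - V n)"
        by (intro finite_measure.finite_measure_Diff[OF fin, symmetric]) (auto simp: U_def V_def)
      also have "\<dots> = inner (E (U - V n) x) x" by (simp add: mE)
      also have "\<dots> = (norm (E (U - V n) x))\<^sup>2" by (intro orth_proj_inner oE) auto
      also have "E (U - V n) x = E U x - (\<Sum>i<n. E (A i) x)"
        by (simp add: diff[symmetric] blinfun.bilinear_simps blinfun.sum_left)
      finally show "measure (\<mu> x) U - measure (\<mu> x) (V n) = (norm (E U x - (\<Sum>i<n. E (A i) x)))\<^sup>2" .
    qed
    finally have "(\<lambda>n. sqrt ((norm (E U x - (\<Sum>i<n. E (A i) x)))\<^sup>2)) \<longlonglongrightarrow> sqrt 0"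
      by (intro tendsto_real_sqrt) simp
    then have "(\<lambda>n. E U x - (\<Sum>i<n. E (A i) x)) \<longlonglongrightarrow> 0" by (simp add: tendsto_norm_zero_iff)
    then have "(\<lambda>n. E U x - (E U x - (\<Sum>i<n. E (A i) x))) \<longlonglongrightarrow> E U x - 0" by (intro tendsto_intros)
    then show "(\<lambda>n. E (A n) x) sums E (\<Union>n. A n) x" by (simp add: sums_def U_def)
  qed
  moreover have "E {a<..b} = F b - F a" if "a \<le> b" for a b
    by (rule uniq) (auto intro: good_Ioc[OF that])
  moreover have "E A (C x) = C (E A x)"
    if "\<And>c x. F c (C x) = C (F c x)" "A \<in> sets borel" for C :: "'a \<Rightarrow>\<^sub>L 'a" and A x
    using E[OF that(2)] that(1) unfolding good_def by blast
  ultimately show ?thesis by (rule that)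
qed

section \<open>The spectral theorem\<close>

text \<open>The counterpart of \<open>is_spectral_measure\<close> for graphs in the underlying real
  Hilbert space; \<open>is_spectral_measure_imp\<close> and
  \<open>is_spectral_measure_spectral_measure\<close> translate between the two.\<close>

definition resolves :: "(real set \<Rightarrow> 'a::{real_inner,banach} \<Rightarrow>\<^sub>L 'a) \<Rightarrow> ('a \<times> 'a) set \<Rightarrow> bool" where
  "resolves E G \<longleftrightarrow> pvm E \<and> (\<forall>x. x \<in> fst ` G \<longleftrightarrow> integrable (vmeasure E x) (\<lambda>t. t\<^sup>2)) \<and>
     (\<forall>(x, y)\<in>G. inner y x = (\<integral>t. t \<partial>vmeasure E x))"

text \<open>Each bisection halves the factor \<open>b - a\<close> while the contributions of the
  additive \<open>M\<close> add up again, so the bound on the whole interval gains a factor 1/2.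
  This stands in for Riemann sums.\<close>

lemma additive_interval_function_eq_0:
  fixes D M :: "real \<Rightarrow> real \<Rightarrow> real"
  assumes D: "\<And>a b c. lo \<le> a \<Longrightarrow> a \<le> c \<Longrightarrow> c \<le> b \<Longrightarrow> b \<le> hi \<Longrightarrow> D a b = D a c + D c b"
    and M: "\<And>a b c. lo \<le> a \<Longrightarrow> a \<le> c \<Longrightarrow> c \<le> b \<Longrightarrow> b \<le> hi \<Longrightarrow> M a b = M a c + M c b"
    and bound: "\<And>a b. lo \<le> a \<Longrightarrow> a \<le> b \<Longrightarrow> b \<le> hi \<Longrightarrow> \<bar>D a b\<bar> \<le> K * (b - a) * M a b"
    and "lo \<le> hi"
  shows "D lo hi = 0"
proof -
  have *: "\<bar>D a b\<bar> \<le> (1/2) ^ k * (K * (b - a) * M a b)" if "lo \<le> a" "a \<le> b" "b \<le> hi" for a b k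
    using that
  proof (induction k arbitrary: a b)
    case 0 then show ?case using bound by simp
  next
    case (Suc k)
    define c where "c = (a + b) / 2"
    have c: "a \<le> c" "c \<le> b" "c - a = (b - a) / 2" "b - c = (b - a) / 2"
      using Suc.prems by (auto simp: c_def field_simps)
    have "\<bar>D a b\<bar> \<le> \<bar>D a c\<bar> + \<bar>D c b\<bar>" using D[of a c b] c Suc.prems by simp
    also have "\<dots> \<le> (1/2) ^ k * (K * (c - a) * M a c) + (1/2) ^ k * (K * (b - c) * M c b)"
      using Suc c by (intro add_mono Suc.IH) auto
    also have "\<dots> = (1/2) ^ Suc k * (K * (b - a) * (M a c + M c b))"
      unfolding c(3,4) by (simp add: field_simps)
    also have "M a c + M c b = M a b" using M[of a c b] c Suc.prems by simp
    finally show ?case .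
  qed
  have "(\<lambda>k. (1/2) ^ k * (K * (hi - lo) * M lo hi)) \<longlonglongrightarrow> 0 * (K * (hi - lo) * M lo hi)"
    by (intro tendsto_intros LIMSEQ_power_zero) simp
  then have "\<bar>D lo hi\<bar> \<le> 0"
    using *[of lo hi] \<open>lo \<le> hi\<close> by (intro LIMSEQ_le_const) auto
  then show ?thesis by simp
qed

lemma set_integral_near_const:
  fixes f :: "real \<Rightarrow> real"
  assumes fin: "finite_measure M" and sets: "sets M = sets borel" and f: "f \<in> borel_measurable borel"
    and A: "A \<in> sets borel" and near: "\<And>t. t \<in> A \<Longrightarrow> \<bar>f t - k\<bar> \<le> q"
  shows "set_integrable M A f" "\<bar>(LINT t:A|M. f t) - k * measure M A\<bar> \<le> q * measure M A"
proof -
  interpret finite_measure M by fact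
  note [measurable_cong] = sets
  note [measurable] = f A
  have bd: "\<bar>f t\<bar> \<le> \<bar>k\<bar> + \<bar>q\<bar>" if "t \<in> A" for t using near[OF that] by linarith
  show int: "set_integrable M A f"
    unfolding set_integrable_def
    by (rule integrable_const_bound[where B = "\<bar>k\<bar> + \<bar>q\<bar>"])
      (auto simp: indicator_def intro: bd)
  have indc: "integrable M (\<lambda>t. indicator A t * c)" for c :: real
    by (rule integrable_const_bound[where B = "\<bar>c\<bar>"]) (auto simp: indicator_def)
  have ic: "(\<integral>t. indicator A t * c \<partial>M) = c * measure M A" for c :: real
    using A sets by simp
  have "(LINT t:A|M. f t) - k * measure M A = (\<integral>t. indicator A t * f t - indicator A t * k \<partial>M)"
    using int indc[of k]
    by (subst Bochner_Integration.integral_diff)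
      (simp_all add: set_lebesgue_integral_def set_integrable_def ic)
  also have "\<bar>\<dots>\<bar> \<le> (\<integral>t. \<bar>indicator A t * f t - indicator A t * k\<bar> \<partial>M)"
    by (rule integral_abs_bound)
  also have "\<dots> \<le> (\<integral>t. indicator A t * q \<partial>M)"
  proof (rule integral_mono)
    show "integrable M (\<lambda>t. \<bar>indicator A t * f t - indicator A t * k\<bar>)"
      using int by (intro integrable_abs Bochner_Integration.integrable_diff indc) (simp add: set_integrable_def)
    show "\<bar>indicator A t * f t - indicator A t * k\<bar> \<le> indicator A t * q" for t
      using near[of t] by (auto simp: indicator_def)
  qed (rule indc)
  finally show "\<bar>(LINT t:A|M. f t) - k * measure M A\<bar> \<le> q * measure M A" unfolding ic by (simp add: mult.commute)
qed

context selfadjoint_graph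
begin

definition op :: "'a \<Rightarrow> 'a" where "op x = (THE w. (x, w) \<in> G)"

lemma op_eq: "(x, w) \<in> G \<Longrightarrow> op x = w"
  unfolding op_def using single_valued by blast

lemma op_mem: "x \<in> fst ` G \<Longrightarrow> (x, op x) \<in> G"
  using op_eq by force

end

locale spectral_extension = selfadjoint_graph G + pvm E
  for G :: "('a::{real_inner,banach} \<times> 'a) set" and E +
  assumes Ioc: "a \<le> b \<Longrightarrow> E {a<..b} = specfam b - specfam a"
    and commute: "(\<And>c x. specfam c (blinfun_apply C x) = blinfun_apply C (specfam c x)) \<Longrightarrow>
      A \<in> sets borel \<Longrightarrow> E A (blinfun_apply C x) = blinfun_apply C (E A x)"
begin

lemma E_R: "A \<in> sets borel \<Longrightarrow> E A (R x) = R (E A x)"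
  and E_S: "A \<in> sets borel \<Longrightarrow> E A (S x) = S (E A x)"
  by (rule commute; simp add: specfam_R specfam_S)+

lemma E_reduces: "A \<in> sets borel \<Longrightarrow> reduces (E A)"
  by (rule commute_reduces) (simp_all add: E_R E_S)

lemma Ioc_fixed:
  assumes "a \<le> b" "E {a<..b} y = y"
  shows "specfam b y = y" "specfam a y = 0"
proof -
  have y: "specfam b y - specfam a y = y" using assms by (simp add: Ioc blinfun.bilinear_simps)
  have "specfam b (specfam b y - specfam a y) = specfam b y - specfam a y"
    using assms(1) by (simp add: blinfun.bilinear_simps specfam_mono orth_proj_idem[OF specfam_proj])
  then show 1: "specfam b y = y" by (simp add: y)
  with y show "specfam a y = 0" by simp
qed

text \<open>With \<open>Q = sqrt R\<close> the form of \<open>T - c\<close> at \<open>R v\<close> is the form of \<open>S - c R\<close> at \<open>Q v\<close>.\<close>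

lemma form_bounds_range_R:
  assumes ab: "a \<le> b" and v: "E {a<..b} v = v"
  shows "a * (norm (R v))\<^sup>2 \<le> inner (S v) (R v)" "inner (S v) (R v) \<le> b * (norm (R v))\<^sup>2"
proof -
  obtain Q where Q: "sym_op Q" "\<And>x. Q (Q x) = R x"
      "\<And>(C :: 'a \<Rightarrow>\<^sub>L 'a) x. (\<And>x. R (C x) = C (R x)) \<Longrightarrow> Q (C x) = C (Q x)"
    by (rule blinfun_sqrt[OF R_sym R_nonneg R_le]) (rule that; blast)
  have QS: "Q (S x) = S (Q x)" for x by (rule Q(3)) (simp add: RS_commute)
  have "E {a<..b} (Q v) = Q v"
    using Q(3)[of "E {a<..b}" v] by (simp add: E_R v)
  note y = Ioc_fixed[OF ab this]
  have 1: "inner (S v) (R v) = inner (S (Q v)) (Q v)"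
    by (metis Q(2) QS sym_opD[OF Q(1)])
  have 2: "(norm (R v))\<^sup>2 = inner (R (Q v)) (Q v)"
    by (metis Q(2) sym_opD[OF Q(1)] power2_norm_eq_inner)
  show "inner (S v) (R v) \<le> b * (norm (R v))\<^sup>2" unfolding 1 2 by (rule specfam_le[OF y(1)])
  show "a * (norm (R v))\<^sup>2 \<le> inner (S v) (R v)"
    unfolding 1 2 using specfam_gt[OF y(2)] by force
qed

text \<open>On vectors \<open>R v\<close> with \<open>v\<close> in the spectral subspace the form
  bounds of \<open>form_bounds_range_R\<close> are available, and
  \<open>norm_le_of_quadratic_form\<close> turns them into a norm bound for T - m with m the
  midpoint. These vectors are dense in the subspace, and closedness of the graph extends domain
  membership and bound to all of it.\<close>

lemma bounded_on_Ioc: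
  assumes ab: "a \<le> b" and u: "E {a<..b} u = u"
  obtains w where "(u, w) \<in> G" "E {a<..b} w = w" "norm (w - ((a + b) / 2) *\<^sub>R u) \<le> (b - a) / 2 * norm u"
proof -
  define P where "P = E {a<..b}"
  define m where "m = (a + b) / 2"
  define r where "r = (b - a) / 2"
  have oP: "orth_proj P" by (simp add: P_def proj)
  define A where "A = (\<lambda>v. (R v, S v - m *\<^sub>R R v)) ` {v. P v = v}"
  have "subspace {v. P v = v}" by (auto simp: subspace_def blinfun.bilinear_simps)
  then have A: "subspace A"
    unfolding A_def
    by (intro linear_subspace_image) (auto intro!: linearI simp: blinfun.bilinear_simps algebra_simps)
  have dom_A: "fst ` A = R ` {v. P v = v}" by (auto simp: A_def image_image)
  have PR: "P (R v) = R (P v)" and PS: "P (S v) = S (P v)" for v by (simp_all add: P_def E_R E_S)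
  have cl_P: "P x = x" if "x \<in> closure (fst ` A)" for x
  proof -
    have "closure (fst ` A) \<subseteq> {x. P x = x}"
      by (intro closure_minimal closed_Collect_eq continuous_intros) (auto simp: dom_A PR)
    then show ?thesis using that by blast
  qed
  \<comment> \<open>Density: the component \<open>q\<close> of \<open>x\<close> orthogonal to the
    closure is itself in the spectral subspace, so \<open>R q\<close> lies in the closure. Thus <R
    q, q> = 0, which forces q = 0.\<close>
  have cl: "x \<in> closure (fst ` A)" if x: "P x = x" for x
  proof -
    have "subspace (closure (fst ` A))"
      by (intro real_subspace_closure linear_subspace_image A linear_fst)
    then obtain Pr where Pr: "orth_proj Pr" "range (blinfun_apply Pr) = closure (fst ` A)"
      using ex_orth_proj closed_closure by blast
    define q where "q = x - Pr x"
    have "P (Pr x) = Pr x" using Pr(2) by (intro cl_P) auto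
    then have "P q = q" by (simp add: q_def blinfun.bilinear_simps x)
    then have "R q \<in> closure (fst ` A)" using closure_subset dom_A by blast
    then have "Pr (R q) = R q" using orth_proj_range[OF Pr(1)] Pr(2) by blast
    then have "inner (R q) q = inner (R q) (Pr q)" by (metis orth_proj_sym[OF Pr(1)])
    also have "Pr q = 0" by (simp add: q_def blinfun.bilinear_simps orth_proj_idem[OF Pr(1)])
    finally have "q = 0" by (intro R_eq_0D) simp
    then have "x = Pr x" by (simp add: q_def)
    then show ?thesis using Pr(2) by (metis rangeI)
  qed
  have RG: "(R v, S v) \<in> G" for v by (rule RS_mem)
  have bound: "norm w \<le> r * norm z" if "(z, w) \<in> A" for z w
  proof (rule norm_le_of_quadratic_form[OF A _ _ that])
    fix u w v z assume "(u, w) \<in> A" "(v, z) \<in> A"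
    then obtain p q where "u = R p" "w = S p - m *\<^sub>R R p" "v = R q" "z = S q - m *\<^sub>R R q"
      by (auto simp: A_def)
    then show "inner w v = inner u z" using symm[OF RG[of p] RG[of q]] by (simp add: inner_diff)
  next
    fix u w assume "(u, w) \<in> A"
    then obtain p where p: "u = R p" "w = S p - m *\<^sub>R R p" "P p = p" by (auto simp: A_def)
    have "inner w u = inner (S p) (R p) - m * (norm (R p))\<^sup>2"
      by (simp add: p inner_diff_left power2_norm_eq_inner)
    moreover have "(m - r) * (norm (R p))\<^sup>2 \<le> inner (S p) (R p)" "inner (S p) (R p) \<le> (m + r) * (norm (R p))\<^sup>2"
    proof -
      have "m - r = a" "m + r = b" by (auto simp: m_def r_def field_simps)
      then show "(m - r) * (norm (R p))\<^sup>2 \<le> inner (S p) (R p)" "inner (S p) (R p) \<le> (m + r) * (norm (R p))\<^sup>2"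
        using form_bounds_range_R[OF ab p(3)[unfolded P_def]] by simp_all
    qed
    ultimately show "\<bar>inner w u\<bar> \<le> r * (norm u)\<^sup>2"
      by (simp add: p(1) algebra_simps abs_le_iff)
  next
    obtain p where p: "z = R p" "w = S p - m *\<^sub>R R p" "P p = p" using \<open>(z, w) \<in> A\<close> by (auto simp: A_def)
    have "P w = w" using PS[of p] PR[of p] by (simp add: p blinfun.bilinear_simps)
    then show "w \<in> closure (fst ` A)" by (rule cl)
  qed
  obtain f where f: "\<And>n. f n \<in> fst ` A" "f \<longlonglongrightarrow> u"
    using cl[of u] u unfolding closure_sequential P_def by blast
  then have "\<forall>n. \<exists>w. (f n, w) \<in> A" by force
  then obtain g where g: "\<And>n. (f n, g n) \<in> A" by metis
  have "Cauchy g"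
  proof (rule CauchyI)
    fix e :: real assume e: "0 < e"
    have r: "r \<ge> 0" using ab by (simp add: r_def)
    have "Cauchy f" using f(2) LIMSEQ_imp_Cauchy by blast
    from CauchyD[OF this, of "e / (r + 1)"] e r
    obtain M where M: "\<And>m n. m \<ge> M \<Longrightarrow> n \<ge> M \<Longrightarrow> norm (f m - f n) < e / (r + 1)" by auto
    have "norm (g m - g n) < e" if "m \<ge> M" "n \<ge> M" for m n
    proof -
      have "(f m - f n, g m - g n) \<in> A" using subspace_diff[OF A g g, of m n] by simp
      then have "norm (g m - g n) \<le> r * norm (f m - f n)" by (rule bound)
      also have "\<dots> \<le> (r + 1) * norm (f m - f n)" by (intro mult_right_mono) auto
      also have "\<dots> < (r + 1) * (e / (r + 1))" using r M[OF that] by (intro mult_strict_left_mono) auto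
      finally show ?thesis using r by simp
    qed
    then show "\<exists>M. \<forall>m\<ge>M. \<forall>n\<ge>M. norm (g m - g n) < e" by blast
  qed
  then obtain w' where w': "g \<longlonglongrightarrow> w'" using Cauchy_convergent convergent_def by blast
  have gG: "(f n, g n + m *\<^sub>R f n) \<in> G" for n using g[of n] RG by (auto simp: A_def)
  have "(\<lambda>n. (f n, g n + m *\<^sub>R f n)) \<longlonglongrightarrow> (u, w' + m *\<^sub>R u)" by (intro tendsto_intros f w')
  then have 1: "(u, w' + m *\<^sub>R u) \<in> G" by (rule closed_sequentially[OF closed_G, rotated]) (rule gG)
  have "P (g n) = g n" for n using g[of n] PS PR by (auto simp: A_def blinfun.bilinear_simps) 
  then have "g \<longlonglongrightarrow> P w'" using blinfun.tendsto[OF tendsto_const w', of P] by simp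
  then have "P w' = w'" using w' LIMSEQ_unique by blast
  then have 2: "E {a<..b} (w' + m *\<^sub>R u) = w' + m *\<^sub>R u" using u by (simp add: P_def blinfun.bilinear_simps)
  have "norm w' \<le> r * norm u"
    by (rule LIMSEQ_le[OF tendsto_norm[OF w'] tendsto_mult_left[OF tendsto_norm[OF f(2)]]])
      (use bound g in blast)
  with 1 2 show ?thesis by (intro that[of "w' + m *\<^sub>R u"]) (auto simp: m_def r_def)
qed

lemma op_Ioc:
  assumes "a \<le> b" "E {a<..b} u = u"
  shows "(u, op u) \<in> G" "E {a<..b} (op u) = op u"
    "norm (op u - ((a + b) / 2) *\<^sub>R u) \<le> (b - a) / 2 * norm u"
  using bounded_on_Ioc[OF assms] op_eq by metis+

lemma op_E_Ioc_split:
  assumes "a \<le> c" "c \<le> b"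
  shows "op (E {a<..b} x) = op (E {a<..c} x) + op (E {c<..b} x)"
    and "inner (op (E {a<..c} x)) (op (E {c<..b} x)) = 0"
proof -
  have ab: "{a<..b} = {a<..c} \<union> {c<..b}" using assms by auto
  have dis: "{a<..c} \<inter> {c<..b} = {}" by auto
  have idem: "E {d<..e} (E {d<..e} x) = E {d<..e} x" for d e by (simp add: orth_proj_idem proj)
  note 1 = op_Ioc[OF assms(1) idem] and 2 = op_Ioc[OF assms(2) idem]
  have "E {a<..b} x = E {a<..c} x + E {c<..b} x" unfolding ab by (rule union) (auto simp: dis)
  then show "op (E {a<..b} x) = op (E {a<..c} x) + op (E {c<..b} x)"
    using op_eq[OF add_mem[OF 1(1) 2(1)]] by simp
  have "inner (op (E {a<..c} x)) (op (E {c<..b} x))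
      = inner (E {a<..c} (op (E {a<..c} x))) (E {c<..b} (op (E {c<..b} x)))"
    by (simp add: 1(2) 2(2))
  also have "\<dots> = 0"
    by (subst orth_proj_sym[OF proj]) (auto simp: disjoint dis)
  finally show "inner (op (E {a<..c} x)) (op (E {c<..b} x)) = 0" .
qed

lemma measure_Ioc_split:
  assumes "a \<le> c" "c \<le> b"
  shows "measure (vmeasure E x) {a<..b} = measure (vmeasure E x) {a<..c} + measure (vmeasure E x) {c<..b}"
proof -
  have "measure (vmeasure E x) ({a<..c} \<union> {c<..b}) = measure (vmeasure E x) {a<..c} + measure (vmeasure E x) {c<..b}"
    by (rule finite_measure.finite_measure_Union[OF finite_vmeasure]) auto
  moreover have "{a<..c} \<union> {c<..b} = {a<..b}" using assms by auto
  ultimately show ?thesis by simp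
qed

text \<open>On a short interval the operator differs from multiplication by the midpoint by at most
  half the length, and so does the integrand. Both sides are additive in the interval, for the
  squared norm because the images of disjoint pieces are orthogonal, so their difference vanishes by
  bisection.\<close>

lemma form_Ioc_eq_integral:
  assumes "lo \<le> hi"
  shows "inner (op (E {lo<..hi} x)) x = (LINT t:{lo<..hi}|vmeasure E x. t)" (is ?A)
    and "(norm (op (E {lo<..hi} x)))\<^sup>2 = (LINT t:{lo<..hi}|vmeasure E x. t\<^sup>2)" (is ?B)
proof -
  define \<mu> where "\<mu> = vmeasure E x"
  \<comment> \<open>Bounds the absolute values of all points, midpoints and half-lengths that occur
    between \<open>lo\<close> and \<open>hi\<close>.\<close>
  define K where "K = \<bar>lo\<bar> + \<bar>hi\<bar>"
  have idem: "E {d<..e} (E {d<..e} x) = E {d<..e} x" for d e by (simp add: orth_proj_idem proj)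
  have fin: "finite_measure \<mu>" and sets_\<mu>: "sets \<mu> = sets borel" by (auto simp: \<mu>_def finite_vmeasure)
  have mu: "measure \<mu> {a<..b} = (norm (E {a<..b} x))\<^sup>2" for a b by (simp add: \<mu>_def measure_vmeasure)
  have near1: "\<bar>t - (a + b) / 2\<bar> \<le> (b - a) / 2" if "t \<in> {a<..b}" for a b t :: real
    using that by (auto simp: abs_le_iff field_simps)
  have near2: "\<bar>t\<^sup>2 - ((a + b) / 2)\<^sup>2\<bar> \<le> 2 * K * ((b - a) / 2)" if "t \<in> {a<..b}" "lo \<le> a" "b \<le> hi" for a b t
  proof -
    have "\<bar>t\<^sup>2 - ((a + b) / 2)\<^sup>2\<bar> = \<bar>t + (a + b) / 2\<bar> * \<bar>t - (a + b) / 2\<bar>"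
      unfolding abs_mult[symmetric] by (simp add: power2_eq_square algebra_simps)
    also have "\<dots> \<le> (2 * K) * ((b - a) / 2)"
    proof (intro mult_mono near1)
      have "\<bar>t\<bar> \<le> K" "\<bar>a\<bar> \<le> K" "\<bar>b\<bar> \<le> K" using that by (auto simp: K_def)
      then show "\<bar>t + (a + b) / 2\<bar> \<le> 2 * K" by (auto simp: abs_le_iff field_simps)
    qed (use that in \<open>auto simp: K_def\<close>)
    finally show ?thesis by simp
  qed
  note int1 = set_integral_near_const[OF fin sets_\<mu> _ _ near1]
  note int2 = set_integral_near_const[OF fin sets_\<mu> _ _ near2]
  have int_split: "(LINT t:{a<..b}|\<mu>. f t) = (LINT t:{a<..c}|\<mu>. f t) + (LINT t:{c<..b}|\<mu>. f t)"
    if "a \<le> c" "c \<le> b" "set_integrable \<mu> {a<..c} f" "set_integrable \<mu> {c<..b} f" for a b c and f :: "real \<Rightarrow> real"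
  proof -
    have "{a<..b} = {a<..c} \<union> {c<..b}" using that by auto
    then show ?thesis using that set_integral_Un[of "{a<..c}" "{c<..b}" \<mu> f] by auto
  qed
  have m_split: "measure \<mu> {a<..b} = measure \<mu> {a<..c} + measure \<mu> {c<..b}"
    if "a \<le> c" "c \<le> b" for a b c
    unfolding \<mu>_def by (rule measure_Ioc_split[OF that])
  have T: "\<bar>inner (op (E {a<..b} x)) x - ((a + b) / 2) * measure \<mu> {a<..b}\<bar> \<le> ((b - a) / 2) * measure \<mu> {a<..b}"
    "\<bar>(norm (op (E {a<..b} x)))\<^sup>2 - ((a + b) / 2)\<^sup>2 * measure \<mu> {a<..b}\<bar> \<le> (3 * K) * ((b - a) / 2) * measure \<mu> {a<..b}"
    if ab: "lo \<le> a" "a \<le> b" "b \<le> hi" for a b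
  proof -
    define u where "u = E {a<..b} x"
    define m r where "m = (a + b) / 2" and "r = (b - a) / 2"
    note op = op_Ioc[OF ab(2) idem, folded u_def m_def r_def]
    have r: "0 \<le> r" "r \<le> K" "\<bar>m\<bar> \<le> K" using ab by (auto simp: r_def m_def K_def)
    have mu_u: "measure \<mu> {a<..b} = (norm u)\<^sup>2" by (simp add: u_def mu)
    have "inner (op u) x = inner (op u) u"
      by (metis op(2) orth_proj_sym[OF proj] u_def greaterThanAtMost_borel)
    then have "inner (op u) x - m * (norm u)\<^sup>2 = inner (op u - m *\<^sub>R u) u"
      by (simp add: inner_diff_left power2_norm_eq_inner)
    also have "\<bar>\<dots>\<bar> \<le> norm (op u - m *\<^sub>R u) * norm u" by (rule Cauchy_Schwarz_ineq2)
    also have "\<dots> \<le> r * norm u * norm u" by (intro mult_right_mono op) auto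
    finally show "\<bar>inner (op (E {a<..b} x)) x - ((a + b) / 2) * measure \<mu> {a<..b}\<bar> \<le> ((b - a) / 2) * measure \<mu> {a<..b}"
      unfolding mu_u m_def r_def by (simp add: u_def power2_eq_square mult.assoc)
    have "(2 * m) *\<^sub>R u = m *\<^sub>R u + m *\<^sub>R u" by (simp flip: scaleR_add_left)
    then have "op u + m *\<^sub>R u = (op u - m *\<^sub>R u) + (2 * m) *\<^sub>R u" by simp
    then have "norm (op u + m *\<^sub>R u) \<le> norm (op u - m *\<^sub>R u) + norm ((2 * m) *\<^sub>R u)"
      using norm_triangle_ineq by metis
    also have "norm ((2 * m) *\<^sub>R u) = 2 * \<bar>m\<bar> * norm u" by (simp add: abs_mult)
    also have "norm (op u - m *\<^sub>R u) + 2 * \<bar>m\<bar> * norm u \<le> r * norm u + 2 * K * norm u" using op(3) r by (intro add_mono mult_right_mono) auto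
    also have "\<dots> \<le> K * norm u + 2 * K * norm u" using r by (intro add_mono mult_right_mono) auto
    finally have 3: "norm (op u + m *\<^sub>R u) \<le> 3 * K * norm u" by (simp add: algebra_simps)
    have "(norm (op u))\<^sup>2 - m\<^sup>2 * (norm u)\<^sup>2 = inner (op u - m *\<^sub>R u) (op u + m *\<^sub>R u)"
      by (simp add: power2_norm_eq_inner inner_diff inner_add inner_commute power2_eq_square[of m])
    also have "\<bar>\<dots>\<bar> \<le> norm (op u - m *\<^sub>R u) * norm (op u + m *\<^sub>R u)" by (rule Cauchy_Schwarz_ineq2)
    also have "\<dots> \<le> (r * norm u) * (3 * K * norm u)" using r by (intro mult_mono op 3) auto
    finally show "\<bar>(norm (op (E {a<..b} x)))\<^sup>2 - ((a + b) / 2)\<^sup>2 * measure \<mu> {a<..b}\<bar> \<le> (3 * K) * ((b - a) / 2) * measure \<mu> {a<..b}"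
      unfolding mu_u m_def r_def u_def[symmetric] by (simp add: power2_eq_square algebra_simps)
  qed
  have "inner (op (E {lo<..hi} x)) x - (LINT t:{lo<..hi}|\<mu>. t) = 0"
  proof (rule additive_interval_function_eq_0[where M = "\<lambda>a b. measure \<mu> {a<..b}" and K = 1
        and D = "\<lambda>a b. inner (op (E {a<..b} x)) x - (LINT t:{a<..b}|\<mu>. t)"])
    fix a b c :: real assume ac: "a \<le> c" "c \<le> b"
    have "(LINT t:{a<..b}|\<mu>. t) = (LINT t:{a<..c}|\<mu>. t) + (LINT t:{c<..b}|\<mu>. t)"
      by (rule int_split[OF ac]; rule int1(1)) auto
    then show "inner (op (E {a<..b} x)) x - (LINT t:{a<..b}|\<mu>. t) =
       inner (op (E {a<..c} x)) x - (LINT t:{a<..c}|\<mu>. t) + (inner (op (E {c<..b} x)) x - (LINT t:{c<..b}|\<mu>. t))"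
      by (simp add: op_E_Ioc_split(1)[OF ac] inner_add_left)
  next
    fix a b :: real assume ab: "lo \<le> a" "a \<le> b" "b \<le> hi"
    have "\<bar>(LINT t:{a<..b}|\<mu>. t) - (a + b) / 2 * measure \<mu> {a<..b}\<bar> \<le> (b - a) / 2 * measure \<mu> {a<..b}"
      by (rule int1(2)) auto
    moreover have "1 * (b - a) * measure \<mu> {a<..b} = (b - a) / 2 * measure \<mu> {a<..b} + (b - a) / 2 * measure \<mu> {a<..b}"
      by (simp add: algebra_simps)
    ultimately show "\<bar>inner (op (E {a<..b} x)) x - (LINT t:{a<..b}|\<mu>. t)\<bar> \<le> 1 * (b - a) * measure \<mu> {a<..b}"
      using T(1)[OF ab] by linarith
  qed (auto intro: m_split assms)
  then show ?A by (simp add: \<mu>_def)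
  have "(norm (op (E {lo<..hi} x)))\<^sup>2 - (LINT t:{lo<..hi}|\<mu>. t\<^sup>2) = 0"
  \<comment> \<open>Per half-length the integral of the square contributes \<open>2 * K\<close> and
    the squared norm \<open>3 * K\<close>, whence the constant \<open>5 * K / 2\<close>.\<close>
  proof (rule additive_interval_function_eq_0[where M = "\<lambda>a b. measure \<mu> {a<..b}" and K = "5 * K / 2"
        and D = "\<lambda>a b. (norm (op (E {a<..b} x)))\<^sup>2 - (LINT t:{a<..b}|\<mu>. t\<^sup>2)"])
    fix a b c :: real assume abc: "lo \<le> a" "a \<le> c" "c \<le> b" "b \<le> hi"
    have "(norm (op (E {a<..b} x)))\<^sup>2 = (norm (op (E {a<..c} x)))\<^sup>2 + (norm (op (E {c<..b} x)))\<^sup>2"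
      using op_E_Ioc_split(2)[OF abc(2,3), of x]
      by (simp add: op_E_Ioc_split(1)[OF abc(2,3), of x] power2_norm_eq_inner inner_add inner_commute)
    moreover have "(LINT t:{a<..b}|\<mu>. t\<^sup>2) = (LINT t:{a<..c}|\<mu>. t\<^sup>2) + (LINT t:{c<..b}|\<mu>. t\<^sup>2)"
      by (rule int_split[OF abc(2,3)]; rule int2(1)) (use abc in auto)
    ultimately show "(norm (op (E {a<..b} x)))\<^sup>2 - (LINT t:{a<..b}|\<mu>. t\<^sup>2) =
       (norm (op (E {a<..c} x)))\<^sup>2 - (LINT t:{a<..c}|\<mu>. t\<^sup>2) + ((norm (op (E {c<..b} x)))\<^sup>2 - (LINT t:{c<..b}|\<mu>. t\<^sup>2))"
      by simp
  next
    fix a b :: real assume ab: "lo \<le> a" "a \<le> b" "b \<le> hi"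
    have "\<bar>(LINT t:{a<..b}|\<mu>. t\<^sup>2) - ((a + b) / 2)\<^sup>2 * measure \<mu> {a<..b}\<bar> \<le> 2 * K * ((b - a) / 2) * measure \<mu> {a<..b}"
      by (rule int2(2)) (use ab in auto)
    moreover have "5 * K / 2 * (b - a) * measure \<mu> {a<..b}
        = 2 * K * ((b - a) / 2) * measure \<mu> {a<..b} + 3 * K * ((b - a) / 2) * measure \<mu> {a<..b}"
      by (simp add: field_simps)
    ultimately show "\<bar>(norm (op (E {a<..b} x)))\<^sup>2 - (LINT t:{a<..b}|\<mu>. t\<^sup>2)\<bar> \<le> 5 * K / 2 * (b - a) * measure \<mu> {a<..b}"
      using T(2)[OF ab] by linarith
  qed (auto intro: m_split assms)
  then show ?B by (simp add: \<mu>_def)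
qed

lemma cutoff_limit: "(\<lambda>n. E {- real n<..real n} x) \<longlonglongrightarrow> x"
proof -
  have "(\<lambda>n. specfam (real n) x - specfam (- real n) x) \<longlonglongrightarrow> x - 0"
    by (intro tendsto_intros specfam_top_limit specfam_bot_limit)
  then show ?thesis by (simp add: Ioc blinfun.bilinear_simps)
qed

lemma cutoff_indicator: "(\<lambda>n. indicator {- real n<..real n} t *\<^sub>R f t) \<longlonglongrightarrow> (f t :: real)"
proof (rule tendsto_eventually)
  obtain N where "\<bar>t\<bar> < real N" using reals_Archimedean2 by blast
  then have "\<forall>n\<ge>N. t \<in> {- real n<..real n}" by fastforce
  then show "\<forall>\<^sub>F n in sequentially. indicator {- real n<..real n} t *\<^sub>R f t = f t"
    unfolding eventually_sequentially by (intro exI[of _ N]) simp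
qed

text \<open>Everything is known on the cutoffs to (-n, n]. For \<open>x\<close> in the domain,
  monotone convergence gives the second moment. Conversely a finite second moment makes the images
  of the cutoffs converge, since their increments are orthogonal, and closedness of the graph puts
  \<open>x\<close> into the domain.\<close>

lemma resolves: "resolves E G"
  unfolding resolves_def
proof (intro conjI allI)
  show "pvm E" by unfold_locales
  define I where "I n = {- real n<..real n}" for n
  have idem: "E (I n) (E (I n) x) = E (I n) x" for n x by (simp add: I_def orth_proj_idem proj)
  have op_I: "(E (I n) x, op (E (I n) x)) \<in> G" "E (I n) (op (E (I n) x)) = op (E (I n) x)" for n x
    using op_Ioc(1,2)[of "- real n" "real n" "E (I n) x"] idem by (auto simp: I_def)
  have sq: "(norm (op (E (I n) x)))\<^sup>2 = (LINT t:I n|vmeasure E x. t\<^sup>2)"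
    and lin: "inner (op (E (I n) x)) x = (LINT t:I n|vmeasure E x. t)" for n x
    unfolding I_def by (rule form_Ioc_eq_integral; simp)+
  have I_borel [simp, measurable]: "I n \<in> sets borel" for n by (simp add: I_def)
  have I_mono: "I m \<subseteq> I n" if "m \<le> n" for m n using that by (auto simp: I_def)
  have op_E: "op (E (I n) x) = E (I n) y" if "(x, y) \<in> G" for n x y
    by (rule op_eq) (use E_reduces[of "I n"] that reducesD in auto)
  have int_I: "integrable (vmeasure E x) (\<lambda>t. indicator (I n) t *\<^sub>R t\<^sup>2)" for n x
  proof -
    have "\<bar>t\<^sup>2 - 0\<bar> \<le> (real n)\<^sup>2" if "t \<in> I n" for t
      using that by (auto simp: I_def abs_le_square_iff[symmetric])
    then have "set_integrable (vmeasure E x) (I n) (\<lambda>t. t\<^sup>2)"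
      by (intro set_integral_near_const(1)[OF finite_vmeasure, where k = 0 and q = "(real n)\<^sup>2"]) auto
    then show ?thesis by (simp add: set_integrable_def)
  qed
  have dom1: "integrable (vmeasure E x) (\<lambda>t. t\<^sup>2)" if xy: "(x, y) \<in> G" for x y
  proof -
    have "incseq (\<lambda>n. (norm (E (I n) y))\<^sup>2)"
    proof (rule incseq_SucI)
      fix n
      have "E (I n) (E (I (Suc n)) y) = E (I n) y"
        using I_mono[of n "Suc n"] by (simp add: inter Int_absorb2)
      then show "(norm (E (I n) y))\<^sup>2 \<le> (norm (E (I (Suc n)) y))\<^sup>2"
        using orth_proj_norm_le[OF proj, of "I n" "E (I (Suc n)) y"] by (simp add: power_mono)
    qed
    moreover have "\<forall>n. (norm (E (I n) y))\<^sup>2 \<le> (norm y)\<^sup>2"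
      by (auto intro!: power_mono orth_proj_norm_le proj)
    ultimately obtain l where "(\<lambda>n. (norm (E (I n) y))\<^sup>2) \<longlonglongrightarrow> l" by (rule incseq_convergent)
    then have l: "(\<lambda>n. \<integral>t. indicator (I n) t *\<^sub>R t\<^sup>2 \<partial>vmeasure E x) \<longlonglongrightarrow> l"
      using sq[of _ x] by (simp add: op_E[OF xy] set_lebesgue_integral_def)
    show ?thesis
    proof (rule integrable_monotone_convergence[OF int_I[of x] _ _ l])
      show "AE t in vmeasure E x. mono (\<lambda>n. indicator (I n) t *\<^sub>R t\<^sup>2)"
        using I_mono by (intro AE_I2 monoI) (auto simp: indicator_def)
      show "AE t in vmeasure E x. (\<lambda>n. indicator (I n) t *\<^sub>R t\<^sup>2) \<longlonglongrightarrow> t\<^sup>2"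
        unfolding I_def by (intro AE_I2 cutoff_indicator)
    qed simp
  qed
  show "x \<in> fst ` G \<longleftrightarrow> integrable (vmeasure E x) (\<lambda>t. t\<^sup>2)" for x
  proof
    assume int: "integrable (vmeasure E x) (\<lambda>t. t\<^sup>2)"
    define y where "y n = op (E (I n) x)" for n
    have "(\<lambda>n. LINT t:I n|vmeasure E x. t\<^sup>2) \<longlonglongrightarrow> (\<integral>t. t\<^sup>2 \<partial>vmeasure E x)"
      unfolding set_lebesgue_integral_def
    proof (rule integral_dominated_convergence[where w = "\<lambda>t. t\<^sup>2"])
      show "AE t in vmeasure E x. (\<lambda>n. indicator (I n) t *\<^sub>R t\<^sup>2) \<longlonglongrightarrow> t\<^sup>2"
        unfolding I_def by (intro AE_I2 cutoff_indicator)
    qed (use int in \<open>auto simp: indicator_def\<close>)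
    then have "(\<lambda>n. (norm (y n))\<^sup>2) \<longlonglongrightarrow> (\<integral>t. t\<^sup>2 \<partial>vmeasure E x)" by (simp add: y_def sq)
    then have conv: "convergent (\<lambda>n. (norm (y n))\<^sup>2)" by (rule convergentI)
    have Ey: "E (I m) (y n) = y m" if "m \<le> n" for m n
    proof -
      have "(E (I m) (E (I n) x), E (I m) (y n)) \<in> G"
        using E_reduces[of "I m"] op_I(1) reducesD by (auto simp: y_def)
      then show ?thesis using I_mono[OF that] op_eq by (simp add: inter Int_absorb2 y_def)
    qed
    have "(norm (y n - y m))\<^sup>2 = (norm (y n))\<^sup>2 - (norm (y m))\<^sup>2" if "m \<le> n" for m n
      using orth_proj_pythagoras[OF proj, of "I m" "y n"] Ey[OF that] by simp
    from Cauchy_of_orthogonal_increments[OF this conv] have "Cauchy y" .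
    then obtain l where l: "y \<longlonglongrightarrow> l" using Cauchy_convergent convergent_def by blast
    have "(\<lambda>n. (E (I n) x, y n)) \<longlonglongrightarrow> (x, l)"
      unfolding I_def by (intro tendsto_intros l cutoff_limit)
    then have "(x, l) \<in> G" by (rule closed_sequentially[OF closed_G, rotated]) (simp add: y_def op_I(1))
    then show "x \<in> fst ` G" by force
  qed (use dom1 in auto)
  show "\<forall>(x, y)\<in>G. inner y x = (\<integral>t. t \<partial>vmeasure E x)"
  proof (intro ballI, clarify)
    fix x y assume xy: "(x, y) \<in> G"
    interpret finite_measure "vmeasure E x" by (rule finite_vmeasure)
    have "integrable (vmeasure E x) (\<lambda>t. 1 + t\<^sup>2)" using dom1[OF xy] by simp
    moreover have "\<bar>t\<bar> \<le> 1 + t\<^sup>2" for t :: real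
      using zero_le_power2[of "\<bar>t\<bar> - 1"] by (simp add: power2_eq_square algebra_simps)
    ultimately have "(\<lambda>n. LINT t:I n|vmeasure E x. t) \<longlonglongrightarrow> (\<integral>t. t \<partial>vmeasure E x)"
      unfolding set_lebesgue_integral_def
    proof (intro integral_dominated_convergence[where w = "\<lambda>t. 1 + t\<^sup>2"])
      show "AE t in vmeasure E x. (\<lambda>n. indicator (I n) t *\<^sub>R t) \<longlonglongrightarrow> t"
        unfolding I_def by (intro AE_I2 cutoff_indicator)
    qed (auto simp: indicator_def)
    then have "(\<lambda>n. inner (E (I n) y) x) \<longlonglongrightarrow> (\<integral>t. t \<partial>vmeasure E x)"
      by (simp add: lin[symmetric] op_E[OF xy])
    moreover have "(\<lambda>n. inner (E (I n) y) x) \<longlonglongrightarrow> inner y x"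
      unfolding I_def by (intro tendsto_intros cutoff_limit)
    ultimately show "inner y x = (\<integral>t. t \<partial>vmeasure E x)" by (rule LIMSEQ_unique[symmetric])
  qed
qed

end

context selfadjoint_graph
begin

text \<open>The commutation clause is there for scalar multiplications: it makes the projections
  linear over the scalar field, not only over the reals.\<close>

theorem spectral_theorem:
  obtains E where "resolves E G"
    "\<And>C C' A x. adjoint_pair C C' \<Longrightarrow> reduces C \<Longrightarrow> reduces C' \<Longrightarrow> A \<in> sets borel \<Longrightarrow>
       E A (C x) = C (E A x)"
proof -
  obtain E where E: "pvm E" "\<And>a b. a \<le> b \<Longrightarrow> E {a<..b} = specfam b - specfam a"
    "\<And>(C :: 'a \<Rightarrow>\<^sub>L 'a) A x. (\<And>c x. specfam c (C x) = C (specfam c x)) \<Longrightarrow> A \<in> sets borel \<Longrightarrow>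
       E A (C x) = C (E A x)"
    by (rule spectral_family_extends[OF specfam_proj specfam_mono specfam_right_limit
          specfam_bot_limit specfam_top_limit]) (assumption, (rule that; blast))
  interpret spectral_extension G E
    by (intro spectral_extension.intro spectral_extension_axioms.intro selfadjoint_graph_axioms E) auto
  show ?thesis
  proof (rule that[OF resolves])
    fix C C' :: "'a \<Rightarrow>\<^sub>L 'a" and A :: "real set" and x assume "adjoint_pair C C'" "reduces C" "reduces C'" "A \<in> sets borel"
    then show "E A (C x) = C (E A x)"
      using reduces_commute[of C C'] by (intro commute specfam_commute) auto
  qed
qed

end

section \<open>Spectral projections of intervals\<close>

context pvm
begin

lemma null_subset:
  assumes "E N = 0" "A \<subseteq> N" "A \<in> sets borel" "N \<in> sets borel" shows "E A = 0"
proof (rule blinfun_eqI)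
  fix x show "E A x = blinfun_apply 0 x"
    using inter[of A N x] assms by (simp add: Int_absorb2 blinfun.zero_right)
qed

lemma null_union:
  assumes "E M = 0" "E N = 0" "M \<in> sets borel" "N \<in> sets borel" shows "E (M \<union> N) = 0"
proof (rule blinfun_eqI)
  fix x
  have "M \<union> N = M \<union> (N - M)" by auto
  then have "E (M \<union> N) x = E M x + E (N - M) x" using assms union[of M "N - M" x] by auto
  then show "E (M \<union> N) x = blinfun_apply 0 x"
    using assms null_subset[of N "N - M"] by simp
qed

lemma eq_modulo_null:
  assumes "E N = 0" "A \<subseteq> B \<union> N" "B \<subseteq> A \<union> N" "A \<in> sets borel" "B \<in> sets borel" "N \<in> sets borel"
  shows "E A = E B"
proof (rule blinfun_eqI)
  fix x
  have 1: "E A' x = E (A' \<inter> B') x" if "A' \<subseteq> B' \<union> N" "A' \<in> sets borel" "B' \<in> sets borel" for A' B'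
  proof -
    have "E ((A' \<inter> B') \<union> (A' - B')) x = E (A' \<inter> B') x + E (A' - B') x"
      using that by (intro union) auto
    moreover have "(A' \<inter> B') \<union> (A' - B') = A'" by auto
    moreover have "E (A' - B') = 0" by (rule null_subset[OF assms(1)]) (use that assms in auto)
    ultimately show ?thesis by simp
  qed
  show "E A x = E B x" using 1[of A B] 1[of B A] assms by (simp add: Int_commute)
qed

lemma inner_E: "A \<in> sets borel \<Longrightarrow> inner (E A x) (E A y) = inner x (E A y)"
  by (simp only: orth_proj_sym[OF proj] orth_proj_idem[OF proj])

lemma inner_E_self: "A \<in> sets borel \<Longrightarrow> inner x (E A x) = (norm (E A x))\<^sup>2"
  by (subst inner_commute) (rule orth_proj_inner[OF proj])

text \<open>Cutting down the vector cuts down the measure; integrability for \<open>E B x\<close>,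
  and with it membership in the domain, is read off from this.\<close>

lemma vmeasure_eq_density:
  assumes B: "B \<in> sets borel"
  shows "vmeasure E (E B x) = density (vmeasure E x) (\<lambda>t. ennreal (indicator B t))"
proof (rule measure_eqI)
  fix A assume "A \<in> sets (vmeasure E (E B x))"
  then have A: "A \<in> sets borel" by simp
  have "emeasure (density (vmeasure E x) (\<lambda>t. ennreal (indicator B t))) A
      = (\<integral>\<^sup>+t. ennreal (indicator B t) * indicator A t \<partial>vmeasure E x)"
    using A B by (intro emeasure_density) auto
  also have "\<dots> = (\<integral>\<^sup>+t. indicator (A \<inter> B) t \<partial>vmeasure E x)"
    by (intro nn_integral_cong) (auto split: split_indicator)
  also have "\<dots> = emeasure (vmeasure E x) (A \<inter> B)" using A B by (intro nn_integral_indicator) auto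
  also have "\<dots> = emeasure (vmeasure E (E B x)) A"
    using A B orth_proj_inner[OF proj[OF A], of "E B x"] orth_proj_inner[OF proj[of "A \<inter> B"], of x]
    by (simp only: emeasure_vmeasure sets.Int inter)
  finally show "emeasure (vmeasure E (E B x)) A
      = emeasure (density (vmeasure E x) (\<lambda>t. ennreal (indicator B t))) A" by simp
qed simp

end

locale spectral_resolution = selfadjoint_graph G + pvm E
  for G :: "('a::{real_inner,banach} \<times> 'a) set" and E +
  assumes resolves: "resolves E G"
begin

lemma dom_iff: "x \<in> fst ` G \<longleftrightarrow> integrable (vmeasure E x) (\<lambda>t. t\<^sup>2)"
  using resolves by (simp add: resolves_def)

lemma form: "(x, y) \<in> G \<Longrightarrow> inner y x = (\<integral>t. t \<partial>vmeasure E x)"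
  using resolves unfolding resolves_def by blast

lemma integrable_id: "x \<in> fst ` G \<Longrightarrow> integrable (vmeasure E x) (\<lambda>t. t)"
proof -
  assume "x \<in> fst ` G"
  then have "integrable (vmeasure E x) (\<lambda>t. 1 + t\<^sup>2)"
    by (intro Bochner_Integration.integrable_add finite_measure.integrable_const[OF finite_vmeasure])
      (simp add: dom_iff)
  moreover have "\<bar>t\<bar> \<le> 1 + t\<^sup>2" for t :: real
    using zero_le_power2[of "\<bar>t\<bar> - 1"] by (simp add: power2_eq_square algebra_simps)
  ultimately show ?thesis
    using Bochner_Integration.integrable_bound[of "vmeasure E x" "\<lambda>t. 1 + t\<^sup>2" "\<lambda>t. t"] by simp
qed

lemma E_dom: "x \<in> fst ` G \<Longrightarrow> B \<in> sets borel \<Longrightarrow> E B x \<in> fst ` G"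
  unfolding dom_iff
  by (subst vmeasure_eq_density, assumption, subst integrable_density)
    (auto intro: integrable_mult_indicator[where 'b = real, simplified])

lemma E_bounded_dom: "B \<in> sets borel \<Longrightarrow> B \<subseteq> {- K..K} \<Longrightarrow> E B x \<in> fst ` G"
proof -
  assume B: "B \<in> sets borel" "B \<subseteq> {- K..K}"
  interpret finite_measure "vmeasure E x" by (rule finite_vmeasure)
  have "\<bar>t\<^sup>2 - 0\<bar> \<le> K\<^sup>2" if "t \<in> B" for t
  proof -
    have "t \<in> {- K..K}" using that B(2) by blast
    then have "\<bar>t\<bar> \<le> \<bar>K\<bar>" by auto
    then show ?thesis by (simp add: abs_le_square_iff)
  qed
  then have "set_integrable (vmeasure E x) B (\<lambda>t. t\<^sup>2)"
    by (intro set_integral_near_const(1)[OF finite_vmeasure, where k = 0 and q = "K\<^sup>2"]) (use B in auto)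
  then show ?thesis
    unfolding dom_iff vmeasure_eq_density[OF B(1)] using B(1)
    by (subst integrable_density) (auto simp: set_integrable_def)
qed

text \<open>\<open>resolves\<close> controls only the quadratic form. The cross terms of
  \<open>E A\<close> between \<open>u\<close> and \<open>v\<close> vanish, so \<open>u + v\<close>
  and \<open>u - v\<close> have the same scalar measure and hence the same form value; their
  difference is four times the wanted product.\<close>

lemma form_orthogonal:
  assumes B: "B \<in> sets borel" and u: "(u, w) \<in> G" "E B u = u" and v: "(v, z) \<in> G" "E B v = 0"
  shows "inner w v = 0"
proof -
  have cross: "inner (E A u) v = 0" if A: "A \<in> sets borel" for A
  proof -
    have "E A u = E B (E A u)" using inter[OF A B, of u] inter[OF B A, of u] u(2) by (simp add: Int_commute)
    then have "inner (E A u) v = inner (E A u) (E B v)" by (metis orth_proj_sym[OF proj[OF B]])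
    then show ?thesis by (simp add: v(2))
  qed
  have "vmeasure E (u + v) = vmeasure E (u - v)"
  proof (rule measure_eqI)
    fix A assume "A \<in> sets (vmeasure E (u + v))"
    then have A: "A \<in> sets borel" by simp
    have "inner (E A v) u = 0"
      using cross[OF A] by (metis orth_proj_sym[OF proj[OF A]] inner_commute)
    then show "emeasure (vmeasure E (u + v)) A = emeasure (vmeasure E (u - v)) A"
      using A cross[OF A] by (simp add: emeasure_vmeasure blinfun.bilinear_simps inner_add inner_diff)
  qed simp
  then have "inner (w + z) (u + v) = inner (w - z) (u - v)"
    using form[OF add_mem[OF u(1) v(1)]] form[OF diff_mem[OF u(1) v(1)]] by simp
  then show ?thesis
    using symm[OF u(1) v(1)] by (simp add: inner_add inner_diff inner_commute)
qed

text \<open>Here \<open>E\<close> is any measure resolving \<open>G\<close>, not the constructed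
  one. Both parts of \<open>x\<close> lie in the domain, and \<open>form_orthogonal\<close> together
  with density of the domain keeps their images in the respective ranges.\<close>

lemma E_reduces: "B \<in> sets borel \<Longrightarrow> reduces (E B)"
  unfolding reduces_def
proof (intro ballI, clarify)
  fix x y assume B: "B \<in> sets borel" and xy: "(x, y) \<in> G"
  have nB: "- B \<in> sets borel" using B by auto
  have dom: "x' \<in> fst ` G \<Longrightarrow> \<exists>w. (x', w) \<in> G" for x' by force
  obtain u where u: "(E B x, u) \<in> G" using dom[OF E_dom[OF _ B, of x]] xy by force
  obtain v where v: "(E (- B) x, v) \<in> G" using dom[OF E_dom[OF _ nB, of x]] xy by force
  have "y = u + v" using single_valued[OF xy] add_mem[OF u v] by (simp add: compl[OF B])
  have range: "E A w = w" if A: "A \<in> sets borel" and w: "(E A x, w) \<in> G" for A w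
  proof -
    have "inner z (E (- A) w) = 0" if z: "z \<in> fst ` G" for z
    proof -
      obtain z' where z': "(E (- A) z, z') \<in> G" using dom[OF E_dom[OF z, of "- A"]] A by auto
      have "inner w (E (- A) z) = 0"
        by (rule form_orthogonal[OF A w _ z']) (use A in \<open>auto simp: orth_proj_idem proj disjoint\<close>)
      moreover have "- A \<in> sets borel" using A by auto
      ultimately show ?thesis by (metis inner_commute orth_proj_sym[OF proj])
    qed
    then have "E (- A) w = 0" by (rule inner_dense_eq_0)
    then show ?thesis by (simp add: compl[OF A])
  qed
  have "E B u = u" using range[OF B u] .
  moreover have "E B v = 0" using range[OF nB v] compl[OF nB, of v] by simp
  ultimately show "(E B x, E B y) \<in> G" using u \<open>y = u + v\<close> by (simp add: blinfun.bilinear_simps)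
qed

lemma AE_vmeasure:
  assumes "B \<in> sets borel" "E B u = u" shows "AE t in vmeasure E u. t \<in> B"
proof (rule AE_I')
  have "- B \<in> sets borel" using assms by auto
  then show "- B \<in> null_sets (vmeasure E u)"
    using compl[OF assms(1), of u] assms(2) by (auto simp: null_sets_def emeasure_vmeasure)
qed auto

section \<open>The operator on and off the spectral subspace of an interval\<close>

lemma form_lower:
  assumes u: "(u, w) \<in> G" "E B u = u" and B: "B \<in> sets borel" "\<And>t. t \<in> B \<Longrightarrow> c \<le> t"
  shows "c * (norm u)\<^sup>2 \<le> inner w u"
proof -
  interpret finite_measure "vmeasure E u" by (rule finite_vmeasure)
  note ae = AE_vmeasure[OF B(1) u(2)]
  have int: "integrable (vmeasure E u) (\<lambda>t. t)" using u(1) by (intro integrable_id) force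
  have tot: "measure (vmeasure E u) UNIV = (norm u)\<^sup>2" by (simp add: measure_vmeasure E_UNIV)
  have "(\<integral>t. c \<partial>vmeasure E u) \<le> (\<integral>t. t \<partial>vmeasure E u)"
    by (rule integral_mono_AE) (use int ae B in \<open>auto elim!: eventually_mono\<close>)
  then show "c * (norm u)\<^sup>2 \<le> inner w u" by (simp add: form[OF u(1)] tot mult.commute)
qed

lemma form_upper:
  assumes u: "(u, w) \<in> G" "E B u = u" and B: "B \<in> sets borel" "\<And>t. t \<in> B \<Longrightarrow> t \<le> d"
  shows "inner w u \<le> d * (norm u)\<^sup>2"
proof -
  interpret finite_measure "vmeasure E u" by (rule finite_vmeasure)
  note ae = AE_vmeasure[OF B(1) u(2)]
  have int: "integrable (vmeasure E u) (\<lambda>t. t)" using u(1) by (intro integrable_id) force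
  have tot: "measure (vmeasure E u) UNIV = (norm u)\<^sup>2" by (simp add: measure_vmeasure E_UNIV)
  have "(\<integral>t. t \<partial>vmeasure E u) \<le> (\<integral>t. d \<partial>vmeasure E u)"
    by (rule integral_mono_AE) (use int ae B in \<open>auto elim!: eventually_mono\<close>)
  then show "inner w u \<le> d * (norm u)\<^sup>2" by (simp add: form[OF u(1)] tot mult.commute)
qed

text \<open>The form lies between m - r and m + r on the spectral subspace. As the subspace is
  contained in the domain and mapped into itself, \<open>norm_le_of_quadratic_form\<close> applies
  to T - m there.\<close>

lemma inside_interval:
  assumes u: "E {m - r..m + r} u = u"
  obtains w where "(u, w) \<in> G" "E {m - r..m + r} w = w" "norm (w - m *\<^sub>R u) \<le> r * norm u"
proof -
  define P where "P = E {m - r..m + r}"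
  have mem: "(x, op x) \<in> G" if "P x = x" for x
  proof (rule op_mem)
    have "{m - r..m + r} \<subseteq> {- (\<bar>m\<bar> + \<bar>r\<bar>)..\<bar>m\<bar> + \<bar>r\<bar>}"
    proof
      fix t assume "t \<in> {m - r..m + r}"
      then have "m - r \<le> t" "t \<le> m + r" by auto
      then have "- (\<bar>m\<bar> + \<bar>r\<bar>) \<le> t" "t \<le> \<bar>m\<bar> + \<bar>r\<bar>" by linarith+
      then show "t \<in> {- (\<bar>m\<bar> + \<bar>r\<bar>)..\<bar>m\<bar> + \<bar>r\<bar>}" by simp
    qed
    then have "E {m - r..m + r} x \<in> fst ` G" by (rule E_bounded_dom[rotated]) simp
    then show "x \<in> fst ` G" using that by (simp add: P_def)
  qed
  have range: "P (op x) = op x" if "P x = x" for x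
  proof -
    have "(P x, P (op x)) \<in> G" unfolding P_def by (intro reducesD[OF E_reduces] mem that) simp
    then have "(x, P (op x)) \<in> G" unfolding that .
    then show ?thesis using op_eq by metis
  qed
  define A where "A = {(x, w - m *\<^sub>R x) |x w. (x, w) \<in> G \<and> P x = x}"
  have A: "subspace A"
  proof (rule subspaceI)
    show "0 \<in> A" unfolding A_def zero_prod_def using zero_mem by (force simp: blinfun.zero_right)
    fix p q :: "'a \<times> 'a" and c :: real
    assume "p \<in> A"
    then obtain x w where p: "p = (x, w - m *\<^sub>R x)" "(x, w) \<in> G" "P x = x" by (auto simp: A_def)
    show "c *\<^sub>R p \<in> A"
      using scale_mem[OF p(2), of c] p(1,3)
      by (auto simp: A_def blinfun.bilinear_simps algebra_simps intro!: exI[of _ "c *\<^sub>R w"])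
    assume "q \<in> A"
    then obtain y z where q: "q = (y, z - m *\<^sub>R y)" "(y, z) \<in> G" "P y = y" by (auto simp: A_def)
    show "p + q \<in> A"
      using add_mem[OF p(2) q(2)] p(1,3) q(1,3)
      by (auto simp: A_def blinfun.bilinear_simps algebra_simps intro!: exI[of _ "w + z"])
  qed
  have uA: "(u, op u - m *\<^sub>R u) \<in> A" using mem[of u] u by (auto simp: A_def P_def)
  have "norm (op u - m *\<^sub>R u) \<le> r * norm u"
  proof (rule norm_le_of_quadratic_form[OF A _ _ uA])
    fix u w v z assume "(u, w) \<in> A" "(v, z) \<in> A"
    then show "inner w v = inner u z" using symm by (auto simp: A_def inner_diff)
  next
    fix x z assume "(x, z) \<in> A"
    then obtain w where w: "z = w - m *\<^sub>R x" "(x, w) \<in> G" "E {m - r..m + r} x = x"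
      by (auto simp: A_def P_def)
    have "(m - r) * (norm x)\<^sup>2 \<le> inner w x" by (rule form_lower[OF w(2,3)]) auto
    moreover have "inner w x \<le> (m + r) * (norm x)\<^sup>2" by (rule form_upper[OF w(2,3)]) auto
    ultimately show "\<bar>inner z x\<bar> \<le> r * (norm x)\<^sup>2"
      by (simp add: w(1) inner_diff_left power2_norm_eq_inner algebra_simps abs_le_iff)
  next
    have Px: "P (op u - m *\<^sub>R u) = op u - m *\<^sub>R u" using range[of u] u by (simp add: P_def blinfun.bilinear_simps)
    define y where "y = op u - m *\<^sub>R u"
    have "P y = y" using Px by (simp add: y_def)
    then have "(y, op y - m *\<^sub>R y) \<in> A" using mem[of y] unfolding A_def by auto
    from imageI[OF this, of fst] have "y \<in> fst ` A" by (simp only: fst_conv)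
    then show "op u - m *\<^sub>R u \<in> closure (fst ` A)" unfolding y_def by (rule subsetD[OF closure_subset])
  qed
  then show ?thesis using mem[of u] range[of u] u by (intro that[of "op u"]) (auto simp: P_def)
qed

text \<open>\<open>w - m v\<close> is tested against \<open>E A v - E B v\<close>, the image of
  \<open>v\<close> under the sign of T - m. The parts above and below the interval then contribute
  with the same sign, and the test vector has the norm of \<open>v\<close>.\<close>

lemma outside_interval:
  assumes v: "(v, w) \<in> G" "E {m - r..m + r} v = 0" and r: "r \<ge> 0"
  shows "r * norm v \<le> norm (w - m *\<^sub>R v)"
proof -
  define A B where "A = {m + r<..}" and "B = {..<m - r}"
  have [simp]: "A \<in> sets borel" "B \<in> sets borel" by (auto simp: A_def B_def)
  have dis: "A \<inter> B = {}" using r by (auto simp: A_def B_def)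
  have "- {m - r..m + r} = A \<union> B" by (auto simp: A_def B_def)
  then have v_eq: "v = E A v + E B v"
    using compl[of "{m - r..m + r}" v] v(2) union[of A B v] dis by simp
  have orth: "inner (E A v) (E B v) = 0"
    by (subst orth_proj_sym[OF proj]) (auto simp: disjoint dis)
  have A: "r * (norm (E A v))\<^sup>2 \<le> inner (w - m *\<^sub>R v) (E A v)"
  proof -
    have "(m + r) * (norm (E A v))\<^sup>2 \<le> inner (E A w) (E A v)"
      by (rule form_lower[where B = A])
        (use E_reduces[of A] v(1) reducesD in \<open>auto simp: orth_proj_idem proj A_def\<close>)
    moreover have "inner (E A w) (E A v) = inner w (E A v)" "inner v (E A v) = (norm (E A v))\<^sup>2"
      by (simp_all add: inner_E inner_E_self)
    ultimately show ?thesis by (simp add: inner_diff_left algebra_simps)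
  qed
  have B: "inner (w - m *\<^sub>R v) (E B v) \<le> - r * (norm (E B v))\<^sup>2"
  proof -
    have "inner (E B w) (E B v) \<le> (m - r) * (norm (E B v))\<^sup>2"
      by (rule form_upper[where B = B])
        (use E_reduces[of B] v(1) reducesD in \<open>auto simp: orth_proj_idem proj B_def\<close>)
    moreover have "inner (E B w) (E B v) = inner w (E B v)" "inner v (E B v) = (norm (E B v))\<^sup>2"
      by (simp_all add: inner_E inner_E_self)
    ultimately show ?thesis by (simp add: inner_diff_left algebra_simps)
  qed
  have n: "(norm v)\<^sup>2 = (norm (E A v))\<^sup>2 + (norm (E B v))\<^sup>2"
    using orth by (subst v_eq) (simp add: power2_norm_eq_inner inner_add inner_commute)
  have n': "(norm (E A v - E B v))\<^sup>2 = (norm (E A v))\<^sup>2 + (norm (E B v))\<^sup>2"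
    using orth by (simp add: power2_norm_eq_inner inner_diff inner_commute)
  have "norm (E A v - E B v) = norm v" by (rule power2_eq_imp_eq) (simp_all only: n n' norm_ge_zero)
  moreover have "r * (norm v)\<^sup>2 \<le> inner (w - m *\<^sub>R v) (E A v - E B v)"
    using A B by (simp add: n inner_diff_right[of "w - m *\<^sub>R v"] algebra_simps)
  ultimately have "r * norm v * norm v \<le> norm (w - m *\<^sub>R v) * norm v"
    using norm_cauchy_schwarz[of "w - m *\<^sub>R v" "E A v - E B v"] by (simp add: power2_eq_square)
  then show ?thesis by (cases "v = 0") auto
qed

lemma null_of_bounded_below:
  assumes below: "\<And>x w. (x, w) \<in> G \<Longrightarrow> \<eta> * norm x \<le> norm (w - c *\<^sub>R x)" and "\<epsilon> < \<eta>"
  shows "E {c - \<epsilon>..c + \<epsilon>} = 0"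
proof (rule blinfun_eqI)
  fix x
  define u where "u = E {c - \<epsilon>..c + \<epsilon>} x"
  have "E {c - \<epsilon>..c + \<epsilon>} u = u" by (simp add: u_def orth_proj_idem proj)
  then obtain w where "(u, w) \<in> G" "norm (w - c *\<^sub>R u) \<le> \<epsilon> * norm u" by (rule inside_interval)
  with below have "\<eta> * norm u \<le> \<epsilon> * norm u" by force
  then have "u = 0" using \<open>\<epsilon> < \<eta>\<close> by (simp add: mult_le_cancel_right)
  then show "E {c - \<epsilon>..c + \<epsilon>} x = blinfun_apply 0 x" by (simp add: u_def)
qed

end

lemma (in selfadjoint_graph) ex_spectral_resolution: "\<exists>E. spectral_resolution G E"
proof -
  obtain E where "resolves E G" by (rule spectral_theorem)
  then have "spectral_resolution G E"
    by (intro spectral_resolution.intro selfadjoint_graph_axioms spectral_resolution_axioms.intro)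
      (auto simp: resolves_def)
  then show ?thesis by blast
qed

text \<open>A choice among all resolving measures; \<open>spectral_resolution_unique\<close> shows
  that on Borel sets it does not matter.\<close>

definition spectral_measure :: "('a::{real_inner,banach} \<times> 'a) set \<Rightarrow> real set \<Rightarrow> 'a \<Rightarrow>\<^sub>L 'a" where
  "spectral_measure G = (SOME E. spectral_resolution G E)"

lemma (in selfadjoint_graph) spectral_resolution: "spectral_resolution G (spectral_measure G)"
  unfolding spectral_measure_def using ex_spectral_resolution by (rule someI_ex)

definition gap :: "('a::{real_inner,banach} \<times> 'a) set \<Rightarrow> ('a \<times> 'a) set \<Rightarrow> real" where
  "gap G H = norm (selfadjoint_graph.graph_projection G - selfadjoint_graph.graph_projection H)"

lemma gap_commute: "gap G H = gap H G"
  by (simp add: gap_def norm_minus_commute)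

text \<open>The pair \<open>(y, z)\<close> is the projection of \<open>(x, w)\<close> onto the graph
  \<open>H\<close>.\<close>

lemma gap_nearby:
  assumes "selfadjoint_graph G" "selfadjoint_graph H" "(x, w) \<in> G"
  obtains y z where "(y, z) \<in> H" "norm (y - x) \<le> gap G H * (norm x + norm w)"
    "norm (z - w) \<le> gap G H * (norm x + norm w)"
proof -
  interpret G: selfadjoint_graph G by fact
  interpret H: selfadjoint_graph H by fact
  define y z where "y = fst (H.graph_projection (x, w))" and "z = snd (H.graph_projection (x, w))"
  have yz: "H.graph_projection (x, w) = (y, z)" by (simp add: y_def z_def)
  have "G.graph_projection (x, w) = (x, w)" using assms(3) G.graph_projection_fixed by blast
  then have "(x - y, w - z) = (G.graph_projection - H.graph_projection) (x, w)"
    by (simp add: blinfun.bilinear_simps yz)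
  then have "norm (x - y, w - z) \<le> gap G H * norm (x, w)"
    using norm_blinfun by (simp add: gap_def)
  also have "\<dots> \<le> gap G H * (norm x + norm w)"
    by (intro mult_left_mono norm_Pair_le) (simp add: gap_def)
  finally have *: "norm (x - y, w - z) \<le> gap G H * (norm x + norm w)" .
  have "norm (x - y) \<le> norm (x - y, w - z)" "norm (w - z) \<le> norm (x - y, w - z)"
    by (simp_all add: norm_Pair real_le_rsqrt)
  then show ?thesis
    using * H.graph_projection_mem[of "(x, w)"]
    by (intro that[of y z]) (auto simp: yz norm_minus_commute)
qed

text \<open>A one-sided version of the Davis--Kahan theorem: \<open>X = (1 - Q) P\<close> satisfies
  \<open>\<beta> \<parallel>X\<parallel> \<le> \<alpha> \<parallel>X\<parallel> + O(\<delta>)\<close>.\<close>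

lemma sin_theta:
  fixes P Q :: "'a::{real_inner,banach} \<Rightarrow>\<^sub>L 'a"
  assumes GH: "selfadjoint_graph G" "selfadjoint_graph H"
    and P: "orth_proj P" and Q: "orth_proj Q"
    and inside: "\<And>u. P u = u \<Longrightarrow> \<exists>w. (u, w) \<in> G \<and> P w = w \<and> norm (w - m *\<^sub>R u) \<le> \<alpha> * norm u"
    and red: "\<And>v w. (v, w) \<in> H \<Longrightarrow> (Q v, Q w) \<in> H"
    and outside: "\<And>v w. (v, w) \<in> H \<Longrightarrow> Q v = 0 \<Longrightarrow> \<beta> * norm v \<le> norm (w - m *\<^sub>R v)"
    and \<alpha>\<beta>: "0 \<le> \<alpha>" "\<alpha> < \<beta>"
  shows "norm (P x - Q (P x)) \<le> gap G H * (1 + \<bar>m\<bar> + \<beta>)\<^sup>2 / (\<beta> - \<alpha>) * norm x"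
proof -
  interpret G: selfadjoint_graph G by fact
  interpret H: selfadjoint_graph H by fact
  define \<delta> where "\<delta> = gap G H"
  \<comment> \<open>For \<open>P u = u\<close> with image \<open>w\<close>, \<open>K\<close> bounds
    (|u| + |w|) / |u|, as |w - m u| <= \<alpha> |u| <= \<beta> |u|. The errors of size
    \<open>\<delta> * K * norm u\<close> enter with total weight 1 + |m| + \<beta> = K, hence the
    square.\<close>
  define K where "K = 1 + \<bar>m\<bar> + \<beta>"
  have \<delta>: "\<delta> \<ge> 0" and K: "K \<ge> 0" using \<alpha>\<beta> by (auto simp: \<delta>_def gap_def K_def)
  define X where "X = P - (Q o\<^sub>L P)"
  have X: "X x = P x - Q (P x)" for x by (simp add: X_def blinfun.bilinear_simps)
  have nQ: "norm (y - Q y) \<le> norm y" for y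
    using orth_proj_norm_le[OF orth_proj_compl[OF Q], of y] by (simp add: blinfun.bilinear_simps)
  have main: "\<beta> * norm (u - Q u) \<le> (norm X * \<alpha> + \<delta> * K\<^sup>2) * norm u" if u: "P u = u" for u
  proof -
    obtain w where w: "(u, w) \<in> G" "P w = w" "norm (w - m *\<^sub>R u) \<le> \<alpha> * norm u" using inside[OF u] by blast
    have "norm w \<le> norm (w - m *\<^sub>R u) + norm (m *\<^sub>R u)" using norm_triangle_ineq[of "w - m *\<^sub>R u" "m *\<^sub>R u"] by simp
    also have "\<dots> \<le> \<beta> * norm u + \<bar>m\<bar> * norm u"
      using w(3) \<alpha>\<beta> mult_right_mono[of \<alpha> \<beta> "norm u"] by simp
    finally have "norm u + norm w \<le> K * norm u" by (simp add: K_def algebra_simps)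
    then have d: "\<delta> * (norm u + norm w) \<le> \<delta> * K * norm u" using \<delta> by (simp add: mult_left_mono mult.assoc)
    obtain v z where v: "(v, z) \<in> H" "norm (v - u) \<le> \<delta> * (norm u + norm w)" "norm (z - w) \<le> \<delta> * (norm u + norm w)"
      using gap_nearby[OF GH w(1)] unfolding \<delta>_def by blast
    then have vu: "norm (v - u) \<le> \<delta> * K * norm u" "norm (z - w) \<le> \<delta> * K * norm u" using d by linarith+
    have vQ: "(v - Q v, z - Q z) \<in> H" by (intro H.diff_mem red v(1))
    have "Q (v - Q v) = 0" by (simp add: blinfun.bilinear_simps orth_proj_idem[OF Q])
    then have 1: "\<beta> * norm (v - Q v) \<le> norm ((z - Q z) - m *\<^sub>R (v - Q v))" by (rule outside[OF vQ])
    have "(z - Q z) - m *\<^sub>R (v - Q v)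
        = ((w - m *\<^sub>R u) - Q (w - m *\<^sub>R u)) + ((z - w) - Q (z - w)) - m *\<^sub>R ((v - u) - Q (v - u))"
      by (simp add: blinfun.bilinear_simps algebra_simps)
    also have "norm \<dots> \<le> norm ((w - m *\<^sub>R u) - Q (w - m *\<^sub>R u)) + norm ((z - w) - Q (z - w))
        + norm (m *\<^sub>R ((v - u) - Q (v - u)))"
      by (intro order_trans[OF norm_triangle_ineq4] add_mono norm_triangle_ineq order_refl)
    also have "\<dots> \<le> norm X * (\<alpha> * norm u) + \<delta> * K * norm u + \<bar>m\<bar> * (\<delta> * K * norm u)"
    proof (intro add_mono)
      \<comment> \<open>\<open>P\<close> fixes this vector, so its defect is again a value of
        \<open>X\<close>. The factor \<open>norm X * \<alpha>\<close> on the right can therefore be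
        absorbed by \<open>\<beta> * norm X\<close> on the left.\<close>
      have "P (w - m *\<^sub>R u) = w - m *\<^sub>R u" by (simp add: blinfun.bilinear_simps u w(2))
      then have "(w - m *\<^sub>R u) - Q (w - m *\<^sub>R u) = X (w - m *\<^sub>R u)" by (simp add: X)
      then have "norm ((w - m *\<^sub>R u) - Q (w - m *\<^sub>R u)) \<le> norm X * norm (w - m *\<^sub>R u)"
        by (simp add: norm_blinfun)
      also have "\<dots> \<le> norm X * (\<alpha> * norm u)" by (intro mult_left_mono w) auto
      finally show "norm ((w - m *\<^sub>R u) - Q (w - m *\<^sub>R u)) \<le> norm X * (\<alpha> * norm u)" .
      show "norm ((z - w) - Q (z - w)) \<le> \<delta> * K * norm u" using nQ vu(2) order_trans by blast
      have "norm ((v - u) - Q (v - u)) \<le> \<delta> * K * norm u" using nQ vu(1) order_trans by blast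
      then show "norm (m *\<^sub>R ((v - u) - Q (v - u))) \<le> \<bar>m\<bar> * (\<delta> * K * norm u)" by (simp add: mult_left_mono)
    qed
    finally have 2: "\<beta> * norm (v - Q v) \<le> norm X * (\<alpha> * norm u) + \<delta> * K * norm u + \<bar>m\<bar> * (\<delta> * K * norm u)"
      using 1 by linarith
    have "u - Q u = (v - Q v) - ((v - u) - Q (v - u))" by (simp add: blinfun.bilinear_simps)
    then have "norm (u - Q u) \<le> norm (v - Q v) + norm ((v - u) - Q (v - u))" by (metis norm_triangle_ineq4)
    also have "\<dots> \<le> norm (v - Q v) + \<delta> * K * norm u" using nQ[of "v - u"] vu(1) by linarith
    finally have "\<beta> * norm (u - Q u) \<le> \<beta> * norm (v - Q v) + \<beta> * (\<delta> * K * norm u)"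
      using \<alpha>\<beta> by (simp add: mult_left_mono flip: distrib_left)
    then show ?thesis using 2 by (simp add: K_def power2_eq_square algebra_simps)
  qed
  have "\<beta> * norm X \<le> norm X * \<alpha> + \<delta> * K\<^sup>2"
  proof -
    have "norm X \<le> (norm X * \<alpha> + \<delta> * K\<^sup>2) / \<beta>"
    proof (rule norm_blinfun_bound)
      fix x
      have "\<beta> * norm (X x) \<le> (norm X * \<alpha> + \<delta> * K\<^sup>2) * norm (P x)"
        using main[of "P x"] by (simp add: orth_proj_idem[OF P] X)
      also have "\<dots> \<le> (norm X * \<alpha> + \<delta> * K\<^sup>2) * norm x"
        using \<alpha>\<beta> \<delta> by (intro mult_left_mono orth_proj_norm_le[OF P]) auto
      finally show "norm (X x) \<le> (norm X * \<alpha> + \<delta> * K\<^sup>2) / \<beta> * norm x"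
        using \<alpha>\<beta> by (simp add: field_simps)
    qed (use \<alpha>\<beta> \<delta> in auto)
    then show ?thesis using \<alpha>\<beta> by (simp add: field_simps)
  qed
  then have "norm X \<le> \<delta> * K\<^sup>2 / (\<beta> - \<alpha>)" using \<alpha>\<beta> by (simp add: field_simps)
  then have "norm (X x) \<le> \<delta> * K\<^sup>2 / (\<beta> - \<alpha>) * norm x"
    using norm_blinfun[of X x] mult_right_mono[of "norm X" _ "norm x"] by (meson norm_ge_zero order_trans)
  then show ?thesis by (simp add: X \<delta>_def K_def)
qed

section \<open>Uniqueness and stability in the gap metric\<close>

text \<open>\<open>sin_theta\<close> is used with both graphs equal to \<open>G\<close>, so the gap
  is 0 and the range for \<open>E\<close> lies in the range of \<open>E'\<close> for every slightly
  larger interval; the enlargement \<open>e\<close> is the separation that the estimate demands.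
  Continuity of the measure along decreasing intervals removes it.\<close>

lemma spectral_resolution_Icc_subset:
  assumes "spectral_resolution G E" "spectral_resolution G E'" "c \<le> d" "E {c..d} u = u"
  shows "E' {c..d} u = u"
proof -
  interpret E: spectral_resolution G E by fact
  interpret E': spectral_resolution G E' by fact
  define m r where "m = (c + d) / 2" and "r = (d - c) / 2"
  have cd: "c = m - r" "d = m + r" "r \<ge> 0" using \<open>c \<le> d\<close> by (auto simp: m_def r_def field_simps)
  have gap0: "gap G G = 0" by (simp add: gap_def)
  have fixed: "E' {m - (r + e)..m + (r + e)} u = u" if "e > 0" for e
  proof -
    have "norm (E {c..d} u - E' {m - (r + e)..m + (r + e)} (E {c..d} u))
        \<le> gap G G * (1 + \<bar>m\<bar> + (r + e))\<^sup>2 / ((r + e) - r) * norm u"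
    proof (rule sin_theta)
      show "selfadjoint_graph G" by unfold_locales
      then show "selfadjoint_graph G" .
      show "orth_proj (E {c..d})" "orth_proj (E' {m - (r + e)..m + (r + e)})"
        by (simp_all add: E.proj E'.proj)
      show "\<exists>w. (x, w) \<in> G \<and> E {c..d} w = w \<and> norm (w - m *\<^sub>R x) \<le> r * norm x" if "E {c..d} x = x" for x
        using E.inside_interval[of m r x] that unfolding cd by blast
      show "(E' {m - (r + e)..m + (r + e)} v, E' {m - (r + e)..m + (r + e)} w) \<in> G" if "(v, w) \<in> G" for v w
        by (rule E.reducesD[OF E'.E_reduces that]) simp
      show "(r + e) * norm v \<le> norm (w - m *\<^sub>R v)"
        if "(v, w) \<in> G" "E' {m - (r + e)..m + (r + e)} v = 0" for v w
        using E'.outside_interval[OF that] cd \<open>e > 0\<close> by simp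
    qed (use cd \<open>e > 0\<close> in auto)
    then show ?thesis by (simp add: gap0 assms(4))
  qed
  define A where "A n = {m - (r + inverse (real (Suc n)))..m + (r + inverse (real (Suc n)))}" for n
  have "(\<lambda>n. measure (vmeasure E' u) (A n)) \<longlonglongrightarrow> measure (vmeasure E' u) (\<Inter>n. A n)"
  proof (rule finite_measure.finite_Lim_measure_decseq[OF E'.finite_vmeasure])
    show "range A \<subseteq> sets (vmeasure E' u)" by (auto simp: A_def)
    show "decseq A"
      unfolding decseq_def
    proof (intro allI impI)
      fix k n :: nat assume "k \<le> n"
      then have "inverse (real (Suc n)) \<le> inverse (real (Suc k))" by simp
      then show "A n \<subseteq> A k" unfolding A_def by (intro atLeastatMost_subset_iff[THEN iffD2] disjI2) linarith
    qed
  qed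
  moreover have "(\<Inter>n. A n) = {c..d}"
  proof (intro set_eqI iffI)
    fix t assume t: "t \<in> (\<Inter>n. A n)"
    have "c \<le> t + inverse (real (Suc n))" "t \<le> d + inverse (real (Suc n))" for n
      using INT_D[OF t, of n] by (auto simp: A_def cd)
    moreover have "(\<lambda>n. t + inverse (real (Suc n))) \<longlonglongrightarrow> t + 0" "(\<lambda>n. d + inverse (real (Suc n))) \<longlonglongrightarrow> d + 0"
      by (intro tendsto_intros LIMSEQ_inverse_real_of_nat)+
    ultimately have "c \<le> t + 0" "t \<le> d + 0" by (meson LIMSEQ_le_const)+
    then show "t \<in> {c..d}" by simp
  next
    fix t assume t: "t \<in> {c..d}"
    have "t \<in> A n" for n
    proof -
      have "0 \<le> inverse (real (Suc n))" "c \<le> t" "t \<le> d" using t by auto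
      then have "m - (r + inverse (real (Suc n))) \<le> t" "t \<le> m + (r + inverse (real (Suc n)))"
        using cd(1,2) by linarith+
      then show ?thesis by (simp add: A_def)
    qed
    then show "t \<in> (\<Inter>n. A n)" by blast
  qed
  moreover have "measure (vmeasure E' u) (A n) = (norm u)\<^sup>2" for n
    using fixed[of "inverse (real (Suc n))"] by (simp add: A_def E'.measure_vmeasure)
  ultimately have "(norm (E' {c..d} u))\<^sup>2 = (norm u)\<^sup>2"
    by (simp add: E'.measure_vmeasure LIMSEQ_const_iff)
  then have "u - E' {c..d} u = 0"
    using orth_proj_pythagoras[OF E'.proj, of "{c..d}" u] by simp
  then show ?thesis by simp
qed

lemma spectral_resolution_unique:
  assumes "spectral_resolution G E" "spectral_resolution G E'" "A \<in> sets borel"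
  shows "E A = E' A"
proof -
  interpret E: spectral_resolution G E by fact
  interpret E': spectral_resolution G E' by fact
  have Icc: "E {c..d} = E' {c..d}" for c d
  proof (cases "c \<le> d")
    case True
    show ?thesis
    proof (rule orth_proj_unique)
      show "orth_proj (E {c..d})" "orth_proj (E' {c..d})" by (simp_all add: E.proj E'.proj)
      then show "range (blinfun_apply (E {c..d})) = range (blinfun_apply (E' {c..d}))"
        using spectral_resolution_Icc_subset[OF assms(1,2) True]
          spectral_resolution_Icc_subset[OF assms(2,1) True]
        by (intro set_eqI) (metis orth_proj_range)
    qed
  qed simp
  have vm: "vmeasure E x = vmeasure E' x" for x
  proof (rule measure_eqI_generator_eq)
    show "Int_stable (range (\<lambda>(a::real, b). {a..b}))"
      unfolding Int_stable_def
    proof (intro ballI)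
      fix A B assume "A \<in> range (\<lambda>(a::real, b). {a..b})" "B \<in> range (\<lambda>(a::real, b). {a..b})"
      then obtain a b c d where "A = {a..b}" "B = {c..d}" by auto
      then have "A \<inter> B = (\<lambda>(a, b). {a..b}) (max a c, min b d)" by auto
      then show "A \<inter> B \<in> range (\<lambda>(a::real, b). {a..b})" by blast
    qed
    show "sets (vmeasure E x) = sigma_sets UNIV (range (\<lambda>(a::real, b). {a..b}))"
      "sets (vmeasure E' x) = sigma_sets UNIV (range (\<lambda>(a::real, b). {a..b}))"
      by (simp_all add: borel_eq_atLeastAtMost)
    show "emeasure (vmeasure E x) X = emeasure (vmeasure E' x) X"
      if "X \<in> range (\<lambda>(a::real, b). {a..b})" for X
      using that by (auto simp: E.emeasure_vmeasure E'.emeasure_vmeasure Icc)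
    show "range (\<lambda>n. {- real n..real n}) \<subseteq> range (\<lambda>(a::real, b). {a..b})" by auto
    have "(\<Union>n. {- real n<..real n}) \<subseteq> (\<Union>n. {- real n..real n})" by (intro UN_mono) auto
    then show "(\<Union>n. {- real n..real n}) = UNIV" by (simp add: UN_Ioc_nat top.extremum_unique)
    show "emeasure (vmeasure E x) {- real n..real n} \<noteq> \<infinity>" for n
      by (simp add: E.emeasure_vmeasure)
  qed auto
  show ?thesis
  proof (rule sym_op_eqI)
    show "sym_op (E A)" "sym_op (E' A)" by (simp_all add: orth_proj_imp_sym_op E.proj E'.proj assms(3))
    fix x
    have "(norm (E A x))\<^sup>2 = (norm (E' A x))\<^sup>2"
      using vm[of x] assms(3) by (metis E.measure_vmeasure E'.measure_vmeasure)
    then show "inner (E A x) x = inner (E' A x) x"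
      by (simp add: orth_proj_inner E.proj E'.proj assms(3))
  qed
qed

section \<open>Perturbation of lower bounds and spectral projections\<close>

text \<open>For positive \<eta> a quantitative way of saying that \<open>c\<close> is outside the
  spectrum, see \<open>not_in_spectrum_iff\<close>; in this form it can be transported to nearby
  graphs.\<close>

definition bounded_below :: "('a::real_normed_vector \<times> 'a) set \<Rightarrow> real \<Rightarrow> real \<Rightarrow> bool" where
  "bounded_below G c \<eta> \<longleftrightarrow> (\<forall>(x, w)\<in>G. \<eta> * norm x \<le> norm (w - c *\<^sub>R x))"

lemma bounded_belowD: "bounded_below G c \<eta> \<Longrightarrow> (x, w) \<in> G \<Longrightarrow> \<eta> * norm x \<le> norm (w - c *\<^sub>R x)"
  unfolding bounded_below_def by blast

lemma bounded_below_weaken: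
  assumes "bounded_below G c \<eta>'" "\<eta> \<le> \<eta>'" shows "bounded_below G c \<eta>"
proof -
  have "\<eta> * norm x \<le> norm (w - c *\<^sub>R x)" if "(x, w) \<in> G" for x w
    using bounded_belowD[OF assms(1) that] mult_right_mono[OF assms(2), of "norm x"]
    by (auto intro: order_trans)
  then show ?thesis by (auto simp: bounded_below_def)
qed

text \<open>A pair of \<open>H\<close> is moved to \<open>G\<close> with error \<open>e\<close> in
  each component, and the errors enter with total weight 1 + |c| + \<eta>. Since |z| <= |z - c y| +
  |c| |y|, the smallness hypothesis bounds them by \<eta>/4 |y| + 1/4 |z - c y|, which leaves 3
  \<eta> |y| <= 5 |z - c y|, more than is claimed.\<close>

lemma bounded_below_stable:
  assumes GH: "selfadjoint_graph G" "selfadjoint_graph H" and below: "bounded_below G c \<eta>" and "\<eta> > 0"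
    and small: "(1 + \<bar>c\<bar> + \<eta>) * (1 + \<bar>c\<bar>) * gap G H \<le> min (1/4) (\<eta>/4)"
  shows "bounded_below H c (\<eta> / 2)"
  unfolding bounded_below_def
proof (intro ballI, clarify)
  fix y z assume "(y, z) \<in> H"
  define \<gamma> where "\<gamma> = gap G H"
  have \<gamma>: "\<gamma> \<ge> 0" by (simp add: \<gamma>_def gap_def)
  define \<kappa> where "\<kappa> = (1 + \<bar>c\<bar> + \<eta>) * (1 + \<bar>c\<bar>) * \<gamma>"
  define s where "s = norm (z - c *\<^sub>R y)"
  define e where "e = \<gamma> * (norm y + norm z)"
  obtain x w where x: "(x, w) \<in> G" "norm (x - y) \<le> e" "norm (w - z) \<le> e"
    using gap_nearby[OF GH(2,1) \<open>(y, z) \<in> H\<close>] unfolding e_def \<gamma>_def gap_commute[of H G] by blast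
  have "norm z \<le> s + \<bar>c\<bar> * norm y"
    using norm_triangle_ineq[of "z - c *\<^sub>R y" "c *\<^sub>R y"] by (simp add: s_def)
  then have "norm y + norm z \<le> (1 + \<bar>c\<bar>) * norm y + s" by (simp add: algebra_simps)
  also have "\<dots> \<le> (1 + \<bar>c\<bar>) * norm y + (1 + \<bar>c\<bar>) * s"
    using mult_right_mono[of 1 "1 + \<bar>c\<bar>" s] by (simp add: s_def)
  finally have "e \<le> \<gamma> * ((1 + \<bar>c\<bar>) * norm y + (1 + \<bar>c\<bar>) * s)"
    unfolding e_def by (rule mult_left_mono) (rule \<gamma>)
  then have "(1 + \<bar>c\<bar> + \<eta>) * e \<le> (1 + \<bar>c\<bar> + \<eta>) * (\<gamma> * ((1 + \<bar>c\<bar>) * norm y + (1 + \<bar>c\<bar>) * s))"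
    using \<open>\<eta> > 0\<close> by (intro mult_left_mono) auto
  also have "\<dots> = \<kappa> * norm y + \<kappa> * s" by (simp add: \<kappa>_def algebra_simps)
  also have "\<dots> \<le> \<eta>/4 * norm y + 1/4 * s"
    using small unfolding \<gamma>_def[symmetric] \<kappa>_def[symmetric] s_def
    by (intro add_mono mult_right_mono) auto
  finally have e: "(1 + \<bar>c\<bar> + \<eta>) * e \<le> \<eta>/4 * norm y + 1/4 * s" .
  have "\<eta> * norm y \<le> \<eta> * (norm x + e)"
    using x(2) norm_triangle_ineq2[of y x] \<open>\<eta> > 0\<close> by (intro mult_left_mono) (auto simp: norm_minus_commute)
  also have "\<dots> = \<eta> * norm x + \<eta> * e" by (simp add: algebra_simps)
  also have "\<eta> * norm x \<le> norm (w - c *\<^sub>R x)" by (rule bounded_belowD[OF below x(1)])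
  also have "w - c *\<^sub>R x = (z - c *\<^sub>R y) + (w - z) - c *\<^sub>R (x - y)" by (simp add: algebra_simps)
  also have "norm \<dots> \<le> s + norm (w - z) + norm (c *\<^sub>R (x - y))"
    unfolding s_def by (intro order_trans[OF norm_triangle_ineq4] add_mono norm_triangle_ineq order_refl)
  also have "\<dots> \<le> s + e + \<bar>c\<bar> * e" using x by (intro add_mono) (auto simp: mult_left_mono)
  finally have "\<eta> * norm y \<le> s + (1 + \<bar>c\<bar> + \<eta>) * e" by (simp add: algebra_simps)
  with e have "3 * \<eta> * norm y \<le> 5 * s" by (simp add: field_simps)
  moreover have "0 \<le> \<eta> * norm y" using \<open>\<eta> > 0\<close> by simp
  ultimately show "\<eta> / 2 * norm y \<le> norm (z - c *\<^sub>R y)" by (simp add: s_def)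
qed

text \<open>P - Q = (1 - Q) P - Q (1 - P), and the second term is the adjoint of (1 - P) Q, so
  one-sided estimates in both directions bound the difference.\<close>

lemma norm_orth_proj_diff_le:
  fixes P Q :: "'a::real_inner \<Rightarrow>\<^sub>L 'a"
  assumes P: "orth_proj P" and Q: "orth_proj Q"
    and PQ: "\<And>x. norm (P x - Q (P x)) \<le> \<kappa> * norm x" and QP: "\<And>x. norm (Q x - P (Q x)) \<le> \<kappa> * norm x"
    and "0 \<le> \<kappa>"
  shows "norm (P - Q) \<le> 2 * \<kappa>"
proof (rule norm_blinfun_bound)
  fix x
  define z where "z = Q (x - P x)"
  have "norm z * norm z = inner (Q z) (x - P x)"
    using Q by (simp add: z_def orth_proj_sym orth_proj_idem dot_square_norm flip: power2_eq_square)
      (metis Q dot_square_norm orth_proj_idem orth_proj_sym)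
  also have "Q z = z" by (simp add: z_def orth_proj_idem[OF Q])
  also have "inner z (x - P x) = inner (z - P z) x"
    by (simp add: inner_diff_left inner_diff_right orth_proj_sym[OF P])
  also have "\<dots> \<le> norm (z - P z) * norm x" by (rule norm_cauchy_schwarz)
  also have "\<dots> \<le> \<kappa> * norm z * norm x"
    using QP[of z] by (intro mult_right_mono) (simp_all add: z_def orth_proj_idem[OF Q])
  finally have "norm z * norm z \<le> norm z * (\<kappa> * norm x)" by (simp add: algebra_simps)
  then have z: "norm z \<le> \<kappa> * norm x" using \<open>0 \<le> \<kappa>\<close> by (cases "norm z = 0") auto
  have "(P - Q) x = (P x - Q (P x)) - z" by (simp add: z_def blinfun.bilinear_simps)
  then have "norm ((P - Q) x) \<le> norm (P x - Q (P x)) + norm z" by (metis norm_triangle_ineq4)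
  also have "\<dots> \<le> \<kappa> * norm x + \<kappa> * norm x" by (intro add_mono PQ z)
  finally show "norm ((P - Q) x) \<le> 2 * \<kappa> * norm x" by simp
qed (use \<open>0 \<le> \<kappa>\<close> in simp)

text \<open>Neighbourhoods of the endpoints carry no spectral measure. This provides the separation
  between an inner and an outer interval on which \<open>sin_theta\<close> rests.\<close>

lemma spectral_measure_shrink_enlarge:
  assumes "spectral_resolution G E" and below: "bounded_below G c \<eta>" "bounded_below G d \<eta>"
    and "0 \<le> \<epsilon>" "\<epsilon> < \<eta>" "\<epsilon> \<le> (d - c) / 2"
  shows "E {c..d} = E {c + \<epsilon>..d - \<epsilon>}" "E {c..d} = E {c - \<epsilon>..d + \<epsilon>}"
proof -
  interpret E: spectral_resolution G E by fact
  define N where "N = {c - \<epsilon>..c + \<epsilon>} \<union> {d - \<epsilon>..d + \<epsilon>}"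
  have "E N = 0" unfolding N_def
    by (intro E.null_union E.null_of_bounded_below[of \<eta>] bounded_belowD[OF below(1)] bounded_belowD[OF below(2)] assms)
      auto
  then show "E {c..d} = E {c + \<epsilon>..d - \<epsilon>}" "E {c..d} = E {c - \<epsilon>..d + \<epsilon>}"
    by (rule E.eq_modulo_null; use assms in \<open>auto simp: N_def\<close>)+
qed

lemma spectral_projection_stable:
  fixes G :: "('a::{real_inner,banach} \<times> 'a) set"
  assumes G: "selfadjoint_graph G" and "c < d" and below: "bounded_below G c \<eta>" "bounded_below G d \<eta>" and "\<eta> > 0"
  obtains \<delta> C where "\<delta> > 0"
    "\<And>H. selfadjoint_graph H \<Longrightarrow> gap G H < \<delta> \<Longrightarrow> bounded_below H c (\<eta>/2) \<and> bounded_below H d (\<eta>/2) \<and>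
       norm (spectral_measure G {c..d} - spectral_measure H {c..d}) \<le> C * gap G H"
proof -
  \<comment> \<open>\<eta>/4 stays below \<eta>/2, the lower bound that survives for
    \<open>H\<close>; a quarter of the length keeps the shrunk interval nonempty.\<close>
  define \<epsilon> where "\<epsilon> = min (\<eta>/4) ((d - c)/4)"
  have \<epsilon>: "0 < \<epsilon>" "\<epsilon> < \<eta>" "\<epsilon> < \<eta>/2" "\<epsilon> < (d - c) / 2" "\<epsilon> \<le> (d - c) / 2"
    using \<open>c < d\<close> \<open>\<eta> > 0\<close> by (auto simp: \<epsilon>_def min_def)
  define m \<alpha> \<beta> where "m = (c + d) / 2" and "\<alpha> = (d - c) / 2 - \<epsilon>" and "\<beta> = (d - c) / 2 + \<epsilon>"
  have ivl: "c + \<epsilon> = m - \<alpha>" "d - \<epsilon> = m + \<alpha>" "c - \<epsilon> = m - \<beta>" "d + \<epsilon> = m + \<beta>"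
    by (auto simp: m_def \<alpha>_def \<beta>_def field_simps)
  have ab: "0 \<le> \<alpha>" "\<alpha> < \<beta>" "0 \<le> \<beta>" using \<epsilon> by (auto simp: \<alpha>_def \<beta>_def)
  define K where "K a = (1 + \<bar>a\<bar> + \<eta>) * (1 + \<bar>a\<bar>)" for a
  have K: "K a > 0" for a using \<open>\<eta> > 0\<close> by (simp add: K_def add_pos_nonneg)
  define \<delta> where "\<delta> = min (min (1/4) (\<eta>/4) / K c) (min (1/4) (\<eta>/4) / K d)"
  define C where "C = (1 + \<bar>m\<bar> + \<beta>)\<^sup>2 / (\<beta> - \<alpha>)"
  have C: "C \<ge> 0" using ab by (simp add: C_def)
  show ?thesis
  proof (rule that[of \<delta> "2 * C"])
    show "\<delta> > 0" using \<open>\<eta> > 0\<close> K by (simp add: \<delta>_def)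
    fix H :: "('a \<times> 'a) set" assume H: "selfadjoint_graph H" and gap: "gap G H < \<delta>"
    have "K c * gap G H \<le> min (1/4) (\<eta>/4)" "K d * gap G H \<le> min (1/4) (\<eta>/4)"
    proof -
      have "gap G H < min (1/4) (\<eta>/4) / K c" "gap G H < min (1/4) (\<eta>/4) / K d"
        using gap unfolding \<delta>_def by linarith+
      then show "K c * gap G H \<le> min (1/4) (\<eta>/4)" "K d * gap G H \<le> min (1/4) (\<eta>/4)"
        by (simp_all only: pos_less_divide_eq[OF K] mult.commute[of "K _"] less_imp_le)
    qed
    then have belowH: "bounded_below H c (\<eta>/2)" "bounded_below H d (\<eta>/2)"
      using bounded_below_stable[OF G H _ \<open>\<eta> > 0\<close>] below unfolding K_def by blast+
    interpret G: spectral_resolution G "spectral_measure G"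
      by (rule selfadjoint_graph.spectral_resolution[OF G])
    interpret H: spectral_resolution H "spectral_measure H"
      by (rule selfadjoint_graph.spectral_resolution[OF H])
    have EG: "spectral_measure G {c..d} = spectral_measure G {m - \<alpha>..m + \<alpha>}"
      "spectral_measure G {c..d} = spectral_measure G {m - \<beta>..m + \<beta>}"
      using spectral_measure_shrink_enlarge[OF G.spectral_resolution_axioms below, of \<epsilon>] \<epsilon> unfolding ivl by auto
    have EH: "spectral_measure H {c..d} = spectral_measure H {m - \<alpha>..m + \<alpha>}"
      "spectral_measure H {c..d} = spectral_measure H {m - \<beta>..m + \<beta>}"
      using spectral_measure_shrink_enlarge[OF H.spectral_resolution_axioms belowH, of \<epsilon>] \<epsilon> unfolding ivl by auto
    have PQ: "norm (spectral_measure G {c..d} x - spectral_measure H {c..d} (spectral_measure G {c..d} x))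
        \<le> gap G H * C * norm x" for x
      unfolding EG(1) EH(2) C_def times_divide_eq_right
    proof (rule sin_theta[OF G H])
      show "\<exists>w. (u, w) \<in> G \<and> spectral_measure G {m - \<alpha>..m + \<alpha>} w = w \<and> norm (w - m *\<^sub>R u) \<le> \<alpha> * norm u"
        if "spectral_measure G {m - \<alpha>..m + \<alpha>} u = u" for u
        using G.inside_interval[OF that] by blast
      show "(spectral_measure H {m - \<beta>..m + \<beta>} v, spectral_measure H {m - \<beta>..m + \<beta>} w) \<in> H"
        if "(v, w) \<in> H" for v w
        by (rule H.reducesD[OF H.E_reduces that]) simp
      show "\<beta> * norm v \<le> norm (w - m *\<^sub>R v)" if "(v, w) \<in> H" "spectral_measure H {m - \<beta>..m + \<beta>} v = 0" for v w
        by (rule H.outside_interval[OF that ab(3)])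
    qed (use ab in \<open>auto simp: G.proj H.proj\<close>)
    have QP: "norm (spectral_measure H {c..d} x - spectral_measure G {c..d} (spectral_measure H {c..d} x))
        \<le> gap G H * C * norm x" for x
      unfolding EG(2) EH(1) C_def times_divide_eq_right gap_commute[of G H]
    proof (rule sin_theta[OF H G])
      show "\<exists>w. (u, w) \<in> H \<and> spectral_measure H {m - \<alpha>..m + \<alpha>} w = w \<and> norm (w - m *\<^sub>R u) \<le> \<alpha> * norm u"
        if "spectral_measure H {m - \<alpha>..m + \<alpha>} u = u" for u
        using H.inside_interval[OF that] by blast
      show "(spectral_measure G {m - \<beta>..m + \<beta>} v, spectral_measure G {m - \<beta>..m + \<beta>} w) \<in> G"
        if "(v, w) \<in> G" for v w
        by (rule G.reducesD[OF G.E_reduces that]) simp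
      show "\<beta> * norm v \<le> norm (w - m *\<^sub>R v)" if "(v, w) \<in> G" "spectral_measure G {m - \<beta>..m + \<beta>} v = 0" for v w
        by (rule G.outside_interval[OF that ab(3)])
    qed (use ab in \<open>auto simp: G.proj H.proj\<close>)
    have "norm (spectral_measure G {c..d} - spectral_measure H {c..d}) \<le> 2 * (gap G H * C)"
      by (rule norm_orth_proj_diff_le[OF G.proj H.proj PQ QP]) (use C in \<open>auto simp: gap_def\<close>)
    then show "bounded_below H c (\<eta>/2) \<and> bounded_below H d (\<eta>/2) \<and>
       norm (spectral_measure G {c..d} - spectral_measure H {c..d}) \<le> 2 * C * gap G H"
      using belowH by (simp add: mult_ac)
  qed
qed

text \<open>The lower bound makes the image of T - c on the kernel of \<open>Q\<close> closed. A
  vector \<open>q\<close> of that kernel orthogonal to the image satisfies (q, c q) in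
  \<open>G\<close> by selfadjointness, and the lower bound forces q = 0. The case Q = 0 gives
  resolvents, a spectral projection Q gives Fredholmness.\<close>

lemma (in selfadjoint_graph) shift_surjective:
  fixes Q :: "'a \<Rightarrow>\<^sub>L 'a"
  assumes Q: "orth_proj Q" "reduces Q" and "\<eta> > 0"
    and below: "\<And>v w. (v, w) \<in> G \<Longrightarrow> Q v = 0 \<Longrightarrow> \<eta> * norm v \<le> norm (w - c *\<^sub>R v)"
    and y: "Q y = 0"
  shows "\<exists>v w. (v, w) \<in> G \<and> Q v = 0 \<and> w - c *\<^sub>R v = y"
proof -
  define M where "M = {w - c *\<^sub>R v |v w. (v, w) \<in> G \<and> Q v = 0}"
  have Qw: "Q w = 0" if "(v, w) \<in> G" "Q v = 0" for v w
    using reducesD[OF Q(2) that(1)] that(2) single_valued[OF zero_mem] by metis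
  have M: "subspace M"
  proof (rule subspaceI)
    show "0 \<in> M" unfolding M_def mem_Collect_eq
      using zero_mem by (intro exI[of _ 0]) (simp add: blinfun.zero_right)
    fix p q :: 'a and t :: real
    assume "p \<in> M"
    then obtain v w where p: "p = w - c *\<^sub>R v" "(v, w) \<in> G" "Q v = 0" by (auto simp: M_def)
    show "t *\<^sub>R p \<in> M"
      unfolding M_def mem_Collect_eq
      using scale_mem[OF p(2), of t] p
      by (intro exI[of _ "t *\<^sub>R v"] exI[of _ "t *\<^sub>R w"]) (auto simp: blinfun.bilinear_simps algebra_simps)
    assume "q \<in> M"
    then obtain v' w' where q: "q = w' - c *\<^sub>R v'" "(v', w') \<in> G" "Q v' = 0" by (auto simp: M_def)
    show "p + q \<in> M"
      unfolding M_def mem_Collect_eq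
      using add_mem[OF p(2) q(2)] p q
      by (intro exI[of _ "v + v'"] exI[of _ "w + w'"]) (auto simp: blinfun.bilinear_simps algebra_simps)
  qed
  have "closed M"
    unfolding closed_sequential_limits
  proof (intro allI impI, elim conjE)
    fix f l assume "\<forall>n. f n \<in> M" and f: "f \<longlonglongrightarrow> l"
    then have "\<forall>n. \<exists>v w. f n = w - c *\<^sub>R v \<and> (v, w) \<in> G \<and> Q v = 0" by (auto simp: M_def)
    then obtain v w where vw: "\<And>n. f n = w n - c *\<^sub>R v n" "\<And>n. (v n, w n) \<in> G" "\<And>n. Q (v n) = 0" by metis
    have "Cauchy v"
    proof (rule CauchyI)
      fix e :: real assume "0 < e"
      then obtain N where N: "\<And>m n. m \<ge> N \<Longrightarrow> n \<ge> N \<Longrightarrow> norm (f m - f n) < \<eta> * e"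
        using CauchyD[OF LIMSEQ_imp_Cauchy[OF f], of "\<eta> * e"] \<open>\<eta> > 0\<close> by auto
      have "norm (v m - v n) < e" if "m \<ge> N" "n \<ge> N" for m n
      proof -
        have "\<eta> * norm (v m - v n) \<le> norm ((w m - w n) - c *\<^sub>R (v m - v n))"
          by (intro below diff_mem vw) (simp add: blinfun.bilinear_simps vw)
        also have "(w m - w n) - c *\<^sub>R (v m - v n) = f m - f n" by (simp add: vw(1) algebra_simps)
        also have "norm (f m - f n) < \<eta> * e" by (rule N[OF that])
        finally show ?thesis using \<open>\<eta> > 0\<close> by (simp only: mult_less_cancel_left_pos)
      qed
      then show "\<exists>M. \<forall>m\<ge>M. \<forall>n\<ge>M. norm (v m - v n) < e" by blast
    qed
    then obtain v' where v': "v \<longlonglongrightarrow> v'" using Cauchy_convergent convergent_def by blast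
    have "(\<lambda>n. f n + c *\<^sub>R v n) \<longlonglongrightarrow> l + c *\<^sub>R v'" by (intro tendsto_intros f v')
    then have w': "w \<longlonglongrightarrow> l + c *\<^sub>R v'" by (simp add: vw(1))
    have "(\<lambda>n. (v n, w n)) \<longlonglongrightarrow> (v', l + c *\<^sub>R v')" by (intro tendsto_intros v' w')
    then have "(v', l + c *\<^sub>R v') \<in> G" by (rule closed_sequentially[OF closed_G, rotated]) (rule vw)
    moreover have "Q v' = 0"
      using blinfun.tendsto[OF tendsto_const v', of Q] by (simp add: vw(3) LIMSEQ_const_iff)
    ultimately show "l \<in> M" unfolding M_def by force
  qed
  then obtain p where p: "p \<in> M" "\<And>s. s \<in> M \<Longrightarrow> inner (y - p) s = 0" using ex_nearest_point[OF M] by blast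
  define q where "q = y - p"
  obtain v w where vw: "p = w - c *\<^sub>R v" "(v, w) \<in> G" "Q v = 0" using p(1) by (auto simp: M_def)
  have "Q q = 0" using Qw[OF vw(2,3)] by (simp add: q_def blinfun.bilinear_simps y vw)
  have "(q, c *\<^sub>R q) \<in> G"
  proof (rule memI)
    fix x w assume xw: "(x, w) \<in> G"
    define x' w' where "x' = x - Q x" and "w' = w - Q w"
    have "(x', w') \<in> G" unfolding x'_def w'_def by (intro diff_mem xw reducesD[OF Q(2)])
    moreover have "Q x' = 0" by (simp add: x'_def blinfun.bilinear_simps orth_proj_idem[OF Q(1)])
    ultimately have "inner q (w' - c *\<^sub>R x') = 0" unfolding q_def by (intro p(2)) (auto simp: M_def)
    moreover have "inner q (Q z) = 0" for z
      using \<open>Q q = 0\<close> by (metis inner_zero_left orth_proj_sym[OF Q(1)])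
    ultimately have "inner q (w - c *\<^sub>R x) = 0" by (simp add: x'_def w'_def inner_diff_right)
    then show "inner w q = inner x (c *\<^sub>R q)" by (simp add: inner_diff_right inner_commute)
  qed
  from below[OF this \<open>Q q = 0\<close>] have "q = 0" using \<open>\<eta> > 0\<close> by (simp add: mult_le_0_iff)
  then show ?thesis using vw by (auto simp: q_def)
qed

section \<open>Operators over the scalar field\<close>

lemma to_complex_0 [simp]: "to_complex 0 = 0"
  using to_complex_add[of 0 0] by simp

lemma to_complex_diff: "to_complex (x - y) = to_complex x - to_complex y"
  using to_complex_add[of "x - y" y] by simp

lemma to_complex_inject: "to_complex x = to_complex y \<longleftrightarrow> x = y"
  using norm_to_complex[of "x - y"] by (auto simp: to_complex_diff)

lemma to_complex_1: "to_complex (1 :: 'a::real_or_complex) = 1"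
proof -
  define t where "t = to_complex (1::'a)"
  have "norm t = 1" by (simp add: t_def norm_to_complex)
  then have "t \<noteq> 0" by auto
  moreover have "t * t = t" using to_complex_mult[of "1::'a" 1, symmetric] by (simp only: t_def mult_1)
  then have "t * t = t * 1" by simp
  ultimately have "t = 1" by (simp only: mult_cancel_left) simp
  then show ?thesis by (simp add: t_def)
qed

lemma to_complex_of_real: "to_complex (of_real r) = of_real r"
  unfolding of_real_def by (simp only: to_complex_scaleR to_complex_1)

text \<open>The scalar field is either real, where conjugation is trivial, or all of the complex
  numbers; in both cases it is closed under conjugation.\<close>

lemma ex_conjugate: "\<exists>c'::'a. to_complex c' = cnj (to_complex (c::'a::real_or_complex))"
proof (cases "range (to_complex :: 'a \<Rightarrow> complex) = UNIV")
  case True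
  then have "cnj (to_complex c) \<in> range (to_complex :: 'a \<Rightarrow> complex)" by simp
  then show ?thesis by (auto simp: image_iff intro: sym)
next
  case False
  then have "to_complex c \<in> \<real>" using range_to_complex[where 'a = 'a] by blast
  then have "to_complex c = cnj (to_complex c)" by (simp add: Reals_cnj_iff)
  then show ?thesis by (rule exI)
qed

text \<open>The uniform boundedness principle: by Baire one of the closed sets \<open>S n\<close>
  contains a ball.\<close>

lemma pointwise_bounded_functionals:
  fixes Z :: "'a::{real_inner,banach} set"
  assumes "\<And>y. \<exists>K. \<forall>z\<in>Z. \<bar>inner z y\<bar> \<le> K"
  obtains C where "\<And>z. z \<in> Z \<Longrightarrow> norm z \<le> C"
proof -
  define S where "S n = {y. \<forall>z\<in>Z. \<bar>inner z y\<bar> \<le> real n}" for n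
  have "closed (S n)" for n
  proof -
    have "S n = (\<Inter>z\<in>Z. {y. \<bar>inner z y\<bar> \<le> real n})" by (auto simp: S_def)
    then show ?thesis by (auto intro!: closed_INT closed_Collect_le continuous_intros)
  qed
  moreover have "(\<Union>n. S n) = UNIV"
  proof -
    have "y \<in> (\<Union>n. S n)" for y
    proof -
      obtain K where K: "\<forall>z\<in>Z. \<bar>inner z y\<bar> \<le> K" using assms by blast
      obtain n where "K \<le> real n" using real_arch_simple by blast
      then have "y \<in> S n" using K by (force simp: S_def)
      then show ?thesis by blast
    qed
    then show ?thesis by blast
  qed
  ultimately obtain n where "interior (S n) \<noteq> {}"
    using Baire_category_alt[of "euclidean :: 'a topology" "range S"] completely_metrizable_space_euclidean
    by auto
  then obtain y e where e: "e > 0" "cball y e \<subseteq> S n" by (auto simp: mem_interior_cball)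
  show ?thesis
  proof (rule that)
    fix z assume z: "z \<in> Z"
    show "norm z \<le> 2 * real n / e"
    proof (cases "z = 0")
      case False
      \<comment> \<open>The point of the ball farthest in the direction of \<open>z\<close>: the
        pairing exceeds that at the centre by \<open>e * norm z\<close>, while both are at most
        \<open>n\<close> in absolute value.\<close>
      define x where "x = y + (e / norm z) *\<^sub>R z"
      have "x \<in> cball y e" "y \<in> cball y e" using e False by (auto simp: x_def dist_norm)
      then have "x \<in> S n" "y \<in> S n" using e(2) by blast+
      then have "\<bar>inner z x\<bar> \<le> real n" "\<bar>inner z y\<bar> \<le> real n" using z by (auto simp: S_def)
      moreover have "inner z x - inner z y = e * norm z"
        using False by (simp add: x_def inner_add_right dot_square_norm power2_eq_square)
      ultimately have "e * norm z \<le> 2 * real n" by linarith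
      then show ?thesis using e by (simp add: field_simps)
    qed (use e in simp)
  qed
qed

context hilbert_space
begin

lemma ip_add_right: "ip x (y + z) = ip x y + ip x z"
  by (rule to_complex_inject[THEN iffD1], simp add: ip_commute[of x] ip_add_left to_complex_add)

lemma ip_scale_adjoint:
  assumes "to_complex c' = cnj (to_complex c)"
  shows "ip (scale c x) y = ip x (scale c' y)"
  by (rule to_complex_inject[THEN iffD1], simp add: ip_commute[of x "scale c' y"] ip_scale_left to_complex_mult assms)
    (metis ip_commute)

lemma inner_scale_adjoint:
  "to_complex c' = cnj (to_complex c) \<Longrightarrow> inner (scale c x) y = inner x (scale c' y)"
  by (metis Re_ip ip_scale_adjoint)

text \<open>The real parts of all multiples determine a scalar: for \<open>c\<close> conjugate to
  the difference \<open>z\<close>, the real part of \<open>c * z\<close> is |z|^2. This lifts real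
  identities to the scalar field.\<close>

lemma ip_eqI:
  assumes "\<And>c. inner (scale c x) y = inner (scale c x') y'"
  shows "ip x y = ip x' y'"
proof -
  define z where "z = ip x y - ip x' y'"
  obtain c :: 'k where c: "to_complex c = cnj (to_complex z)" using ex_conjugate by blast
  have "Re (to_complex (c * ip x y)) = Re (to_complex (c * ip x' y'))"
    using assms[of c] by (metis Re_ip ip_scale_left)
  then have "Re (cnj (to_complex z) * to_complex z) = 0"
    by (simp add: to_complex_mult c z_def to_complex_diff algebra_simps)
  moreover have "Re (cnj (to_complex z) * to_complex z) = (cmod (to_complex z))\<^sup>2"
    unfolding cmod_power2 by (simp add: power2_eq_square)
  ultimately have "(cmod (to_complex z))\<^sup>2 = 0" by (simp only:)
  then have "cmod (to_complex z) = 0" by (simp only: zero_eq_power2)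
  then have "to_complex z = to_complex (0 :: 'k)" by (simp only: norm_eq_zero to_complex_0)
  then have "z = 0" unfolding to_complex_inject .
  then show ?thesis by (simp add: z_def)
qed

lemma ip_zero_left [simp]: "ip 0 y = 0" and ip_zero_right [simp]: "ip x 0 = 0"
  using ip_add_left[of 0 0 y] ip_add_right[of x 0 0] by simp_all

lemma scale_scaleR: "scale c (r *\<^sub>R x) = r *\<^sub>R scale c x"
  by (metis scale_of_real scale_left_commute)

lemma norm_scale_le: "norm (scale c x) \<le> norm x * norm c"
proof -
  define C Z where "C = to_complex c" and "Z = to_complex (ip x x)"
  have "(norm (scale c x))\<^sup>2 = Re (to_complex (c * ip x (scale c x)))"
    by (simp only: power2_norm_eq_inner Re_ip[symmetric] ip_scale_left)
  also have "to_complex (c * ip x (scale c x)) = C * cnj (C * Z)"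
    by (simp only: to_complex_mult ip_commute[of x "scale c x"] ip_scale_left C_def Z_def)
  also have "\<dots> = of_real ((cmod C)\<^sup>2) * cnj Z"
    using complex_norm_square[of C] by (simp add: mult.assoc)
  also have "Re \<dots> = (cmod C)\<^sup>2 * (norm x)\<^sup>2"
    by (simp add: Z_def Re_ip power2_norm_eq_inner)
  finally have "(norm (scale c x))\<^sup>2 = (norm x * norm c)\<^sup>2"
    by (simp add: C_def norm_to_complex power_mult_distrib)
  then show ?thesis by (simp add: power2_eq_iff_nonneg)
qed

definition scale_op :: "'k \<Rightarrow> 'a \<Rightarrow>\<^sub>L 'a" where "scale_op c = Blinfun (scale c)"

lemma scale_op [simp]: "blinfun_apply (scale_op c) = scale c"
  unfolding scale_op_def
  by (rule bounded_linear_Blinfun_apply, rule bounded_linear_intro)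
    (auto simp: scale_right_distrib scale_scaleR intro: norm_scale_le)

lemma adjoint_pair_scale_op:
  "to_complex c' = cnj (to_complex c) \<Longrightarrow> adjoint_pair (scale_op c) (scale_op c')"
  by (simp add: adjoint_pair_def inner_scale_adjoint)

text \<open>The bridge for projections. Symmetry for \<open>ip\<close> lets scalars be moved across,
  which gives linearity; conversely linearity supplies the multiples that \<open>ip_eqI\<close> asks
  for.\<close>

lemma is_orth_proj_ip_iff:
  fixes P :: "'a \<Rightarrow>\<^sub>L 'a"
  shows "is_orth_proj ip P \<longleftrightarrow> orth_proj P \<and> (\<forall>c x. P (scale c x) = scale c (P x))"
proof (intro iffI conjI allI; (elim conjE)?)
  assume P: "is_orth_proj ip P"
  then have sym: "ip (P x) y = ip x (P y)" for x y by (simp add: is_orth_proj_def)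
  show "orth_proj P"
    by (rule orth_projI) (metis P is_orth_proj_idem, metis Re_ip sym)
  fix c x
  have "inner (P (scale c x)) y = inner (scale c (P x)) y" for y
    by (metis Re_ip ip_scale_left sym)
  then show "P (scale c x) = scale c (P x)" using vector_eq_rdot by blast
next
  assume P: "orth_proj P" and lin: "\<forall>c x. P (scale c x) = scale c (P x)"
  have "ip (P x) y = ip x (P y)" for x y
  proof (rule ip_eqI)
    fix c show "inner (scale c (P x)) y = inner (scale c x) (P y)"
      using lin orth_proj_sym[OF P] by metis
  qed
  then show "is_orth_proj ip P" using P by (simp add: is_orth_proj_def)
qed

lemma range_subspace:
  fixes P :: "'a \<Rightarrow>\<^sub>L 'a"
  assumes "is_orth_proj ip P" shows "subspace (range (blinfun_apply P))"
  using assms unfolding subspace_def is_orth_proj_ip_iff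
  by (auto simp: orth_proj_range orth_proj_idem blinfun.bilinear_simps)

lemma hilbert_space_prod:
  "hilbert_space (\<lambda>c (u :: 'a \<times> 'a). (scale c (fst u), scale c (snd u))) ip_prod"
proof
  show "to_complex (ip_prod x y) = cnj (to_complex (ip_prod y x))" for x y
    by (simp add: ip_prod_def to_complex_add ip_commute[of "fst x"] ip_commute[of "snd x"])
qed (auto simp: scale_right_distrib scale_left_distrib scale_of_real ip_prod_def ip_add_left
    ip_scale_left to_complex_add Re_ip inner_prod_def algebra_simps)

lemma graph_iff: "(x, y) \<in> Map.graph T \<longleftrightarrow> T x = Some y"
  by (auto simp: Map.graph_def)

lemma dom_eq: "fst ` Map.graph T = dom T"
  by (force simp: Map.graph_def)

definition selfadjoint :: "('a \<rightharpoonup> 'a) \<Rightarrow> bool" where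
  "selfadjoint T \<longleftrightarrow> linear_op T \<and> closure (dom T) = UNIV \<and> adjoint T = T"

lemma CFsa_selfadjoint: "T \<in> CFsa \<Longrightarrow> selfadjoint T"
  by (simp add: CFsa_def closed_ops_def selfadjoint_def)

lemma graph_scale: "selfadjoint T \<Longrightarrow> (x, w) \<in> Map.graph T \<Longrightarrow> (scale c x, scale c w) \<in> Map.graph T"
proof -
  assume T: "selfadjoint T" and xw: "(x, w) \<in> Map.graph T"
  then have "x \<in> dom T" by (auto simp: graph_iff)
  then have "scale c x \<in> dom T" "the (T (scale c x)) = scale c (the (T x))"
    using T by (auto simp: selfadjoint_def linear_op_def subspace_def)
  then show ?thesis using xw by (auto simp: graph_iff)
qed

lemma adjoint_eq_Some_iff:
  assumes "closure (dom T) = UNIV"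
  shows "adjoint T y = Some z \<longleftrightarrow> (\<forall>x\<in>dom T. ip (the (T x)) y = ip x z)"
proof -
  have uniq: "z = z'" if "\<forall>x\<in>dom T. ip (the (T x)) y = ip x z" "\<forall>x\<in>dom T. ip (the (T x)) y = ip x z'" for z z'
  proof -
    have "dom T \<subseteq> {x. inner x (z - z') = 0}"
      using that by (auto simp: inner_diff_right) (metis Re_ip domI)
    then have "closure (dom T) \<subseteq> {x. inner x (z - z') = 0}"
      by (intro closure_minimal closed_Collect_eq continuous_intros)
    then have "inner (z - z') (z - z') = 0" using assms by blast
    then show ?thesis by simp
  qed
  show ?thesis
  proof
    assume "adjoint T y = Some z"
    then have ex: "\<exists>z. \<forall>x\<in>dom T. ip (the (T x)) y = ip x z"
      and z: "z = (THE z. \<forall>x\<in>dom T. ip (the (T x)) y = ip x z)"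
      by (auto simp: adjoint_def split: if_splits)
    have "\<exists>!z. \<forall>x\<in>dom T. ip (the (T x)) y = ip x z" using ex uniq by blast
    then show "\<forall>x\<in>dom T. ip (the (T x)) y = ip x z" unfolding z by (rule theI')
  next
    assume z: "\<forall>x\<in>dom T. ip (the (T x)) y = ip x z"
    then have "(THE z. \<forall>x\<in>dom T. ip (the (T x)) y = ip x z) = z"
      by (rule the_equality) (rule uniq[OF _ z])
    then show "adjoint T y = Some z" using z by (auto simp: adjoint_def)
  qed
qed

text \<open>Being adjoint for \<open>ip\<close> and for the real inner product coincide because the
  graph is invariant under scalars, so \<open>ip_eqI\<close> applies.\<close>

lemma selfadjoint_graph: "selfadjoint T \<Longrightarrow> selfadjoint_graph (Map.graph T)"
proof
  assume T: "selfadjoint T"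
  then show "closure (fst ` Map.graph T) = UNIV" by (simp add: dom_eq selfadjoint_def)
  fix y z
  have "(y, z) \<in> Map.graph T \<longleftrightarrow> (\<forall>x\<in>dom T. ip (the (T x)) y = ip x z)"
    using T adjoint_eq_Some_iff[of T y z] by (simp add: selfadjoint_def graph_iff)
  also have "\<dots> \<longleftrightarrow> (\<forall>(x, w)\<in>Map.graph T. ip w y = ip x z)"
    by (force simp: graph_iff)
  also have "\<dots> \<longleftrightarrow> (\<forall>(x, w)\<in>Map.graph T. inner w y = inner x z)"
  proof
    assume "\<forall>(x, w)\<in>Map.graph T. ip w y = ip x z"
    then show "\<forall>(x, w)\<in>Map.graph T. inner w y = inner x z" by (metis (mono_tags, lifting) Re_ip case_prodD case_prodI2)
  next
    assume *: "\<forall>(x, w)\<in>Map.graph T. inner w y = inner x z"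
    show "\<forall>(x, w)\<in>Map.graph T. ip w y = ip x z"
    proof (intro ballI, clarify)
      fix x w assume xw: "(x, w) \<in> Map.graph T"
      show "ip w y = ip x z"
      proof (rule ip_eqI)
        fix c show "inner (scale c w) y = inner (scale c x) z"
          using * graph_scale[OF T xw, of c] by blast
      qed
    qed
  qed
  finally show "(y, z) \<in> Map.graph T \<longleftrightarrow> (\<forall>(x, w)\<in>Map.graph T. inner w y = inner x z)" .
qed

lemma reduces_scale_op:
  assumes "selfadjoint T"
  shows "selfadjoint_graph.reduces (Map.graph T) (scale_op c)"
  using graph_scale[OF assms] by (auto simp: selfadjoint_graph.reduces_def[OF selfadjoint_graph[OF assms]])

text \<open>Commutation is known for the constructed measure; uniqueness carries it over to the
  chosen one.\<close>

lemma spectral_measure_scale: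
  assumes T: "selfadjoint T" and A: "A \<in> sets borel"
  shows "spectral_measure (Map.graph T) A (scale c x) = scale c (spectral_measure (Map.graph T) A x)"
proof -
  interpret selfadjoint_graph "Map.graph T" by (rule selfadjoint_graph[OF T])
  obtain E where E: "resolves E (Map.graph T)"
    "\<And>C C' A x. adjoint_pair C C' \<Longrightarrow> reduces C \<Longrightarrow> reduces C' \<Longrightarrow> A \<in> sets borel \<Longrightarrow>
       E A (C x) = C (E A x)"
    using spectral_theorem by blast
  have "spectral_resolution (Map.graph T) E"
    using E(1) by (intro spectral_resolution.intro selfadjoint_graph_axioms spectral_resolution_axioms.intro)
      (auto simp: resolves_def)
  then have eq: "spectral_measure (Map.graph T) A = E A"
    by (intro spectral_resolution_unique[OF spectral_resolution _ A])
  obtain c' :: 'k where "to_complex c' = cnj (to_complex c)" using ex_conjugate by blast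
  from E(2)[OF adjoint_pair_scale_op[OF this] reduces_scale_op[OF T] reduces_scale_op[OF T] A, of x]
  show ?thesis by (simp add: eq)
qed

lemma spectral_measure_proj:
  assumes "selfadjoint T" "A \<in> sets borel"
  shows "is_orth_proj ip (spectral_measure (Map.graph T) A)"
proof -
  interpret spectral_resolution "Map.graph T" "spectral_measure (Map.graph T)"
    by (rule selfadjoint_graph.spectral_resolution[OF selfadjoint_graph[OF assms(1)]])
  show ?thesis using assms by (simp add: is_orth_proj_ip_iff proj spectral_measure_scale)
qed

lemma scalar_measure_eq: "scalar_measure E x = vmeasure E x"
  by (simp add: scalar_measure_def vmeasure_def Re_ip)

lemma is_spectral_measure_imp:
  assumes T: "selfadjoint T" and E: "is_spectral_measure T E"
  shows "spectral_resolution (Map.graph T) E"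
proof (intro spectral_resolution.intro spectral_resolution_axioms.intro selfadjoint_graph[OF T])
  show pvm: "pvm E"
    using E unfolding is_spectral_measure_def projection_valued_measure_def is_orth_proj_ip_iff
    by (intro pvm.intro) blast+
  have "inner y x = (\<integral>t. t \<partial>vmeasure E x)" if "(x, y) \<in> Map.graph T" for x y
  proof -
    have "ip y x = of_real (\<integral>t. t \<partial>vmeasure E x)"
      using E that unfolding is_spectral_measure_def scalar_measure_eq graph_iff by force
    then show ?thesis by (metis Re_complex_of_real Re_ip to_complex_of_real)
  qed
  then show "resolves E (Map.graph T)"
    using E pvm unfolding resolves_def is_spectral_measure_def scalar_measure_eq dom_eq by auto
qed

lemma is_spectral_measure_spectral_measure:
  assumes T: "selfadjoint T"
  shows "is_spectral_measure T (spectral_measure (Map.graph T))"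
proof -
  interpret spectral_resolution "Map.graph T" "spectral_measure (Map.graph T)"
    by (rule selfadjoint_graph.spectral_resolution[OF selfadjoint_graph[OF T]])
  show ?thesis
    unfolding is_spectral_measure_def projection_valued_measure_def scalar_measure_eq
  proof (intro conjI ballI allI impI)
    show "dom T = {x. integrable (vmeasure (spectral_measure (Map.graph T)) x) power2}"
      using dom_iff by (auto simp: dom_eq)
    fix x assume "x \<in> dom T"
    then have x: "(x, the (T x)) \<in> Map.graph T" by (auto simp: graph_iff)
    \<comment> \<open>\<open>form\<close> controls only the real part of this product, so over
      complex scalars its value has to be shown real first.\<close>
    have "ip (the (T x)) x = ip x (the (T x))"
      using adjoint_eq_Some_iff[of T x "the (T x)"] T \<open>x \<in> dom T\<close> by (auto simp: selfadjoint_def)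
    then have "to_complex (ip (the (T x)) x) = cnj (to_complex (ip (the (T x)) x))" by (metis ip_commute)
    then have "to_complex (ip (the (T x)) x) \<in> \<real>" by (simp add: Reals_cnj_iff)
    then have "Im (to_complex (ip (the (T x)) x)) = 0" by (simp add: complex_is_Real_iff)
    then have "to_complex (ip (the (T x)) x) = of_real (inner (the (T x)) x)"
      by (simp add: complex_eq_iff Re_ip)
    then show "ip (the (T x)) x = of_real (\<integral>t. t \<partial>vmeasure (spectral_measure (Map.graph T)) x)"
      unfolding form[OF x] to_complex_of_real[symmetric, where 'a = 'k] to_complex_inject .
  qed (use T sums in \<open>auto simp: spectral_measure_proj E_UNIV\<close>)
qed

lemma spectral_proj_eq:
  assumes "selfadjoint T" "A \<in> sets borel"
  shows "spectral_proj A T = spectral_measure (Map.graph T) A"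
  unfolding spectral_proj_def
proof (rule the_equality)
  show "\<exists>E. is_spectral_measure T E \<and> spectral_measure (Map.graph T) A = E A"
    using is_spectral_measure_spectral_measure[OF assms(1)] by blast
  fix P assume "\<exists>E. is_spectral_measure T E \<and> P = E A"
  then show "P = spectral_measure (Map.graph T) A"
    using spectral_resolution_unique[OF is_spectral_measure_imp[OF assms(1)]
        selfadjoint_graph.spectral_resolution[OF selfadjoint_graph[OF assms(1)]] assms(2)] by blast
qed

lemma graph_proj_eq:
  assumes T: "selfadjoint T"
  shows "graph_proj T = selfadjoint_graph.graph_projection (Map.graph T)"
proof -
  interpret selfadjoint_graph "Map.graph T" by (rule selfadjoint_graph[OF T])
  interpret prod: hilbert_space "\<lambda>c (u :: 'a \<times> 'a). (scale c (fst u), scale c (snd u))" ip_prod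
    by (rule hilbert_space_prod)
  have "graph_projection (scale c (fst u), scale c (snd u))
      = (scale c (fst (graph_projection u)), scale c (snd (graph_projection u)))" for c u
  proof -
    obtain c' :: 'k where c': "to_complex c' = cnj (to_complex c)" using ex_conjugate by blast
    show ?thesis
    proof (rule orth_proj_commute[OF graph_projection(1), where C = "\<lambda>u. (scale c (fst u), scale c (snd u))"
            and C' = "\<lambda>u. (scale c' (fst u), scale c' (snd u))"])
      show "graph_projection (scale c (fst u), scale c (snd u)) = (scale c (fst u), scale c (snd u))"
        if "graph_projection u = u" for u c
        using that graph_scale[OF T, of "fst u" "snd u" c] by (simp add: graph_projection_fixed[symmetric])
      then show "graph_projection (scale c' (fst u), scale c' (snd u)) = (scale c' (fst u), scale c' (snd u))"
        if "graph_projection u = u" for u using that .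
    qed (simp_all add: inner_prod_def inner_scale_adjoint[OF c'] scale_right_distrib)
  qed
  then have P: "is_orth_proj ip_prod graph_projection"
    by (simp add: prod.is_orth_proj_ip_iff graph_projection(1))
  show ?thesis
    unfolding graph_proj_def
  proof (rule the_equality)
    show "is_orth_proj ip_prod graph_projection \<and> range (blinfun_apply graph_projection) = Map.graph T"
      using P graph_projection(2) by blast
    fix Q assume "is_orth_proj ip_prod Q \<and> range (blinfun_apply Q) = Map.graph T"
    then show "Q = graph_projection"
      by (intro orth_proj_unique) (auto simp: prod.is_orth_proj_ip_iff graph_projection)
  qed
qed

lemma gap_dist_eq: "selfadjoint T \<Longrightarrow> selfadjoint S \<Longrightarrow> gap_dist T S = gap (Map.graph T) (Map.graph S)"
  by (simp add: gap_dist_def gap_def graph_proj_eq)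

lemma shift_op_eq_Some_iff: "shift_op T (of_real c) x = Some z \<longleftrightarrow> (\<exists>w. T x = Some w \<and> z = w - c *\<^sub>R x)"
  by (auto simp: shift_op_def scale_of_real)

text \<open>An inverse bounded by \<open>norm R\<close> gives a lower bound. Conversely a lower
  bound alone suffices, since selfadjointness supplies surjectivity through
  \<open>shift_surjective\<close>.\<close>

lemma not_in_spectrum_iff:
  assumes T: "selfadjoint T"
  shows "of_real c \<notin> spectrum T \<longleftrightarrow> (\<exists>\<eta>>0. bounded_below (Map.graph T) c \<eta>)"
proof
  interpret selfadjoint_graph "Map.graph T" by (rule selfadjoint_graph[OF T])
  {
    assume "of_real c \<notin> spectrum T"
    then obtain R :: "'a \<Rightarrow>\<^sub>L 'a" where R: "\<And>x. x \<in> dom T \<Longrightarrow> R (the (shift_op T (of_real c) x)) = x"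
      by (auto simp: spectrum_def resolvent_set_def)
    show "\<exists>\<eta>>0. bounded_below (Map.graph T) c \<eta>"
    proof (intro exI[of _ "1 / (norm R + 1)"] conjI)
      have R1: "norm R + 1 > 0" by (simp add: add_nonneg_pos)
      then show "1 / (norm R + 1) > 0" by simp
      show "bounded_below (Map.graph T) c (1 / (norm R + 1))"
        unfolding bounded_below_def
      proof (intro ballI, clarify)
        fix x w assume "(x, w) \<in> Map.graph T"
        then have "T x = Some w" by (simp add: graph_iff)
        then have "R (w - c *\<^sub>R x) = x" using R[of x] by (auto simp: shift_op_def scale_of_real)
        then have "norm x \<le> norm R * norm (w - c *\<^sub>R x)" by (metis norm_blinfun)
        also have "\<dots> \<le> (norm R + 1) * norm (w - c *\<^sub>R x)" by (intro mult_right_mono) auto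
        finally show "1 / (norm R + 1) * norm x \<le> norm (w - c *\<^sub>R x)" using R1 by (simp add: field_simps)
      qed
    qed
  }
  assume "\<exists>\<eta>>0. bounded_below (Map.graph T) c \<eta>"
  then obtain \<eta> where \<eta>: "\<eta> > 0" "bounded_below (Map.graph T) c \<eta>" by blast
  have "\<exists>v w. (v, w) \<in> Map.graph T \<and> (0 :: 'a \<Rightarrow>\<^sub>L 'a) v = 0 \<and> w - c *\<^sub>R v = y" for y
  proof (rule shift_surjective[where Q = 0 and \<eta> = \<eta>, OF _ _ \<eta>(1)])
    show "orth_proj 0" by (rule orth_projI) simp_all
    show "reduces 0" by (simp add: reduces_def zero_mem case_prod_unfold)
  qed (use bounded_belowD[OF \<eta>(2)] in auto)
  then obtain v w where vw: "\<And>y. (v y, w y) \<in> Map.graph T" "\<And>y. w y - c *\<^sub>R v y = y" by metis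
  have uniq: "v (b - c *\<^sub>R a) = a" if "(a, b) \<in> Map.graph T" for a b
  proof -
    define y where "y = b - c *\<^sub>R a"
    have "\<eta> * norm (v y - a) \<le> norm ((w y - b) - c *\<^sub>R (v y - a))"
      by (rule bounded_belowD[OF \<eta>(2) diff_mem[OF vw(1) that]])
    also have "(w y - b) - c *\<^sub>R (v y - a) = (w y - c *\<^sub>R v y) - (b - c *\<^sub>R a)" by (simp add: algebra_simps)
    also have "\<dots> = 0" by (simp only: vw(2)) (simp add: y_def)
    finally show ?thesis using \<eta>(1) by (simp add: mult_le_0_iff y_def)
  qed
  have bl: "bounded_linear v"
  proof (rule bounded_linear_intro)
    fix x y r
    have "(w x + w y) - c *\<^sub>R (v x + v y) = (w x - c *\<^sub>R v x) + (w y - c *\<^sub>R v y)" by (simp add: algebra_simps)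
    then have "(w x + w y) - c *\<^sub>R (v x + v y) = x + y" by (simp only: vw(2))
    then show "v (x + y) = v x + v y" using uniq[OF add_mem[OF vw(1) vw(1)], of x y] by simp
    have "(r *\<^sub>R w x) - c *\<^sub>R (r *\<^sub>R v x) = r *\<^sub>R (w x - c *\<^sub>R v x)" by (simp add: algebra_simps)
    then have "(r *\<^sub>R w x) - c *\<^sub>R (r *\<^sub>R v x) = r *\<^sub>R x" by (simp only: vw(2))
    then show "v (r *\<^sub>R x) = r *\<^sub>R v x" using uniq[OF scale_mem[OF vw(1)], of r x] by simp
    have "\<eta> * norm (v x) \<le> norm x" using bounded_belowD[OF \<eta>(2) vw(1), of x] by (simp only: vw(2))
    then show "norm (v x) \<le> norm x * (1 / \<eta>)" using \<eta>(1) by (simp add: field_simps)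
  qed
  have "of_real c \<in> resolvent_set T"
    unfolding resolvent_set_def mem_Collect_eq
  proof (intro exI[of _ "Blinfun v"] conjI allI ballI)
    show "shift_op T (of_real c) (Blinfun v y) = Some y" for y
      using vw[of y] by (auto simp: bounded_linear_Blinfun_apply[OF bl] shift_op_eq_Some_iff graph_iff)
    show "Blinfun v (the (shift_op T (of_real c) x)) = x" if "x \<in> dom T" for x
      using that uniq[of x] by (auto simp: bounded_linear_Blinfun_apply[OF bl] shift_op_def scale_of_real graph_iff)
  qed
  then show "of_real c \<notin> spectrum T" by (simp add: spectrum_def)
qed

end

section \<open>Fredholm operators and spectral projections of finite rank\<close>

context hilbert_space
begin

text \<open>\<open>dim\<close> is a natural number and vanishes on infinite-dimensional spaces, so
  finiteness has to be tracked beside it.\<close>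

definition fin_dim :: "'a set \<Rightarrow> bool" where
  "fin_dim W \<longleftrightarrow> (\<exists>B. finite B \<and> W \<subseteq> span B)"

lemma fin_dim_subset: "fin_dim W \<Longrightarrow> V \<subseteq> W \<Longrightarrow> fin_dim V"
  unfolding fin_dim_def by blast

lemma fin_dim_finite_independent:
  assumes "fin_dim W" "B \<subseteq> W" "independent B" shows "finite B"
  using assms independent_span_bound unfolding fin_dim_def by blast

lemma fin_dim_independent_le_dim:
  assumes W: "fin_dim W" and B: "B \<subseteq> W" "independent B" shows "card B \<le> dim W"
proof -
  obtain A where A: "A \<subseteq> W" "independent A" "W \<subseteq> span A" "card A = dim W" by (rule basis_exists)
  then have "finite A" using fin_dim_finite_independent[OF W] by blast
  then show ?thesis using independent_span_bound[of A B] A B by auto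
qed

lemma fin_dim_dim_eq:
  assumes W: "fin_dim W" and V: "V \<subseteq> W" "subspace V" and eq: "dim W \<le> dim V" shows "V = W"
proof (rule ccontr)
  assume "V \<noteq> W"
  then obtain w where w: "w \<in> W" "w \<notin> V" using V by blast
  obtain A where A: "A \<subseteq> V" "independent A" "V \<subseteq> span A" "card A = dim V" by (rule basis_exists)
  have "span A \<subseteq> V" using A(1) V(2) by (rule span_minimal)
  then have "independent (insert w A)" using A(2) w(2) by (intro independent_insertI) auto
  then have "card (insert w A) \<le> dim W" using A(1) V(1) w(1) by (intro fin_dim_independent_le_dim[OF W]) auto
  moreover have "finite A" using A V(1) by (intro fin_dim_finite_independent[OF W]) auto
  moreover have "w \<notin> A" using A(1) w(2) by blast
  ultimately show False using A(4) eq by simp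
qed

lemma independent_Un:
  assumes "finite B" "independent A" "independent B" "span A \<inter> span B \<subseteq> {0}"
  shows "independent (A \<union> B)"
  using assms
proof (induction B)
  case (insert b B)
  have "span A \<inter> span B \<subseteq> {0}" using insert.prems(3) span_mono[of B "insert b B"] by blast
  moreover have "independent B" using insert.prems(2) by (rule independent_mono) blast
  ultimately have ind: "independent (A \<union> B)" using insert by blast
  have "b \<notin> span B" using insert.prems(2) insert.hyps(2) by (simp add: independent_insert)
  have "b \<notin> span (A \<union> B)"
  proof
    assume "b \<in> span (A \<union> B)"
    then obtain x y where xy: "b = x + y" "x \<in> span A" "y \<in> span B" by (auto simp: span_Un)
    have "y \<in> span (insert b B)" using xy(3) span_mono[of B "insert b B"] by blast
    then have "b - y \<in> span (insert b B)" by (rule span_diff[rotated]) (simp add: span_base)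
    then have "x \<in> span (insert b B)" using xy(1) by simp
    then have "x = 0" using xy(2) insert.prems(3) by blast
    then show False using xy \<open>b \<notin> span B\<close> by simp
  qed
  then show ?case using ind by (simp add: independent_insertI)
qed simp

lemma dim_direct_sum:
  assumes V: "subspace V" "fin_dim V" and W: "subspace W" "fin_dim W" and VW: "V \<inter> W \<subseteq> {0}"
  shows "dim {x + y |x y. x \<in> V \<and> y \<in> W} = dim V + dim W"
proof -
  obtain A where A: "A \<subseteq> V" "independent A" "V \<subseteq> span A" "card A = dim V" by (rule basis_exists)
  obtain B where B: "B \<subseteq> W" "independent B" "W \<subseteq> span B" "card B = dim W" by (rule basis_exists)
  have span: "span A = V" "span B = W"
    using A(3) B(3) span_minimal[OF A(1) V(1)] span_minimal[OF B(1) W(1)] by blast+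
  have fin: "finite A" "finite B" using A B V W fin_dim_finite_independent by blast+
  have ind: "independent (A \<union> B)" by (rule independent_Un) (use fin A B VW span in auto)
  have "A \<inter> B = {}" using A B VW dependent_zero by blast
  then have "card (A \<union> B) = dim V + dim W" using fin A B by (simp add: card_Un_disjoint)
  moreover have "span (A \<union> B) = {x + y |x y. x \<in> V \<and> y \<in> W}" by (simp add: span_Un span)
  ultimately show ?thesis using dim_span_eq_card_independent[OF ind] by simp
qed

text \<open>A vector with \<open>P x = x\<close> and \<open>Q x = 0\<close> satisfies (P - Q) x = x
  and is therefore 0, so \<open>Q\<close> is injective on the range of \<open>P\<close>.\<close>

lemma dim_range_le_of_close:
  fixes P Q :: "'a \<Rightarrow>\<^sub>L 'a"
  assumes P: "is_orth_proj ip P" and Q: "is_orth_proj ip Q" and close: "norm (P - Q) < 1"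
    and fin: "fin_dim (range (blinfun_apply Q))"
  shows "fin_dim (range (blinfun_apply P))" "dim (range (blinfun_apply P)) \<le> dim (range (blinfun_apply Q))"
proof -
  have inj: "x = 0" if "P x = x" "Q x = 0" for x
  proof -
    have "norm x = norm ((P - Q) x)" using that by (simp add: blinfun.bilinear_simps)
    also have "\<dots> \<le> norm (P - Q) * norm x" by (rule norm_blinfun)
    finally have "(1 - norm (P - Q)) * norm x \<le> 0" by (simp add: algebra_simps)
    then show ?thesis using close by (simp add: mult_le_0_iff)
  qed
  have linQ: "Vector_Spaces.linear scale scale (blinfun_apply Q)"
    using Q by (intro Vector_Spaces.linear.intro module_hom.intro module_hom_axioms.intro vector_space_axioms module_axioms)
      (auto simp: is_orth_proj_ip_iff blinfun.bilinear_simps)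
  have subP: "subspace (range (blinfun_apply P))" by (rule range_subspace[OF P])
  have bound: "finite B \<and> card B \<le> dim (range (blinfun_apply Q))"
    if B: "B \<subseteq> range (blinfun_apply P)" "independent B" for B
  proof -
    have spanB: "span B \<subseteq> range (blinfun_apply P)" using B(1) subP by (rule span_minimal)
    have injB: "inj_on (blinfun_apply Q) (span B)"
    proof (rule inj_onI)
      fix x y assume xy: "x \<in> span B" "y \<in> span B" "Q x = Q y"
      then have "x - y \<in> range (blinfun_apply P)" using spanB span_diff by blast
      then have "P (x - y) = x - y" using P orth_proj_range is_orth_proj_ip_iff by blast
      moreover have "Q (x - y) = 0" using xy(3) by (simp add: blinfun.bilinear_simps)
      ultimately show "x = y" using inj by fastforce
    qed
    have ind: "independent (blinfun_apply Q ` B)"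
      by (rule module_hom.independent_injective_image[OF _ B(2) injB])
        (use linQ in \<open>simp add: module_hom_iff_linear\<close>)
    have im: "blinfun_apply Q ` B \<subseteq> range (blinfun_apply Q)" by (rule image_mono) simp
    note fin_dim_finite_independent[OF fin im ind] fin_dim_independent_le_dim[OF fin im ind]
    moreover have injB': "inj_on (blinfun_apply Q) B" using injB by (rule inj_on_subset) (simp add: span_superset)
    ultimately show ?thesis using finite_imageD[OF _ injB'] by (simp add: card_image)
  qed
  obtain B where B: "B \<subseteq> range (blinfun_apply P)" "independent B" "range (blinfun_apply P) \<subseteq> span B"
    "card B = dim (range (blinfun_apply P))"
    by (rule basis_exists)
  then show "fin_dim (range (blinfun_apply P))" "dim (range (blinfun_apply P)) \<le> dim (range (blinfun_apply Q))"
    using bound[of B] unfolding fin_dim_def by auto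
qed

text \<open>Each \<open>f\<close> in \<open>F\<close> defines one linear functional, whose kernel in
  \<open>W\<close> has codimension at most 1.\<close>

lemma fin_dim_of_trivial_annihilator:
  assumes "finite F" "subspace W" "\<And>w. w \<in> W \<Longrightarrow> (\<And>f. f \<in> F \<Longrightarrow> ip w f = 0) \<Longrightarrow> w = 0"
  shows "fin_dim W"
  using assms
proof (induction F arbitrary: W)
  case empty
  then have "W \<subseteq> span {}" by auto
  then show ?case unfolding fin_dim_def by blast
next
  case (insert f F)
  define W' where "W' = {w \<in> W. ip w f = 0}"
  have "subspace W'"
    using insert.prems(1) by (auto simp: W'_def subspace_def ip_add_left ip_scale_left)
  then have "fin_dim W'" by (rule insert.IH) (use insert.prems(2) in \<open>auto simp: W'_def\<close>)
  then obtain B where B: "finite B" "W' \<subseteq> span B" by (auto simp: fin_dim_def)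
  show ?case
  proof (cases "W' = W")
    case True then show ?thesis using B by (auto simp: fin_dim_def)
  next
    case False
    then obtain w where w: "w \<in> W" "ip w f \<noteq> 0" by (auto simp: W'_def)
    have "x \<in> span (insert w B)" if x: "x \<in> W" for x
    proof -
      define a where "a = ip x f / ip w f"
      have "ip (x - scale a w) f = ip x f - a * ip w f"
        using ip_add_left[of "x - scale a w" "scale a w" f] by (simp add: ip_scale_left algebra_simps)
      then have "x - scale a w \<in> W'"
        using x w insert.prems(1) by (simp add: W'_def a_def subspace_diff subspace_scale)
      then have "x - scale a w \<in> span (insert w B)" using B(2) span_mono[of B "insert w B"] by blast
      moreover have "scale a w \<in> span (insert w B)" by (intro span_scale span_base) simp
      ultimately have "(x - scale a w) + scale a w \<in> span (insert w B)" by (rule span_add)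
      then show ?thesis by simp
    qed
    then show ?thesis unfolding fin_dim_def using B(1) by (intro exI[of _ "insert w B"]) auto
  qed
qed

abbreviation specm :: "('a \<rightharpoonup> 'a) \<Rightarrow> real set \<Rightarrow> 'a \<Rightarrow>\<^sub>L 'a" where
  "specm T \<equiv> spectral_measure (Map.graph T)"

abbreviation specran :: "('a \<rightharpoonup> 'a) \<Rightarrow> real set \<Rightarrow> 'a set" where
  "specran T A \<equiv> range (blinfun_apply (specm T A))"

lemma spectral_resolution_specm: "selfadjoint T \<Longrightarrow> spectral_resolution (Map.graph T) (specm T)"
  by (rule selfadjoint_graph.spectral_resolution[OF selfadjoint_graph])

lemma range_specm_subspace: "selfadjoint T \<Longrightarrow> A \<in> sets borel \<Longrightarrow> subspace (specran T A)"
  by (intro range_subspace spectral_measure_proj)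

lemma range_specm_mono:
  assumes "selfadjoint T" "A \<in> sets borel" "B \<in> sets borel" "A \<subseteq> B"
  shows "specran T A \<subseteq> specran T B"
proof -
  interpret spectral_resolution "Map.graph T" "specm T" by (rule spectral_resolution_specm[OF assms(1)])
  show ?thesis using mono[OF assms(2-4)] assms orth_proj_range[OF proj] by blast
qed

lemma range_specm_union:
  assumes "selfadjoint T" "A \<in> sets borel" "B \<in> sets borel" "A \<inter> B = {}"
  shows "specran T (A \<union> B)
    = {x + y |x y. x \<in> specran T A \<and> y \<in> specran T B}"
proof -
  interpret spectral_resolution "Map.graph T" "specm T" by (rule spectral_resolution_specm[OF assms(1)])
  have AB: "A \<union> B \<in> sets borel" using assms by auto
  show ?thesis
  proof (intro set_eqI iffI)
    fix z assume "z \<in> {x + y |x y. x \<in> specran T A \<and> y \<in> specran T B}"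
    then obtain x y where "z = x + y" "specm T A x = x" "specm T B y = y"
      using assms orth_proj_range[OF proj] by auto
    moreover have "specm T (A \<union> B) x = x" "specm T (A \<union> B) y = y"
      using assms AB mono[of A "A \<union> B" x] mono[of B "A \<union> B" y] calculation by auto
    ultimately show "z \<in> specran T (A \<union> B)"
      by (metis blinfun.add_right rangeI)
  next
    fix z assume "z \<in> specran T (A \<union> B)"
    then obtain z' where "z = specm T (A \<union> B) z'" by auto
    then show "z \<in> {x + y |x y. x \<in> specran T A \<and> y \<in> specran T B}"
      using union[OF assms(2-4)] by auto
  qed
qed

lemma fin_dim_range_specm_union:
  assumes "selfadjoint T" "A \<in> sets borel" "B \<in> sets borel" "A \<inter> B = {}"
    and "fin_dim (specran T A)" "fin_dim (specran T B)"
  shows "fin_dim (specran T (A \<union> B))"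
proof -
  obtain X Y where "finite X" "specran T A \<subseteq> span X"
    "finite Y" "specran T B \<subseteq> span Y"
    using assms(5,6) by (auto simp: fin_dim_def)
  then have "finite (X \<union> Y)" "specran T (A \<union> B) \<subseteq> span (X \<union> Y)"
    unfolding range_specm_union[OF assms(1-4)] span_Un by blast+
  then show ?thesis unfolding fin_dim_def by blast
qed

lemma dim_range_specm_union:
  assumes "selfadjoint T" "A \<in> sets borel" "B \<in> sets borel" "A \<inter> B = {}"
    and "fin_dim (specran T A)" "fin_dim (specran T B)"
  shows "dim (specran T (A \<union> B))
    = dim (specran T A) + dim (specran T B)"
  unfolding range_specm_union[OF assms(1-4)]
proof (rule dim_direct_sum)
  interpret spectral_resolution "Map.graph T" "specm T" by (rule spectral_resolution_specm[OF assms(1)])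
  show "specran T A \<inter> specran T B \<subseteq> {0}"
  proof
    fix x assume "x \<in> specran T A \<inter> specran T B"
    then have "specm T A x = x" "specm T B x = x" using assms orth_proj_range[OF proj] by blast+
    then show "x \<in> {0}" using disjoint[OF assms(2-4), of x] by simp
  qed
qed (use assms range_specm_subspace in auto)

text \<open>If \<open>T - c\<close> has finite codimensional image, complemented by the span of \<open>F\<close>, then the vectors
  \<open>z\<close> orthogonal to \<open>F\<close> with \<open>\<parallel>(T - c) z\<parallel> \<le> 1\<close> are pointwise bounded as functionals, since
  \<open>\<langle>z, (T - c) v + f\<rangle> = \<langle>(T - c) z, v\<rangle>\<close>.  So \<open>T - c\<close> is bounded below on the complement of \<open>F\<close>, and
  closedness of the image is not needed.\<close>

lemma fredholm_imp_fin_dim: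
  assumes T: "selfadjoint T" and fred: "fredholm (shift_op T (of_real c))"
  obtains \<epsilon> where "\<epsilon> > 0" "fin_dim (specran T {c - \<epsilon>..c + \<epsilon>})"
proof -
  interpret spectral_resolution "Map.graph T" "specm T" by (rule spectral_resolution_specm[OF T])
  obtain F where F: "finite F" "span (ran (shift_op T (of_real c)) \<union> F) = UNIV"
    using fred by (auto simp: fredholm_def)
  have ran: "ran (shift_op T (of_real c)) = {w - c *\<^sub>R v |v w. (v, w) \<in> Map.graph T}"
    by (auto simp: ran_def shift_op_eq_Some_iff graph_iff)
  have sub: "subspace {w - c *\<^sub>R v |v w. (v, w) \<in> Map.graph T}"
    unfolding subspace_def
  proof (intro conjI ballI allI)
    show "0 \<in> {w - c *\<^sub>R v |v w. (v, w) \<in> Map.graph T}"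
      unfolding mem_Collect_eq using zero_mem by (intro exI[of _ 0]) simp
  next
    fix x y assume "x \<in> {w - c *\<^sub>R v |v w. (v, w) \<in> Map.graph T}" "y \<in> {w - c *\<^sub>R v |v w. (v, w) \<in> Map.graph T}"
    then obtain v w v' w' where vw: "x = w - c *\<^sub>R v" "(v, w) \<in> Map.graph T" "y = w' - c *\<^sub>R v'" "(v', w') \<in> Map.graph T" by blast
    have "x + y = (w + w') - c *\<^sub>R (v + v')"
      unfolding vw(1,3) by (simp only: scaleR_right_distrib add_diff_add)
    with add_mem[OF vw(2,4)] show "x + y \<in> {w - c *\<^sub>R v |v w. (v, w) \<in> Map.graph T}" by blast
  next
    fix k x assume "x \<in> {w - c *\<^sub>R v |v w. (v, w) \<in> Map.graph T}"
    then obtain v w where vw: "x = w - c *\<^sub>R v" "(v, w) \<in> Map.graph T" by blast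
    show "scale k x \<in> {w - c *\<^sub>R v |v w. (v, w) \<in> Map.graph T}"
      unfolding mem_Collect_eq using graph_scale[OF T vw(2), of k] vw(1)
      by - (rule exI[of _ "scale k v"], rule exI[of _ "scale k w"], simp add: scale_right_diff_distrib scale_scaleR)
  qed
  have decomp: "\<exists>v w f. (v, w) \<in> Map.graph T \<and> f \<in> span F \<and> y = (w - c *\<^sub>R v) + f" for y
  proof -
    have "y \<in> span ({w - c *\<^sub>R v |v w. (v, w) \<in> Map.graph T} \<union> F)" using F(2) ran by simp
    then obtain a f where y: "y = a + f" "a \<in> span {w - c *\<^sub>R v |v w. (v, w) \<in> Map.graph T}" "f \<in> span F"
      unfolding span_Un by blast
    have "span {w - c *\<^sub>R v |v w. (v, w) \<in> Map.graph T} = {w - c *\<^sub>R v |v w. (v, w) \<in> Map.graph T}"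
      using sub by (simp only: span_eq_iff)
    then have "a \<in> {w - c *\<^sub>R v |v w. (v, w) \<in> Map.graph T}" using y(2) by (simp only:)
    then obtain v w where "a = w - c *\<^sub>R v" "(v, w) \<in> Map.graph T" by blast
    then show ?thesis using y(1,3) by blast
  qed
  define Z where "Z = {z. (\<forall>f\<in>F. ip z f = 0) \<and> (\<exists>w. (z, w) \<in> Map.graph T \<and> norm (w - c *\<^sub>R z) \<le> 1)}"
  have orth: "inner z f = 0" if "\<forall>f\<in>F. ip z f = 0" "f \<in> span F" for z f
  proof -
    have "subspace {f. ip z f = 0}"
      unfolding subspace_def
    proof (intro conjI ballI allI)
      fix k :: 'k and x assume x: "x \<in> {f. ip z f = 0}"
      obtain k' :: 'k where "to_complex k' = cnj (to_complex k)" using ex_conjugate by blast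
      then have "to_complex k = cnj (to_complex k')" by simp
      then have "ip z (scale k x) = ip (scale k' z) x" by (rule ip_scale_adjoint[symmetric])
      then show "scale k x \<in> {f. ip z f = 0}" using x by (simp add: ip_scale_left)
    qed (auto simp: ip_add_right)
    then have "span F \<subseteq> {f. ip z f = 0}" using that(1) by (intro span_minimal) auto
    then have "ip z f = 0" using that(2) by blast
    then show ?thesis by (simp add: Re_ip[symmetric])
  qed
  have "\<exists>K. \<forall>z\<in>Z. \<bar>inner z y\<bar> \<le> K" for y
  proof -
    obtain v w f where y: "(v, w) \<in> Map.graph T" "f \<in> span F" "y = (w - c *\<^sub>R v) + f" using decomp by blast
    have "\<bar>inner z y\<bar> \<le> norm v" if z: "z \<in> Z" for z
    proof -
      obtain w' where w': "(z, w') \<in> Map.graph T" "norm (w' - c *\<^sub>R z) \<le> 1" "\<forall>f\<in>F. ip z f = 0"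
        using z by (auto simp: Z_def)
      have "inner z y = inner (w' - c *\<^sub>R z) v"
        using symm[OF w'(1) y(1)] orth[OF w'(3) y(2)] by (simp add: y(3) inner_add_right inner_diff)
      also have "\<bar>\<dots>\<bar> \<le> norm (w' - c *\<^sub>R z) * norm v" by (rule Cauchy_Schwarz_ineq2)
      also have "\<dots> \<le> 1 * norm v" by (intro mult_right_mono w') simp
      finally show ?thesis by simp
    qed
    then show ?thesis by blast
  qed
  then obtain C where C: "\<And>z. z \<in> Z \<Longrightarrow> norm z \<le> C" using pointwise_bounded_functionals by blast
  define \<epsilon> where "\<epsilon> = 1 / (\<bar>C\<bar> + 1)"
  have \<epsilon>: "\<epsilon> > 0" by (simp add: \<epsilon>_def add_nonneg_pos)
  have "fin_dim (specran T {c - \<epsilon>..c + \<epsilon>})"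
  proof (rule fin_dim_of_trivial_annihilator[OF F(1)])
    show "subspace (specran T {c - \<epsilon>..c + \<epsilon>})" using T by (intro range_specm_subspace) auto
    fix x assume x: "x \<in> specran T {c - \<epsilon>..c + \<epsilon>}" and xF: "\<And>f. f \<in> F \<Longrightarrow> ip x f = 0"
    have "specm T {c - \<epsilon>..c + \<epsilon>} x = x" using x orth_proj_range[OF proj] by auto
    then obtain w where w: "(x, w) \<in> Map.graph T" "norm (w - c *\<^sub>R x) \<le> \<epsilon> * norm x" by (rule inside_interval)
    show "x = 0"
    proof (rule ccontr)
      assume "x \<noteq> 0"
      \<comment> \<open>Scales \<open>x\<close> to norm 1/\<epsilon> = |C| + 1, beyond the bound for
        \<open>Z\<close>, while its image under T - c has norm at most 1.\<close>
      define r where "r = 1 / (\<epsilon> * norm x)"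
      have r: "r > 0" using \<epsilon> \<open>x \<noteq> 0\<close> by (simp add: r_def)
      have "r *\<^sub>R x \<in> Z"
        unfolding Z_def mem_Collect_eq
      proof (intro conjI ballI exI)
        show "ip (r *\<^sub>R x) f = 0" if "f \<in> F" for f
          using xF[OF that] by (simp add: scale_of_real[symmetric] ip_scale_left)
        show "(r *\<^sub>R x, r *\<^sub>R w) \<in> Map.graph T" by (rule scale_mem[OF w(1)])
        have "r *\<^sub>R w - c *\<^sub>R (r *\<^sub>R x) = r *\<^sub>R (w - c *\<^sub>R x)" by (simp add: algebra_simps)
        then have "norm (r *\<^sub>R w - c *\<^sub>R (r *\<^sub>R x)) = r * norm (w - c *\<^sub>R x)"
          using r by simp
        also have "\<dots> \<le> r * (\<epsilon> * norm x)" using r w(2) by (intro mult_left_mono) auto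
        also have "\<dots> = 1" using \<epsilon> \<open>x \<noteq> 0\<close> by (simp add: r_def)
        finally show "norm (r *\<^sub>R w - c *\<^sub>R (r *\<^sub>R x)) \<le> 1" .
      qed
      then have "norm (r *\<^sub>R x) \<le> C" by (rule C)
      moreover have "norm (r *\<^sub>R x) = \<bar>C\<bar> + 1" using r \<open>x \<noteq> 0\<close> \<epsilon> by (simp add: r_def \<epsilon>_def)
      ultimately show False by simp
    qed
  qed
  then show ?thesis using that \<epsilon> by blast
qed

text \<open>Compactness of [a, b]: \<open>fredholm_imp_fin_dim\<close> settles short intervals
  around each point, and adjacent intervals are joined after making the right one half-open, so that
  the union is disjoint.\<close>

lemma fin_dim_of_fredholm_interval:
  assumes T: "selfadjoint T" and ab: "a \<le> b"
    and fred: "\<And>c. a \<le> c \<Longrightarrow> c \<le> b \<Longrightarrow> fredholm (shift_op T (of_real c))"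
  shows "fin_dim (specran T {a..b})"
  using ab
proof (induction a b rule: Bolzano)
  case (trans u v w)
  have "fin_dim (specran T {v<..w})"
    by (rule fin_dim_subset[OF trans(2)], rule range_specm_mono[OF T]) auto
  then have "fin_dim (specran T ({u..v} \<union> {v<..w}))"
    using trans T by (intro fin_dim_range_specm_union) auto
  moreover have "{u..v} \<union> {v<..w} = {u..w}" using trans by auto
  ultimately show ?case by simp
next
  case (local c)
  then obtain \<epsilon> where \<epsilon>: "\<epsilon> > 0" "fin_dim (specran T {c - \<epsilon>..c + \<epsilon>})"
    using fredholm_imp_fin_dim[OF T fred[of c]] by blast
  show ?case
  proof (intro exI[of _ \<epsilon>] conjI allI impI \<epsilon>(1))
    fix u v assume "u \<le> c \<and> c \<le> v \<and> v - u < \<epsilon>"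
    then show "fin_dim (specran T {u..v})"
      by (intro fin_dim_subset[OF \<epsilon>(2)] range_specm_mono[OF T]) auto
  qed
qed

text \<open>With \<open>P\<close> the projection for [-a, a], the kernel of T - c lies in the
  finite-dimensional range of \<open>P\<close>, and T - c maps the kernel of \<open>P\<close> onto
  itself. The lower bound there comes from enlarging the interval by \<epsilon>: |T v| >= (a +
  \<epsilon>) |v| while |c| <= a.\<close>

lemma fredholm_of_fin_dim:
  assumes T: "selfadjoint T" and a: "a > 0" and "\<eta> > 0"
    and below: "bounded_below (Map.graph T) a \<eta>" "bounded_below (Map.graph T) (- a) \<eta>"
    and fin: "fin_dim (specran T {- a..a})" and c: "\<bar>c\<bar> \<le> a"
  shows "fredholm (shift_op T (of_real c))"
proof -
  interpret spectral_resolution "Map.graph T" "specm T" by (rule spectral_resolution_specm[OF T])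
  define P where "P = specm T {- a..a}"
  have oP: "orth_proj P" by (simp add: P_def proj)
  define \<epsilon> where "\<epsilon> = min (\<eta>/2) a"
  have \<epsilon>: "\<epsilon> > 0" "\<epsilon> < \<eta>" "\<epsilon> \<le> a" using a \<open>\<eta> > 0\<close> by (auto simp: \<epsilon>_def)
  have P_eq: "P = specm T {0 - (a + \<epsilon>)..0 + (a + \<epsilon>)}"
    using spectral_measure_shrink_enlarge(2)[OF spectral_resolution_axioms below(2,1), of \<epsilon>] \<epsilon>
    by (simp add: P_def)
  have out: "\<epsilon> * norm v \<le> norm (w - c *\<^sub>R v)" if "(v, w) \<in> Map.graph T" "P v = 0" for v w
  proof -
    have "(a + \<epsilon>) * norm v \<le> norm (w - 0 *\<^sub>R v)"
      by (rule outside_interval[OF that(1)]) (use that(2) a \<epsilon> in \<open>auto simp: P_eq\<close>)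
    moreover have "norm w \<le> norm (w - c *\<^sub>R v) + norm (c *\<^sub>R v)"
      using norm_triangle_ineq[of "w - c *\<^sub>R v" "c *\<^sub>R v"] by simp
    moreover have "norm (c *\<^sub>R v) \<le> a * norm v" using c by (simp add: mult_right_mono)
    ultimately show ?thesis by (simp add: algebra_simps)
  qed
  obtain B where B: "finite B" "range (blinfun_apply P) \<subseteq> span B" using fin by (auto simp: fin_dim_def P_def)
  have red: "reduces P" unfolding P_def by (rule E_reduces) simp
  show ?thesis
    unfolding fredholm_def
  proof
    define N where "N = {x. shift_op T (of_real c) x = Some 0}"
    have N: "x \<in> N \<longleftrightarrow> (x, c *\<^sub>R x) \<in> Map.graph T" for x
      by (auto simp: N_def shift_op_eq_Some_iff graph_iff)
    have subN: "subspace N"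
      unfolding subspace_def using zero_mem add_mem graph_scale[OF T]
      by (auto simp: N scaleR_right_distrib scale_scaleR[symmetric])
    have "N \<subseteq> range (blinfun_apply P)"
    proof
      fix x assume "x \<in> N"
      then have "(x, c *\<^sub>R x) \<in> Map.graph T" using N by blast
      then have "(x - P x, c *\<^sub>R x - P (c *\<^sub>R x)) \<in> Map.graph T" by (intro diff_mem reducesD[OF red])
      then have 1: "(x - P x, c *\<^sub>R (x - P x)) \<in> Map.graph T" by (simp add: blinfun.bilinear_simps scaleR_right_diff_distrib)
      have "P (x - P x) = 0" by (simp add: blinfun.bilinear_simps orth_proj_idem[OF oP])
      from out[OF 1 this] have "x - P x = 0" using \<epsilon> by (simp add: mult_le_0_iff)
      then have "x = P x" by simp
      then show "x \<in> range (blinfun_apply P)" by (metis rangeI)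
    qed
    then have finN: "fin_dim N" by (rule fin_dim_subset[OF fin[folded P_def]])
    obtain A where A: "A \<subseteq> N" "independent A" "N \<subseteq> span A" by (rule basis_exists)
    have "finite A" using fin_dim_finite_independent[OF finN A(1,2)] .
    moreover have "span A = N" using A(3) span_minimal[OF A(1) subN] by blast
    ultimately show "\<exists>F. finite F \<and> span F = {x. shift_op T (of_real c) x = Some 0}" unfolding N_def by blast
    show "\<exists>F. finite F \<and> span (ran (shift_op T (of_real c)) \<union> F) = UNIV"
    proof (intro exI[of _ B] conjI B(1))
      have "y \<in> span (ran (shift_op T (of_real c)) \<union> B)" for y
      proof -
        have "P (y - P y) = 0" by (simp add: blinfun.bilinear_simps orth_proj_idem[OF oP])
        then obtain v w where vw: "(v, w) \<in> Map.graph T" "w - c *\<^sub>R v = y - P y"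
          using shift_surjective[OF oP red \<epsilon>(1), of c "y - P y"] out by blast
        have "shift_op T (of_real c) v = Some (y - P y)"
          using vw by (auto simp: shift_op_eq_Some_iff graph_iff)
        then have "y - P y \<in> ran (shift_op T (of_real c))" by (rule ranI)
        then have 1: "y - P y \<in> span (ran (shift_op T (of_real c)) \<union> B)" by (intro span_base) simp
        have "P y \<in> span B" using B(2) by blast
        then have "P y \<in> span (ran (shift_op T (of_real c)) \<union> B)" by (rule subsetD[OF span_mono, rotated]) simp
        from span_add[OF 1 this] show ?thesis by simp
      qed
      then show "span (ran (shift_op T (of_real c)) \<union> B) = UNIV" by blast
    qed
  qed
qed

definition admissible :: "real \<Rightarrow> ('a \<rightharpoonup> 'a) \<Rightarrow> bool" where
  "admissible a T \<longleftrightarrow> 0 < a \<and> of_real a \<notin> spectrum T \<and> of_real (- a) \<notin> spectrum T \<and>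
     of_real ` {- a..a} \<inter> ess_spectrum T = {}"

text \<open>The right-hand side speaks only of lower bounds at two points and of the rank of one
  projection, all of which persist under small gaps.\<close>

lemma admissible_iff:
  assumes T: "selfadjoint T"
  shows "admissible a T \<longleftrightarrow> 0 < a \<and>
    (\<exists>\<eta>>0. bounded_below (Map.graph T) a \<eta> \<and> bounded_below (Map.graph T) (- a) \<eta>) \<and>
    fin_dim (specran T {- a..a})" (is "_ \<longleftrightarrow> ?R")
proof
  assume adm: "admissible a T"
  obtain \<eta>1 \<eta>2 where \<eta>: "\<eta>1 > 0" "bounded_below (Map.graph T) a \<eta>1" "\<eta>2 > 0" "bounded_below (Map.graph T) (- a) \<eta>2"
    using adm not_in_spectrum_iff[OF T, of a] not_in_spectrum_iff[OF T, of "- a"]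
    unfolding admissible_def by blast
  then have "\<exists>\<eta>>0. bounded_below (Map.graph T) a \<eta> \<and> bounded_below (Map.graph T) (- a) \<eta>"
    by (intro exI[of _ "min \<eta>1 \<eta>2"]) (auto intro: bounded_below_weaken)
  moreover have "fredholm (shift_op T (of_real c))" if "- a \<le> c" "c \<le> a" for c
  proof -
    have "of_real c \<in> (of_real :: real \<Rightarrow> 'k) ` {- a..a}" using that by auto
    then show ?thesis using adm by (auto simp: admissible_def ess_spectrum_def)
  qed
  then have "fin_dim (specran T {- a..a})"
    using adm by (intro fin_dim_of_fredholm_interval[OF T]) (auto simp: admissible_def)
  ultimately show ?R using adm by (simp add: admissible_def)
next
  assume R: ?R
  then obtain \<eta> where \<eta>: "\<eta> > 0" "bounded_below (Map.graph T) a \<eta>" "bounded_below (Map.graph T) (- a) \<eta>" by blast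
  have "fredholm (shift_op T (of_real c))" if "- a \<le> c" "c \<le> a" for c
    by (rule fredholm_of_fin_dim[OF T _ \<eta>]) (use R that in auto)
  then have "of_real ` {- a..a} \<inter> ess_spectrum T = {}" by (auto simp: ess_spectrum_def)
  moreover have "of_real a \<notin> spectrum T" "of_real (- a) \<notin> spectrum T"
    using \<eta> not_in_spectrum_iff[OF T] by blast+
  ultimately show "admissible a T" using R by (simp add: admissible_def)
qed

lemma ex_admissible:
  assumes "T \<in> CFsa" shows "\<exists>a. admissible a T"
proof -
  have T: "selfadjoint T" and "fredholm T" using assms CFsa_selfadjoint by (auto simp: CFsa_def)
  interpret spectral_resolution "Map.graph T" "specm T" by (rule spectral_resolution_specm[OF T])
  have "shift_op T (of_real 0) = T"
    by (auto simp: shift_op_def fun_eq_iff option.map_ident)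
  then have "fredholm (shift_op T (of_real 0))" using \<open>fredholm T\<close> by simp
  then obtain \<epsilon> where \<epsilon>: "\<epsilon> > 0" "fin_dim (specran T {0 - \<epsilon>..0 + \<epsilon>})"
    by (rule fredholm_imp_fin_dim[OF T])
  have fin: "fin_dim (specran T {- a..a})" if "a \<le> \<epsilon>" for a
    by (rule fin_dim_subset[OF \<epsilon>(2)], rule range_specm_mono[OF T]) (use that in auto)
  text \<open>Below an \<open>a\<close> for which the rank of the projection is minimal there is no spectrum nearby.\<close>
  define D where "D = (\<lambda>a. dim (specran T {- a..a})) ` {0<..\<epsilon>}"
  have "D \<noteq> {}" using \<epsilon> by (auto simp: D_def)
  then have "(LEAST n. n \<in> D) \<in> D" by (meson LeastI ex_in_conv)
  then obtain a0 where a0: "0 < a0" "a0 \<le> \<epsilon>" "dim (specran T {- a0..a0}) = (LEAST n. n \<in> D)"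
    by (auto simp: D_def)
  have least: "dim (specran T {- a0..a0}) \<le> dim (specran T {- b..b})"
    if "0 < b" "b \<le> a0" for b
    unfolding a0(3) by (rule Least_le) (use that a0 in \<open>auto simp: D_def\<close>)
  \<comment> \<open>No spectral measure is left between a0/4 and a0 on either side; the points a0/2
    and -a0/2 sit there with a margin of a0/8.\<close>
  define b where "b = a0 / 4"
  have "specran T {- b..b} = specran T {- a0..a0}"
    using a0 by (intro fin_dim_dim_eq fin least range_specm_mono range_specm_subspace T) (auto simp: b_def)
  then have null: "specm T ({- a0..a0} - {- b..b}) = 0"
  proof -
    assume eq: "specran T {- b..b} = specran T {- a0..a0}"
    have "specm T ({- a0..a0} - {- b..b}) x = 0" for x
    proof -
      define y where "y = specm T ({- a0..a0} - {- b..b}) x"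
      have "specm T ({- a0..a0} - {- b..b}) y = y" by (simp add: y_def orth_proj_idem proj)
      then have "specm T {- a0..a0} y = y" by (rule mono[rotated 3]) auto
      then have "specm T {- b..b} y = y" using eq by (metis atLeastAtMost_borel orth_proj_range proj)
      moreover have "specm T {- b..b} y = 0" unfolding y_def by (rule disjoint) auto
      ultimately show ?thesis by (simp add: y_def)
    qed
    then show ?thesis by (intro blinfun_eqI) simp
  qed
  have below: "bounded_below (Map.graph T) c (a0 / 8)" if c: "\<bar>c\<bar> = a0 / 2" for c
    unfolding bounded_below_def
  proof (intro ballI, clarify)
    fix x w assume xw: "(x, w) \<in> Map.graph T"
    have "c = a0 / 2 \<or> c = - (a0 / 2)" using c by linarith
    then have "{c - a0/8..c + a0/8} \<subseteq> {- a0..a0} - {- b..b}" using a0 by (auto simp: b_def)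
    then have "specm T {c - a0/8..c + a0/8} = 0" by (intro null_subset[OF null]) auto
    then show "a0 / 8 * norm x \<le> norm (w - c *\<^sub>R x)"
      by (intro outside_interval[OF xw]) (use a0 in auto)
  qed
  show ?thesis
    using a0 below[of "a0/2"] below[of "- (a0/2)"] \<epsilon>
    by (intro exI[of _ "a0/2"]) (auto simp: admissible_iff[OF T] fin b_def intro!: exI[of _ "a0/8"])
qed

end

section \<open>Spectral flow as the increment of a potential\<close>

context hilbert_space
begin

lemma projection_and_dim_stable:
  assumes T: "selfadjoint T" and "c < d" and "\<eta> > 0"
    and below: "bounded_below (Map.graph T) c \<eta>" "bounded_below (Map.graph T) d \<eta>"
    and fin: "fin_dim (specran T {c..d})"
  obtains \<delta> C where "\<delta> > 0"
    "\<And>S. selfadjoint S \<Longrightarrow> gap_dist S T < \<delta> \<Longrightarrow>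
       bounded_below (Map.graph S) c (\<eta>/2) \<and> bounded_below (Map.graph S) d (\<eta>/2) \<and>
       norm (specm S {c..d} - specm T {c..d}) \<le> C * gap_dist S T \<and>
       fin_dim (specran S {c..d}) \<and>
       dim (specran S {c..d}) = dim (specran T {c..d})"
proof -
  obtain \<delta> C where \<delta>: "\<delta> > 0" and C: "\<And>H. selfadjoint_graph H \<Longrightarrow> gap (Map.graph T) H < \<delta> \<Longrightarrow>
      bounded_below H c (\<eta>/2) \<and> bounded_below H d (\<eta>/2) \<and>
      norm (specm T {c..d} - spectral_measure H {c..d}) \<le> C * gap (Map.graph T) H"
    using spectral_projection_stable[OF selfadjoint_graph[OF T] \<open>c < d\<close> below \<open>\<eta> > 0\<close>] by blast
  show ?thesis
  \<comment> \<open>The second bound on the gap forces the two projections to be at distance less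
    than 1, so that their ranks agree.\<close>
  proof (rule that[of "min \<delta> (1 / (\<bar>C\<bar> + 1))" C])
    show "min \<delta> (1 / (\<bar>C\<bar> + 1)) > 0" using \<delta> by (simp add: add_nonneg_pos)
    fix S assume S: "selfadjoint S" and gap: "gap_dist S T < min \<delta> (1 / (\<bar>C\<bar> + 1))"
    have gS: "gap (Map.graph T) (Map.graph S) = gap_dist S T"
      by (simp add: gap_dist_eq[OF S T] gap_commute)
    have *: "bounded_below (Map.graph S) c (\<eta>/2) \<and> bounded_below (Map.graph S) d (\<eta>/2) \<and>
      norm (specm T {c..d} - specm S {c..d}) \<le> C * gap_dist S T"
      using C[OF selfadjoint_graph[OF S]] gap unfolding gS by simp
    have g0: "gap_dist S T \<ge> 0" by (simp add: gap_dist_def)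
    have "C * gap_dist S T \<le> (\<bar>C\<bar> + 1) * gap_dist S T" using g0 by (intro mult_right_mono) auto
    also have "\<dots> < (\<bar>C\<bar> + 1) * (1 / (\<bar>C\<bar> + 1))"
      using gap by (intro mult_strict_left_mono) auto
    finally have "C * gap_dist S T < 1" by (simp add: add_nonneg_pos[THEN less_imp_neq, THEN not_sym])
    then have close: "norm (specm S {c..d} - specm T {c..d}) < 1" "norm (specm T {c..d} - specm S {c..d}) < 1"
      using * by (simp_all add: norm_minus_commute)
    have proj: "is_orth_proj ip (specm S {c..d})" "is_orth_proj ip (specm T {c..d})"
      by (simp_all add: spectral_measure_proj S T)
    note 1 = dim_range_le_of_close[OF proj close(1) fin]
    note 2 = dim_range_le_of_close[OF proj(2,1) close(2) 1(1)]
    show "bounded_below (Map.graph S) c (\<eta>/2) \<and> bounded_below (Map.graph S) d (\<eta>/2) \<and>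
       norm (specm S {c..d} - specm T {c..d}) \<le> C * gap_dist S T \<and>
       fin_dim (specran S {c..d}) \<and>
       dim (specran S {c..d}) = dim (specran T {c..d})"
      using * 1 2 by (simp add: norm_minus_commute)
  qed
qed

text \<open>Transported are the lower bounds and the finite rank; the condition on the essential
  spectrum of \<open>S\<close> is then recovered through \<open>admissible_iff\<close>.\<close>

lemma admissible_stable:
  assumes T: "selfadjoint T" and adm: "admissible a T"
  obtains \<delta> C where "\<delta> > 0"
    "\<And>S. selfadjoint S \<Longrightarrow> gap_dist S T < \<delta> \<Longrightarrow> admissible a S \<and>
       norm (spectral_proj {- a..a} S - spectral_proj {- a..a} T) \<le> C * gap_dist S T"
proof -
  obtain \<eta> where \<eta>: "0 < a" "\<eta> > 0" "bounded_below (Map.graph T) (- a) \<eta>" "bounded_below (Map.graph T) a \<eta>"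
    "fin_dim (specran T {- a..a})"
    using adm by (auto simp: admissible_iff[OF T])
  have "- a < a" using \<eta>(1) by simp
  from projection_and_dim_stable[OF T this \<eta>(2-5)] obtain \<delta> C where \<delta>: "\<delta> > 0"
    and C: "\<And>S. selfadjoint S \<Longrightarrow> gap_dist S T < \<delta> \<Longrightarrow>
       bounded_below (Map.graph S) (- a) (\<eta>/2) \<and> bounded_below (Map.graph S) a (\<eta>/2) \<and>
       norm (specm S {- a..a} - specm T {- a..a}) \<le> C * gap_dist S T \<and>
       fin_dim (specran S {- a..a}) \<and>
       dim (specran S {- a..a}) = dim (specran T {- a..a})"
    by blast
  show ?thesis
  proof (rule that[OF \<delta>])
    fix S assume S: "selfadjoint S" "gap_dist S T < \<delta>"
    have "\<eta>/2 > 0" using \<eta> by simp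
    then have "\<exists>\<eta>>0. bounded_below (Map.graph S) a \<eta> \<and> bounded_below (Map.graph S) (- a) \<eta>"
      using C[OF S] by blast
    then show "admissible a S \<and>
       norm (spectral_proj {- a..a} S - spectral_proj {- a..a} T) \<le> C * gap_dist S T"
      using C[OF S] \<eta>(1) by (simp add: admissible_iff[OF S(1)] spectral_proj_eq S(1) T)
  qed
qed

text \<open>As \<open>a\<close> is outside the spectrum, {a} is a null set, so [a, b] may be
  replaced by (a, b], which together with [0, a] decomposes [0, b].\<close>

lemma spectral_dim_diff:
  assumes T: "selfadjoint T" and a: "admissible a T" and b: "admissible b T" and "a < b"
  shows "fin_dim (specran T {a..b})"
    "spectral_dim {0..b} T - spectral_dim {0..a} T = int (dim (specran T {a..b}))"
proof -
  interpret spectral_resolution "Map.graph T" "specm T" by (rule spectral_resolution_specm[OF T])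
  obtain \<eta> where \<eta>: "0 < a" "\<eta> > 0" "bounded_below (Map.graph T) a \<eta>" using a by (auto simp: admissible_iff[OF T])
  have "specm T {a - 0..a + 0} = 0"
    by (rule null_of_bounded_below[of \<eta>]) (use \<eta> bounded_belowD in auto)
  then have "specm T {a} = 0" by simp
  then have eq: "specm T {a..b} = specm T {a<..b}"
    by (rule eq_modulo_null) (use \<open>a < b\<close> in auto)
  have fin_b: "fin_dim (specran T {- b..b})" using b by (simp add: admissible_iff[OF T])
  have fin: "fin_dim (specran T A)" if "A \<in> sets borel" "A \<subseteq> {- b..b}" for A
    by (rule fin_dim_subset[OF fin_b range_specm_mono[OF T that(1) _ that(2)]]) simp
  show "fin_dim (specran T {a..b})" using \<eta>(1) by (intro fin) auto
  have "{0..b} = {0..a} \<union> {a<..b}" using \<eta>(1) \<open>a < b\<close> by auto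
  moreover have "dim (specran T ({0..a} \<union> {a<..b}))
      = dim (specran T {0..a}) + dim (specran T {a<..b})"
    using \<eta>(1) \<open>a < b\<close> by (intro dim_range_specm_union T fin) auto
  ultimately show "spectral_dim {0..b} T - spectral_dim {0..a} T = int (dim (specran T {a..b}))"
    by (simp add: spectral_dim_def spectral_proj_eq[OF T] eq)
qed

text \<open>An eigenvalue crossing 0 changes both dimensions alike; the difference is the rank, up
  to sign, of a projection for an interval whose endpoints are both outside the spectrum.\<close>

lemma spectral_dim_diff_stable:
  assumes T: "selfadjoint T" and a: "admissible a T" and b: "admissible b T"
  obtains \<delta> where "\<delta> > 0"
    "\<And>S. selfadjoint S \<Longrightarrow> gap_dist S T < \<delta> \<Longrightarrow> admissible a S \<and> admissible b S \<and>
       spectral_dim {0..b} S - spectral_dim {0..a} S = spectral_dim {0..b} T - spectral_dim {0..a} T"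
proof -
  have ordered: "\<exists>\<delta>>0. \<forall>S. selfadjoint S \<longrightarrow> gap_dist S T < \<delta> \<longrightarrow> admissible a S \<longrightarrow> admissible b S \<longrightarrow>
       spectral_dim {0..b} S - spectral_dim {0..a} S = spectral_dim {0..b} T - spectral_dim {0..a} T"
    if a: "admissible a T" and b: "admissible b T" and "a < b" for a b
  proof -
    obtain \<eta>1 \<eta>2 where \<eta>: "\<eta>1 > 0" "bounded_below (Map.graph T) a \<eta>1" "\<eta>2 > 0" "bounded_below (Map.graph T) b \<eta>2"
      using a b by (auto simp: admissible_iff[OF T])
    define \<eta> where "\<eta> = min \<eta>1 \<eta>2"
    have "bounded_below (Map.graph T) a \<eta>" "bounded_below (Map.graph T) b \<eta>"
      by (rule bounded_below_weaken[OF \<eta>(2)], simp add: \<eta>_def)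
        (rule bounded_below_weaken[OF \<eta>(4)], simp add: \<eta>_def)
    moreover have "\<eta> > 0" using \<eta> by (simp add: \<eta>_def)
    ultimately obtain \<delta> C where \<delta>: "\<delta> > 0" and C: "\<And>S. selfadjoint S \<Longrightarrow> gap_dist S T < \<delta> \<Longrightarrow>
       bounded_below (Map.graph S) a (\<eta>/2) \<and> bounded_below (Map.graph S) b (\<eta>/2) \<and>
       norm (specm S {a..b} - specm T {a..b}) \<le> C * gap_dist S T \<and>
       fin_dim (specran S {a..b}) \<and>
       dim (specran S {a..b}) = dim (specran T {a..b})"
      using projection_and_dim_stable[OF T \<open>a < b\<close> _ _ _ spectral_dim_diff(1)[OF T a b \<open>a < b\<close>], of \<eta>] by blast
    show ?thesis
    proof (intro exI[of _ \<delta>] conjI \<delta> allI impI)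
      fix S assume S: "selfadjoint S" "gap_dist S T < \<delta>" "admissible a S" "admissible b S"
      show "spectral_dim {0..b} S - spectral_dim {0..a} S = spectral_dim {0..b} T - spectral_dim {0..a} T"
        using C[OF S(1,2)] spectral_dim_diff(2)[OF S(1,3,4) \<open>a < b\<close>] spectral_dim_diff(2)[OF T a b \<open>a < b\<close>] by simp
    qed
  qed
  have "\<exists>\<delta>>0. \<forall>S. selfadjoint S \<longrightarrow> gap_dist S T < \<delta> \<longrightarrow> admissible a S \<longrightarrow> admissible b S \<longrightarrow>
       spectral_dim {0..b} S - spectral_dim {0..a} S = spectral_dim {0..b} T - spectral_dim {0..a} T"
  proof (cases a b rule: linorder_cases)
    case less then show ?thesis by (rule ordered[OF a b])
  next
    case equal then show ?thesis by (intro exI[of _ 1]) simp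
  next
    case greater
    from ordered[OF b a this] obtain \<delta> where \<delta>: "\<delta> > 0" and *: "\<And>S. selfadjoint S \<Longrightarrow> gap_dist S T < \<delta> \<Longrightarrow>
        admissible b S \<Longrightarrow> admissible a S \<Longrightarrow>
        spectral_dim {0..a} S - spectral_dim {0..b} S = spectral_dim {0..a} T - spectral_dim {0..b} T" by blast
    show ?thesis
    proof (intro exI[of _ \<delta>] conjI \<delta> allI impI)
      fix S assume "selfadjoint S" "gap_dist S T < \<delta>" "admissible a S" "admissible b S"
      with * show "spectral_dim {0..b} S - spectral_dim {0..a} S = spectral_dim {0..b} T - spectral_dim {0..a} T"
        by fastforce
    qed
  qed
  then obtain \<delta> where \<delta>: "\<delta> > 0" "\<And>S. selfadjoint S \<Longrightarrow> gap_dist S T < \<delta> \<Longrightarrow> admissible a S \<Longrightarrow> admissible b S \<Longrightarrow>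
       spectral_dim {0..b} S - spectral_dim {0..a} S = spectral_dim {0..b} T - spectral_dim {0..a} T" by blast
  obtain \<delta>1 C1 where \<delta>1: "\<delta>1 > 0" "\<And>S. selfadjoint S \<Longrightarrow> gap_dist S T < \<delta>1 \<Longrightarrow> admissible a S \<and>
       norm (spectral_proj {- a..a} S - spectral_proj {- a..a} T) \<le> C1 * gap_dist S T"
    using admissible_stable[OF T a] by blast
  obtain \<delta>2 C2 where \<delta>2: "\<delta>2 > 0" "\<And>S. selfadjoint S \<Longrightarrow> gap_dist S T < \<delta>2 \<Longrightarrow> admissible b S \<and>
       norm (spectral_proj {- b..b} S - spectral_proj {- b..b} T) \<le> C2 * gap_dist S T"
    using admissible_stable[OF T b] by blast
  show ?thesis
  proof (rule that[of "min \<delta> (min \<delta>1 \<delta>2)"])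
    show "min \<delta> (min \<delta>1 \<delta>2) > 0" using \<delta> \<delta>1 \<delta>2 by simp
    fix S assume "selfadjoint S" "gap_dist S T < min \<delta> (min \<delta>1 \<delta>2)"
    then show "admissible a S \<and> admissible b S \<and>
       spectral_dim {0..b} S - spectral_dim {0..a} S = spectral_dim {0..b} T - spectral_dim {0..a} T"
      using \<delta>(2) \<delta>1(2) \<delta>2(2) by simp
  qed
qed

lemma gap_continuous_onD:
  fixes A :: "'p::metric_space \<Rightarrow> ('a \<rightharpoonup> 'a)"
  assumes "gap_continuous_on X A" "p \<in> X" "e > 0"
  obtains r where "r > 0" "\<And>q. q \<in> X \<Longrightarrow> dist q p < r \<Longrightarrow> gap_dist (A q) (A p) < e"
proof -
  have "((\<lambda>q. gap_dist (A q) (A p)) \<longlongrightarrow> 0) (at p within X)" using assms by (simp add: gap_continuous_on_def)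
  then have "\<forall>\<^sub>F q in at p within X. dist (gap_dist (A q) (A p)) 0 < e" using assms(3) by (rule tendstoD)
  then obtain r where r0: "r > 0" "\<And>q. q \<in> X \<Longrightarrow> q \<noteq> p \<Longrightarrow> dist q p < r \<Longrightarrow> \<bar>gap_dist (A q) (A p)\<bar> < e"
    by (auto simp: eventually_at)
  then have r: "r > 0" "\<And>q. q \<in> X \<Longrightarrow> q \<noteq> p \<Longrightarrow> dist q p < r \<Longrightarrow> gap_dist (A q) (A p) < e"
    by (auto dest!: r0(2))
  have "gap_dist (A p) (A p) < e" using assms(3) by (simp add: gap_dist_def)
  with r show ?thesis by (intro that[of r]) auto
qed

text \<open>A potential of a family \<open>h\<close> is an integer-valued function whose increments are locally those of
  the dimension of \<open>\<chi>\<^bsub>[0,a]\<^esub>(h p)\<close>, for every admissible \<open>a\<close>.  Its increment along a path is the spectral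
  flow, which turns the theorem into the existence of a potential on the square.\<close>

definition potential :: "'p::metric_space set \<Rightarrow> ('p \<Rightarrow> ('a \<rightharpoonup> 'a)) \<Rightarrow> ('p \<Rightarrow> int) \<Rightarrow> bool" where
  "potential X h g \<longleftrightarrow> (\<forall>a. \<forall>p\<in>X. admissible a (h p) \<longrightarrow>
     (\<exists>r>0. \<forall>q\<in>X. dist q p < r \<longrightarrow> g q - spectral_dim {0..a} (h q) = g p - spectral_dim {0..a} (h p)))"

lemma potentialD:
  assumes "potential X h g" "p \<in> X" "admissible a (h p)"
  obtains r where "r > 0"
    "\<And>q. q \<in> X \<Longrightarrow> dist q p < r \<Longrightarrow> g q - spectral_dim {0..a} (h q) = g p - spectral_dim {0..a} (h p)"
  using assms unfolding potential_def by blast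

lemma potential_local:
  assumes CF: "\<And>p. p \<in> X \<Longrightarrow> h p \<in> CFsa" and cont: "gap_continuous_on X h"
    and Y: "Y \<subseteq> X" "\<And>p. p \<in> Y \<Longrightarrow> admissible b (h p)"
  shows "potential Y h (\<lambda>p. spectral_dim {0..b} (h p))"
  unfolding potential_def
proof (intro allI ballI impI)
  fix a p assume p: "p \<in> Y" and a: "admissible a (h p)"
  have sa: "selfadjoint (h q)" if "q \<in> Y" for q using CF CFsa_selfadjoint that Y(1) by blast
  obtain \<delta> where \<delta>: "\<delta> > 0" "\<And>S. selfadjoint S \<Longrightarrow> gap_dist S (h p) < \<delta> \<Longrightarrow> admissible a S \<and> admissible b S \<and>
       spectral_dim {0..b} S - spectral_dim {0..a} S = spectral_dim {0..b} (h p) - spectral_dim {0..a} (h p)"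
    using spectral_dim_diff_stable[OF sa[OF p] a Y(2)[OF p]] by blast
  obtain r where "r > 0" "\<And>q. q \<in> X \<Longrightarrow> dist q p < r \<Longrightarrow> gap_dist (h q) (h p) < \<delta>"
    using gap_continuous_onD[OF cont _ \<delta>(1)] p Y(1) by blast
  then show "\<exists>r>0. \<forall>q\<in>Y. dist q p < r \<longrightarrow> spectral_dim {0..b} (h q) - spectral_dim {0..a} (h q) =
      spectral_dim {0..b} (h p) - spectral_dim {0..a} (h p)"
    using \<delta>(2) sa Y(1) by (meson subsetD)
qed

lemma constant_of_locally_constant:
  fixes f :: "'p::metric_space \<Rightarrow> int"
  assumes "connected S" "\<And>p. p \<in> S \<Longrightarrow> \<exists>r>0. \<forall>q\<in>S. dist q p < r \<longrightarrow> f q = f p"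
  obtains k where "\<And>p. p \<in> S \<Longrightarrow> f p = k"
proof -
  have "f constant_on S"
  proof (rule locally_constant_imp_constant[OF assms(1)])
    fix p assume p: "p \<in> S"
    then obtain r where r: "r > 0" "\<forall>q\<in>S. dist q p < r \<longrightarrow> f q = f p" using assms(2) by blast
    show "\<exists>T. openin (top_of_set S) T \<and> p \<in> T \<and> (\<forall>x\<in>T. f x = f p)"
    proof (intro exI[of _ "S \<inter> ball p r"] conjI ballI)
      show "openin (top_of_set S) (S \<inter> ball p r)" by (intro openin_open_Int open_ball)
      show "p \<in> S \<inter> ball p r" using p r(1) by simp
      show "f x = f p" if "x \<in> S \<inter> ball p r" for x
        using that r(2) by (simp add: dist_commute)
    qed
  qed
  then show ?thesis using that unfolding constant_on_def by blast
qed

text \<open>On the connected overlap the two potentials differ by a locally constant, hence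
  constant, integer, which is added to one of them. Closedness matters at points outside one of the
  sets: a neighbourhood misses that set, so only the other one imposes a condition.\<close>

lemma potential_glue:
  fixes Y Z :: "'p::metric_space set"
  assumes CF: "\<And>p. p \<in> Y \<union> Z \<Longrightarrow> h p \<in> CFsa"
    and gY: "potential Y h gY" and gZ: "potential Z h gZ"
    and closed: "closed Y" "closed Z" and conn: "connected (Y \<inter> Z)"
  shows "\<exists>g. potential (Y \<union> Z) h g"
proof -
  obtain k where k: "\<And>p. p \<in> Y \<inter> Z \<Longrightarrow> gY p - gZ p = k"
  proof (rule constant_of_locally_constant[OF conn, of "\<lambda>p. gY p - gZ p"])
    fix p assume p: "p \<in> Y \<inter> Z"
    then obtain a where a: "admissible a (h p)" using ex_admissible CF by blast
    obtain r1 where r1: "r1 > 0" "\<And>q. q \<in> Y \<Longrightarrow> dist q p < r1 \<Longrightarrow> gY q - spectral_dim {0..a} (h q) = gY p - spectral_dim {0..a} (h p)"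
      using potentialD[OF gY _ a] p by blast
    obtain r2 where r2: "r2 > 0" "\<And>q. q \<in> Z \<Longrightarrow> dist q p < r2 \<Longrightarrow> gZ q - spectral_dim {0..a} (h q) = gZ p - spectral_dim {0..a} (h p)"
      using potentialD[OF gZ _ a] p by blast
    show "\<exists>r>0. \<forall>q\<in>Y \<inter> Z. dist q p < r \<longrightarrow> gY q - gZ q = gY p - gZ p"
    proof (intro exI[of _ "min r1 r2"] conjI ballI impI)
      fix q assume "q \<in> Y \<inter> Z" "dist q p < min r1 r2"
      then show "gY q - gZ q = gY p - gZ p" using r1(2)[of q] r2(2)[of q] by simp
    qed (use r1 r2 in simp)
  qed blast
  define g where "g p = (if p \<in> Y then gY p else gZ p + k)" for p
  have g: "p \<in> Y \<Longrightarrow> g p = gY p" "p \<in> Z \<Longrightarrow> g p = gZ p + k" for p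
    using k[of p] by (auto simp: g_def)
  have nearY: "\<exists>r>0. \<forall>q\<in>Y. dist q p < r \<longrightarrow> p \<in> Y \<and> g q - spectral_dim {0..a} (h q) = g p - spectral_dim {0..a} (h p)"
    if a: "admissible a (h p)" for a p
  proof (cases "p \<in> Y")
    case True
    then show ?thesis using potentialD[OF gY True a] g(1) by (metis (no_types, lifting))
  next
    case False
    then obtain r where "r > 0" "ball p r \<subseteq> - Y" using open_contains_ball closed(1) open_Compl by (metis ComplI)
    then show ?thesis by (intro exI[of _ r]) (auto simp: dist_commute subset_iff)
  qed
  have nearZ: "\<exists>r>0. \<forall>q\<in>Z. dist q p < r \<longrightarrow> p \<in> Z \<and> g q - spectral_dim {0..a} (h q) = g p - spectral_dim {0..a} (h p)"
    if a: "admissible a (h p)" for a p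
  proof (cases "p \<in> Z")
    case True
    then obtain r where r: "r > 0" "\<And>q. q \<in> Z \<Longrightarrow> dist q p < r \<Longrightarrow> gZ q - spectral_dim {0..a} (h q) = gZ p - spectral_dim {0..a} (h p)"
      using potentialD[OF gZ True a] by blast
    show ?thesis
    proof (intro exI[of _ r] conjI r(1) ballI impI True)
      fix q assume "q \<in> Z" "dist q p < r"
      then show "g q - spectral_dim {0..a} (h q) = g p - spectral_dim {0..a} (h p)"
        using r(2)[of q] True by (simp add: g(2))
    qed
  next
    case False
    then obtain r where "r > 0" "ball p r \<subseteq> - Z" using open_contains_ball closed(2) open_Compl by (metis ComplI)
    then show ?thesis by (intro exI[of _ r]) (auto simp: dist_commute subset_iff)
  qed
  have "potential (Y \<union> Z) h g"
    unfolding potential_def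
  proof (intro allI ballI impI)
    fix a p assume "admissible a (h p)"
    from nearY[OF this] nearZ[OF this] obtain r1 r2 where
      r1: "r1 > 0" "\<And>q. q \<in> Y \<Longrightarrow> dist q p < r1 \<Longrightarrow> g q - spectral_dim {0..a} (h q) = g p - spectral_dim {0..a} (h p)"
      and r2: "r2 > 0" "\<And>q. q \<in> Z \<Longrightarrow> dist q p < r2 \<Longrightarrow> g q - spectral_dim {0..a} (h q) = g p - spectral_dim {0..a} (h p)"
      by blast
    then show "\<exists>r>0. \<forall>q\<in>Y \<union> Z. dist q p < r \<longrightarrow> g q - spectral_dim {0..a} (h q) = g p - spectral_dim {0..a} (h p)"
      by (intro exI[of _ "min r1 r2"]) auto
  qed
  then show ?thesis by blast
qed

lemma admissible_nearby:
  fixes h :: "'p::metric_space \<Rightarrow> ('a \<rightharpoonup> 'a)"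
  assumes CF: "\<And>p. p \<in> X \<Longrightarrow> h p \<in> CFsa" and cont: "gap_continuous_on X h" and p: "p \<in> X"
  obtains a r where "r > 0" "\<And>q. q \<in> X \<Longrightarrow> dist q p < r \<Longrightarrow> admissible a (h q)"
proof -
  have sa: "selfadjoint (h q)" if "q \<in> X" for q using CF CFsa_selfadjoint that by blast
  obtain a where a: "admissible a (h p)" using ex_admissible CF p by blast
  obtain \<delta> C where \<delta>: "\<delta> > 0" "\<And>S. selfadjoint S \<Longrightarrow> gap_dist S (h p) < \<delta> \<Longrightarrow> admissible a S \<and>
       norm (spectral_proj {- a..a} S - spectral_proj {- a..a} (h p)) \<le> C * gap_dist S (h p)"
    using admissible_stable[OF sa[OF p] a] by blast
  obtain r where r: "r > 0" "\<And>q. q \<in> X \<Longrightarrow> dist q p < r \<Longrightarrow> gap_dist (h q) (h p) < \<delta>"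
    using gap_continuous_onD[OF cont p \<delta>(1)] by blast
  show ?thesis by (rule that[OF r(1)]) (use r(2) \<delta>(2) sa in blast)
qed

lemma spectral_proj_continuous:
  fixes h :: "'p::metric_space \<Rightarrow> ('a \<rightharpoonup> 'a)"
  assumes CF: "\<And>p. p \<in> X \<Longrightarrow> h p \<in> CFsa" and cont: "gap_continuous_on X h"
    and Y: "Y \<subseteq> X" "\<And>p. p \<in> Y \<Longrightarrow> admissible a (h p)"
  shows "continuous_on Y (\<lambda>p. spectral_proj {- a..a} (h p))"
  unfolding continuous_on_iff
proof (intro ballI allI impI)
  fix p and e :: real assume p: "p \<in> Y" and "e > 0"
  have sa: "selfadjoint (h q)" if "q \<in> X" for q using CF CFsa_selfadjoint that by blast
  obtain \<delta> C where \<delta>: "\<delta> > 0" "\<And>S. selfadjoint S \<Longrightarrow> gap_dist S (h p) < \<delta> \<Longrightarrow> admissible a S \<and>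
       norm (spectral_proj {- a..a} S - spectral_proj {- a..a} (h p)) \<le> C * gap_dist S (h p)"
    using admissible_stable[OF sa Y(2)[OF p]] p Y(1) by blast
  have C1: "\<bar>C\<bar> + 1 > 0" by (simp add: add_nonneg_pos)
  have "min \<delta> (e / (\<bar>C\<bar> + 1)) > 0" using \<delta> \<open>e > 0\<close> C1 by simp
  then obtain r where r: "r > 0" "\<And>q. q \<in> X \<Longrightarrow> dist q p < r \<Longrightarrow> gap_dist (h q) (h p) < min \<delta> (e / (\<bar>C\<bar> + 1))"
    using gap_continuous_onD[OF cont, of p] p Y(1) by blast
  have "dist (spectral_proj {- a..a} (h q)) (spectral_proj {- a..a} (h p)) < e" if "q \<in> Y" "dist q p < r" for q
  proof -
    have q: "q \<in> X" using that Y(1) by blast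
    have g: "gap_dist (h q) (h p) < \<delta>" "gap_dist (h q) (h p) < e / (\<bar>C\<bar> + 1)" using r(2)[OF q that(2)] by auto
    have "norm (spectral_proj {- a..a} (h q) - spectral_proj {- a..a} (h p)) \<le> C * gap_dist (h q) (h p)"
      using \<delta>(2)[OF sa[OF q] g(1)] by blast
    also have "\<dots> \<le> (\<bar>C\<bar> + 1) * gap_dist (h q) (h p)" by (intro mult_right_mono) (auto simp: gap_dist_def)
    also have "\<dots> < (\<bar>C\<bar> + 1) * (e / (\<bar>C\<bar> + 1))" by (rule mult_strict_left_mono[OF g(2) C1])
    also have "\<dots> = e" using C1 by simp
    finally show ?thesis by (simp add: dist_norm)
  qed
  then show "\<exists>d>0. \<forall>x'\<in>Y. dist x' p < d \<longrightarrow> dist (spectral_proj {- a..a} (h x')) (spectral_proj {- a..a} (h p)) < e"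
    using r(1) by blast
qed

lemma gap_continuous_on_path:
  fixes h :: "'p::metric_space \<Rightarrow> ('a \<rightharpoonup> 'a)" and \<gamma> :: "'q::metric_space \<Rightarrow> 'p"
  assumes cont: "gap_continuous_on X h" and \<gamma>: "continuous_on I \<gamma>" "\<gamma> ` I \<subseteq> X"
  shows "gap_continuous_on I (\<lambda>t. h (\<gamma> t))"
  unfolding gap_continuous_on_def
proof (intro ballI tendstoI)
  fix t and e :: real assume t: "t \<in> I" and e: "e > 0"
  obtain r where r: "r > 0" "\<And>q. q \<in> X \<Longrightarrow> dist q (\<gamma> t) < r \<Longrightarrow> gap_dist (h q) (h (\<gamma> t)) < e"
    using gap_continuous_onD[OF cont _ e] t \<gamma>(2) by blast
  have "(\<gamma> \<longlongrightarrow> \<gamma> t) (at t within I)" using \<gamma>(1) t by (simp add: continuous_on_def)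
  then have "\<forall>\<^sub>F s in at t within I. dist (\<gamma> s) (\<gamma> t) < r" using r(1) by (rule tendstoD)
  moreover have "\<forall>\<^sub>F s in at t within I. s \<in> I" by (simp add: eventually_at_filter)
  ultimately show "\<forall>\<^sub>F s in at t within I. dist (gap_dist (h (\<gamma> s)) (h (\<gamma> t))) 0 < e"
  proof eventually_elim
    case (elim s)
    then have "gap_dist (h (\<gamma> s)) (h (\<gamma> t)) < e" using r(2) \<gamma>(2) by blast
    then show ?case by (simp add: gap_dist_def)
  qed
qed

lemma potential_path:
  fixes h :: "'p::metric_space \<Rightarrow> ('a \<rightharpoonup> 'a)" and \<gamma> :: "'q::metric_space \<Rightarrow> 'p"
  assumes g: "potential X h g" and \<gamma>: "continuous_on I \<gamma>" "\<gamma> ` I \<subseteq> X"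
  shows "potential I (\<lambda>t. h (\<gamma> t)) (\<lambda>t. g (\<gamma> t))"
  unfolding potential_def
proof (intro allI ballI impI)
  fix a t assume t: "t \<in> I" and a: "admissible a (h (\<gamma> t))"
  obtain r where r: "r > 0" "\<And>q. q \<in> X \<Longrightarrow> dist q (\<gamma> t) < r \<Longrightarrow>
      g q - spectral_dim {0..a} (h q) = g (\<gamma> t) - spectral_dim {0..a} (h (\<gamma> t))"
    using potentialD[OF g _ a] t \<gamma>(2) by blast
  obtain d where "d > 0" "\<And>s. s \<in> I \<Longrightarrow> dist s t < d \<Longrightarrow> dist (\<gamma> s) (\<gamma> t) < r"
    using \<gamma>(1) t r(1) unfolding continuous_on_iff by blast
  then show "\<exists>r>0. \<forall>q\<in>I. dist q t < r \<longrightarrow>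
      g (\<gamma> q) - spectral_dim {0..a} (h (\<gamma> q)) = g (\<gamma> t) - spectral_dim {0..a} (h (\<gamma> t))"
    using r(2) \<gamma>(2) by (intro exI[of _ d]) blast
qed

lemma partition_bounds:
  fixes l :: "nat \<Rightarrow> real"
  assumes "\<forall>i\<in>{1..N}. l (i - 1) < l i" "j \<le> N"
  shows "l 0 \<le> l j" "l j \<le> l N"
proof -
  have step: "l i < l (Suc i)" if "i < N" for i using assms(1) that by force
  have mono: "l i \<le> l j" if "i \<le> j" "j \<le> N" for i j
    using that
  proof (induction j rule: dec_induct)
    case (step j) then show ?case using \<open>\<And>i. i < N \<Longrightarrow> l i < l (Suc i)\<close>[of j] by simp
  qed simp
  show "l 0 \<le> l j" "l j \<le> l N" using mono assms(2) by auto
qed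

text \<open>On each subinterval of a partition \<open>g\<close> and dim chi_[0,a_i] differ by a
  constant, so every partition telescopes to the same value. This determines the definite
  description once a partition exists.\<close>

lemma sf_eq_potential:
  fixes A :: "real \<Rightarrow> ('a \<rightharpoonup> 'a)"
  assumes CF: "\<And>t. t \<in> {0..1} \<Longrightarrow> A t \<in> CFsa" and cont: "gap_continuous_on {0..1} A"
    and g: "potential {0..1} A g"
  shows "sf A = g 1 - g 0"
  unfolding sf_def
proof (rule the_equality)
  have sum: "(\<Sum>i=1..N. spectral_dim {0..a i} (A (l i)) - spectral_dim {0..a i} (A (l (i - 1)))) = g 1 - g 0"
    if part: "sf_partition A N l a" for N l a
  proof -
    have l: "l 0 = 0" "l N = 1" and inc: "\<forall>i\<in>{1..N}. l (i - 1) < l i"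
      using part by (auto simp: sf_partition_def)
    have step: "spectral_dim {0..a i} (A (l i)) - spectral_dim {0..a i} (A (l (i - 1))) = g (l i) - g (l (i - 1))"
      if i: "i \<in> {1..N}" for i
    proof -
      have sub: "{l (i - 1)..l i} \<subseteq> {0..1}"
        using partition_bounds[OF inc, of i] partition_bounds[OF inc, of "i - 1"] i l by auto
      have adm: "admissible (a i) (A t)" if "t \<in> {l (i - 1)..l i}" for t
        using part i that unfolding sf_partition_def admissible_def by auto
      obtain k where k: "\<And>t. t \<in> {l (i - 1)..l i} \<Longrightarrow> g t - spectral_dim {0..a i} (A t) = k"
      proof (rule constant_of_locally_constant[of "{l (i - 1)..l i}" "\<lambda>t. g t - spectral_dim {0..a i} (A t)"])
        fix t assume t: "t \<in> {l (i - 1)..l i}"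
        have "t \<in> {0..1}" using t sub by blast
        from potentialD[OF g this adm[OF t]] obtain r where "r > 0"
          "\<And>q. q \<in> {0..1} \<Longrightarrow> dist q t < r \<Longrightarrow> g q - spectral_dim {0..a i} (A q) = g t - spectral_dim {0..a i} (A t)"
          by blast
        then show "\<exists>r>0. \<forall>q\<in>{l (i - 1)..l i}. dist q t < r \<longrightarrow>
            g q - spectral_dim {0..a i} (A q) = g t - spectral_dim {0..a i} (A t)"
          using sub by blast
      qed auto
      have "l (i - 1) < l i" using inc i by blast
      then show ?thesis using k[of "l i"] k[of "l (i - 1)"] by simp
    qed
    have "(\<Sum>i=1..N. spectral_dim {0..a i} (A (l i)) - spectral_dim {0..a i} (A (l (i - 1))))
        = (\<Sum>i=1..N. g (l i) - g (l (i - 1)))"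
      using step by (intro sum.cong) auto
    also have "\<dots> = g (l N) - g (l 0)" by (induction N) simp_all
    finally show ?thesis by (simp add: l)
  qed
  have "\<exists>N l a. sf_partition A N l a"
  proof -
    have "\<exists>a r. r > 0 \<and> (\<forall>s\<in>{0..1}. dist s t < r \<longrightarrow> admissible a (A s))" if t: "t \<in> {0..1}" for t
    proof -
      obtain a r where "r > 0" "\<And>s. s \<in> {0..1} \<Longrightarrow> dist s t < r \<Longrightarrow> admissible a (A s)"
        by (rule admissible_nearby[OF CF cont t]) (assumption, (rule that; blast))
      then show ?thesis by (intro exI[of _ a] exI[of _ r]) simp
    qed
    then obtain b r where br: "\<And>t. t \<in> {0..1} \<Longrightarrow> r t > 0"
      "\<And>t s. t \<in> {0..1} \<Longrightarrow> s \<in> {0..1} \<Longrightarrow> dist s t < r t \<Longrightarrow> admissible (b t) (A s)"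
      by metis
    obtain \<delta> where \<delta>: "\<delta> > 0" "\<And>S. S \<subseteq> {0..1} \<Longrightarrow> diameter S < \<delta> \<Longrightarrow> \<exists>B\<in>(\<lambda>t. ball t (r t)) ` {0..1::real}. S \<subseteq> B"
    proof (rule Lebesgue_number_lemma[of "{0..1::real}" "(\<lambda>t. ball t (r t)) ` {0..1::real}"])
      show "{0..1} \<subseteq> \<Union> ((\<lambda>t. ball t (r t)) ` {0..1})" using br(1) by force
    qed auto
    \<comment> \<open>Equidistant points with mesh below a Lebesgue number of a cover by balls, on
      each of which one number is admissible.\<close>
    obtain n where n: "inverse (real (Suc n)) < \<delta>" using reals_Archimedean \<delta>(1) by blast
    define N where "N = Suc n"
    define l where "l i = real i / real N" for i
    have N: "real N > 0" by (simp add: N_def)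
    have piece: "\<exists>a. \<forall>s\<in>{l (i - 1)..l i}. admissible a (A s)" and sub: "{l (i - 1)..l i} \<subseteq> {0..1}"
      and inc: "l (i - 1) < l i" if i: "i \<in> {1..N}" for i
    proof -
      have len: "l i - l (i - 1) = inverse (real N)" using i by (simp add: l_def of_nat_diff field_simps)
      then show lt: "l (i - 1) < l i" using N by (metis diff_gt_0_iff_gt positive_imp_inverse_positive)
      show sub: "{l (i - 1)..l i} \<subseteq> {0..1}" using i N by (auto simp: l_def field_simps)
      have "diameter {l (i - 1)..l i} < \<delta>" using lt len n by (simp add: N_def)
      then obtain t where t: "t \<in> {0..1}" "{l (i - 1)..l i} \<subseteq> ball t (r t)" using \<delta>(2)[OF sub] by blast
      show "\<exists>a. \<forall>s\<in>{l (i - 1)..l i}. admissible a (A s)"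
      proof (intro exI[of _ "b t"] ballI)
        fix s assume "s \<in> {l (i - 1)..l i}"
        then show "admissible (b t) (A s)" using t sub by (intro br(2)) (auto simp: dist_commute)
      qed
    qed
    then obtain a where a: "\<And>i s. i \<in> {1..N} \<Longrightarrow> s \<in> {l (i - 1)..l i} \<Longrightarrow> admissible (a i) (A s)" by metis
    have "sf_partition A N l a"
      unfolding sf_partition_def
    proof (intro conjI ballI)
      show "l 0 = 0" "l N = 1" using N by (auto simp: l_def)
      fix i assume i: "i \<in> {1..N}"
      show "l (i - 1) < l i" by (rule inc[OF i])
      then have "admissible (a i) (A (l i))" using a[OF i] by simp
      then show "0 < a i" by (simp add: admissible_def)
      show "continuous_on {l (i - 1)..l i} (\<lambda>t. spectral_proj {- a i..a i} (A t))"
        by (rule spectral_proj_continuous[OF CF cont sub[OF i] a[OF i]])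
    qed (use a in \<open>auto simp: admissible_def\<close>)
    then show ?thesis by blast
  qed
  then obtain N l a where part: "sf_partition A N l a" by blast
  show "\<exists>N l a. sf_partition A N l a \<and> g 1 - g 0 =
      (\<Sum>i=1..N. spectral_dim {0..a i} (A (l i)) - spectral_dim {0..a i} (A (l (i - 1))))"
    by (intro exI[of _ N] exI[of _ l] exI[of _ a] conjI part sum[OF part, symmetric])
  fix k assume "\<exists>N l a. sf_partition A N l a \<and> k =
      (\<Sum>i=1..N. spectral_dim {0..a i} (A (l i)) - spectral_dim {0..a i} (A (l (i - 1))))"
  then show "k = g 1 - g 0" using sum by blast
qed

lemma ex_potential_square:
  fixes h :: "real \<times> real \<Rightarrow> ('a \<rightharpoonup> 'a)"
  assumes CF: "\<And>p. p \<in> {0..1} \<times> {0..1} \<Longrightarrow> h p \<in> CFsa" and cont: "gap_continuous_on ({0..1} \<times> {0..1}) h"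
  shows "\<exists>g. potential ({0..1} \<times> {0..1}) h g"
proof -
  \<comment> \<open>Rectangles are cut down to the unit square because the local case of
    \<open>Bolzano\<close> concerns all short intervals around a point, including those that stick
    out.\<close>
  define Q where "Q s0 s1 t0 t1 = ({s0..s1} \<inter> {0..1}) \<times> ({t0..t1} \<inter> {0..1})" for s0 s1 t0 t1 :: real
  have Q_sub: "Q s0 s1 t0 t1 \<subseteq> {0..1} \<times> {0..1}" for s0 s1 t0 t1 by (auto simp: Q_def)
  have closed_Q: "closed (Q s0 s1 t0 t1)" for s0 s1 t0 t1
    unfolding Q_def by (intro closed_Times closed_Int) auto
  have conn_Q: "connected (Q s0 s1 t0 t1)" for s0 s1 t0 t1
    unfolding Q_def by (intro convex_connected convex_Times convex_Int) auto
  \<comment> \<open>The overlap is again a rectangle, possibly degenerated to a segment, and hence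
    connected.\<close>
  have glue: "\<exists>g. potential (Q s0 s1 t0 t1 \<union> Q s0' s1' t0' t1') h g"
    if ex: "\<exists>g. potential (Q s0 s1 t0 t1) h g" "\<exists>g. potential (Q s0' s1' t0' t1') h g"
      and int: "Q s0 s1 t0 t1 \<inter> Q s0' s1' t0' t1' = Q u0 u1 v0 v1" for s0 s1 t0 t1 s0' s1' t0' t1' u0 u1 v0 v1
  proof -
    obtain g1 g2 where "potential (Q s0 s1 t0 t1) h g1" "potential (Q s0' s1' t0' t1') h g2" using ex by blast
    then show ?thesis
    proof (rule potential_glue[rotated])
      show "h p \<in> CFsa" if "p \<in> Q s0 s1 t0 t1 \<union> Q s0' s1' t0' t1'" for p
        using that CF Q_sub by blast
    qed (simp_all only: closed_Q int conn_Q)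
  qed
  \<comment> \<open>\<open>Bolzano\<close> in the second coordinate for fixed \<open>s\<close>,
    where the width \<delta> is part of the statement: it may shrink at each gluing, yet one width
    remains for the whole strip. These strips are the local case of a second application, in the
    first coordinate.\<close>
  have strip: "\<exists>\<delta>>0. \<forall>s0 s1. s0 \<le> s \<and> s \<le> s1 \<and> s1 - s0 < \<delta> \<longrightarrow> (\<exists>g. potential (Q s0 s1 0 1) h g)"
    if s: "0 \<le> s" "s \<le> 1" for s
  proof -
    show ?thesis
    proof (rule Bolzano[where a = 0 and b = 1 and P = "\<lambda>t0 t1. \<exists>\<delta>>0. \<forall>s0 s1. s0 \<le> s \<and> s \<le> s1 \<and> s1 - s0 < \<delta> \<longrightarrow>
          (\<exists>g. potential (Q s0 s1 t0 t1) h g)"])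
      fix t0 t1 t2 :: real
      assume "\<exists>\<delta>>0. \<forall>s0 s1. s0 \<le> s \<and> s \<le> s1 \<and> s1 - s0 < \<delta> \<longrightarrow> (\<exists>g. potential (Q s0 s1 t0 t1) h g)"
        "\<exists>\<delta>>0. \<forall>s0 s1. s0 \<le> s \<and> s \<le> s1 \<and> s1 - s0 < \<delta> \<longrightarrow> (\<exists>g. potential (Q s0 s1 t1 t2) h g)"
        and trans: "t0 \<le> t1" "t1 \<le> t2"
      then obtain \<delta>1 \<delta>2 where \<delta>: "\<delta>1 > 0" "\<delta>2 > 0"
        and *: "\<And>s0 s1. s0 \<le> s \<and> s \<le> s1 \<and> s1 - s0 < \<delta>1 \<Longrightarrow> \<exists>g. potential (Q s0 s1 t0 t1) h g"
          "\<And>s0 s1. s0 \<le> s \<and> s \<le> s1 \<and> s1 - s0 < \<delta>2 \<Longrightarrow> \<exists>g. potential (Q s0 s1 t1 t2) h g"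
        by blast
      show "\<exists>\<delta>>0. \<forall>s0 s1. s0 \<le> s \<and> s \<le> s1 \<and> s1 - s0 < \<delta> \<longrightarrow> (\<exists>g. potential (Q s0 s1 t0 t2) h g)"
      proof (intro exI[of _ "min \<delta>1 \<delta>2"] conjI allI impI)
        show "min \<delta>1 \<delta>2 > 0" using \<delta> by simp
        fix s0 s1 assume ss: "s0 \<le> s \<and> s \<le> s1 \<and> s1 - s0 < min \<delta>1 \<delta>2"
        have "Q s0 s1 t0 t1 \<inter> Q s0 s1 t1 t2 = Q s0 s1 t1 t1" using trans by (auto simp: Q_def)
        moreover have "Q s0 s1 t0 t1 \<union> Q s0 s1 t1 t2 = Q s0 s1 t0 t2" using trans by (auto simp: Q_def)
        ultimately show "\<exists>g. potential (Q s0 s1 t0 t2) h g"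
          using glue[OF *(1)[of s0 s1] *(2)[of s0 s1]] ss by auto
      qed
    next
      fix t :: real assume local: "0 \<le> t" "t \<le> 1"
      have p: "(s, t) \<in> {0..1} \<times> {0..1}" using s local by simp
      obtain a r where r: "r > 0" "\<And>q. q \<in> {0..1} \<times> {0..1} \<Longrightarrow> dist q (s, t) < r \<Longrightarrow> admissible a (h q)"
        using admissible_nearby[OF CF cont p] by blast
      have "\<exists>g. potential (Q s0 s1 t0 t1) h g"
        if st: "s0 \<le> s \<and> s \<le> s1 \<and> s1 - s0 < r/2" "t0 \<le> t \<and> t \<le> t1 \<and> t1 - t0 < r/2" for s0 s1 t0 t1
      proof -
        have adm: "admissible a (h q)" if q: "q \<in> Q s0 s1 t0 t1" for q
        proof -
          have "dist q (s, t) \<le> \<bar>fst q - s\<bar> + \<bar>snd q - t\<bar>"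
            using norm_Pair_le[of "fst q - s" "snd q - t"] by (cases q) (simp add: dist_norm)
          also have "\<dots> < r" using q st by (auto simp: Q_def abs_if)
          finally show ?thesis using r(2) q Q_sub by blast
        qed
        have "potential (Q s0 s1 t0 t1) h (\<lambda>p. spectral_dim {0..a} (h p))"
          by (rule potential_local[OF CF cont Q_sub adm])
        then show ?thesis by blast
      qed
      moreover have "r/2 > 0" using r(1) by simp
      ultimately show "\<exists>d>0. \<forall>t0 t1. t0 \<le> t \<and> t \<le> t1 \<and> t1 - t0 < d \<longrightarrow>
          (\<exists>\<delta>>0. \<forall>s0 s1. s0 \<le> s \<and> s \<le> s1 \<and> s1 - s0 < \<delta> \<longrightarrow> (\<exists>g. potential (Q s0 s1 t0 t1) h g))"
        by blast
    qed simp
  qed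
  have "\<exists>g. potential (Q 0 1 0 1) h g"
  proof -
    show ?thesis
    proof (rule Bolzano[where a = 0 and b = 1 and P = "\<lambda>s0 s1. \<exists>g. potential (Q s0 s1 0 1) h g"])
      fix s0 s1 s2 :: real
      assume ex: "\<exists>g. potential (Q s0 s1 0 1) h g" "\<exists>g. potential (Q s1 s2 0 1) h g"
        and trans: "s0 \<le> s1" "s1 \<le> s2"
      have "Q s0 s1 0 1 \<inter> Q s1 s2 0 1 = Q s1 s1 0 1" using trans by (auto simp: Q_def)
      moreover have "Q s0 s1 0 1 \<union> Q s1 s2 0 1 = Q s0 s2 0 1" using trans by (auto simp: Q_def)
      ultimately show "\<exists>g. potential (Q s0 s2 0 1) h g" using glue[OF ex] by metis
    qed (simp, rule strip)
  qed
  then show ?thesis by (simp add: Q_def)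
qed

end

theorem theorem3p2:
  fixes scale :: "'k::real_or_complex \<Rightarrow> 'a::{real_inner,banach} \<Rightarrow> 'a"
    and ip :: "'a \<Rightarrow> 'a \<Rightarrow> 'k"
    and h :: "real \<Rightarrow> real \<Rightarrow> ('a \<rightharpoonup> 'a)"
  assumes "separable_hilbert_space scale ip"
    and "\<And>s t. s \<in> {0..1} \<Longrightarrow> t \<in> {0..1} \<Longrightarrow> h s t \<in> hilbert_space.CFsa scale ip"
    and "hilbert_space.gap_continuous_on ip ({0..1} \<times> {0..1}) (\<lambda>(s, t). h s t)"
  shows "hilbert_space.sf scale ip (\<lambda>t. h 0 t) =
    hilbert_space.sf scale ip (\<lambda>s. h s 0) + hilbert_space.sf scale ip (\<lambda>t. h 1 t)
      - hilbert_space.sf scale ip (\<lambda>s. h s 1)"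
proof -
  interpret separable_hilbert_space scale ip by fact
  have CF: "(\<lambda>(s, t). h s t) p \<in> CFsa" if "p \<in> {0..1} \<times> {0..1}" for p
    using assms(2) that by auto
  obtain g where g: "potential ({0..1} \<times> {0..1}) (\<lambda>(s, t). h s t) g"
    using ex_potential_square[OF CF assms(3)] by blast
  have edge: "sf (\<lambda>t. case \<gamma> t of (s, t) \<Rightarrow> h s t) = g (\<gamma> 1) - g (\<gamma> 0)"
    if "continuous_on {0..1} \<gamma>" "\<gamma> ` {0..1} \<subseteq> {0..1} \<times> {0..1}" for \<gamma>
    by (rule sf_eq_potential[OF CF gap_continuous_on_path[OF assms(3) that] potential_path[OF g that]])
      (use that in blast)
  have "sf (\<lambda>t. case (0, t) of (s, t) \<Rightarrow> h s t) = g (0, 1) - g (0, 0)"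
    by (rule edge[of "\<lambda>t. (0, t)"], intro continuous_intros, auto)
  moreover have "sf (\<lambda>s. case (s, 0) of (s, t) \<Rightarrow> h s t) = g (1, 0) - g (0, 0)"
    by (rule edge[of "\<lambda>s. (s, 0)"], intro continuous_intros, auto)
  moreover have "sf (\<lambda>t. case (1, t) of (s, t) \<Rightarrow> h s t) = g (1, 1) - g (1, 0)"
    by (rule edge[of "\<lambda>t. (1, t)"], intro continuous_intros, auto)
  moreover have "sf (\<lambda>s. case (s, 1) of (s, t) \<Rightarrow> h s t) = g (1, 1) - g (0, 1)"
    by (rule edge[of "\<lambda>s. (s, 1)"], intro continuous_intros, auto)
  ultimately show ?thesis by simp
qed

end
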